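(* There is a deterministic algorithm that, given a positive integer $m$ and vectors $A,B \in \mathbb{R}_{\ge 0}^m$, computes their convolution with wraparound $A \star B$ in time $\|A \star B\|_0 \cdot 2^{O(\sqrt{\log \|A \star B\|_0 \cdot \log\log m})}$ (in particular in time $\|A\star B\|_0\cdot m^{o(1)}$).
   Context: For vectors $A,B\in\mathbb{R}^m$ indexed by $\{0,1,\ldots,m-1\}$, the convolution with wraparound is the vector $C=A\star B\in\mathbb{R}^m$ with $C[k]=\sum_{i=0}^{m-1} A[i]\cdot B[(k-i)\bmod m]$. For a vector $x$, $\|x\|_0$ denotes the number of non-zero entries of $x$. *)

theory Defs
  imports Complex_Main "Jordan_Normal_Form.Matrix"
begin

subsection \<open>Vectors\<close>

text \<open>The difference of indices is taken in the integers, since subtraction on the naturals truncates.\<close>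

definition wrap_conv :: "real vec \<Rightarrow> real vec \<Rightarrow> real vec"  (infixl \<open>\<star>\<close> 70) where
  "A \<star> B = (let m = dim_vec A in
     vec m (\<lambda>k. \<Sum>i<m. A $ i * B $ nat ((int k - int i) mod int m)))"

definition nnz :: "real vec \<Rightarrow> nat" where
  "nnz v = card {i. i < dim_vec v \<and> v $ i \<noteq> 0}"

text \<open>Sparse representation: the non-zero entries, each listed once, in any order.\<close>

definition sparse_rep :: "(nat \<times> real) list \<Rightarrow> real vec \<Rightarrow> bool" where
  "sparse_rep xs v \<longleftrightarrow>
     distinct xs \<and> set xs = {(i, v $ i) | i. i < dim_vec v \<and> v $ i \<noteq> 0}"


subsection \<open>Machine model\<close>

text \<open>
  A word RAM with word length \<open>w\<close>, extended by cells holding exact real numbers (real RAM).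
  There are registers and arrays of words and of reals; every array has one cell per word, and
  a program mentions only finitely many of them. Programs are fixed texts that do not depend
  on the input or on \<open>w\<close>. Words are converted to reals at unit cost, but there is no
  conversion in the other direction (no rounding); reals influence words only through
  comparisons.
\<close>

type_synonym vname = string

record state =
  wreg :: "vname \<Rightarrow> nat"
  warr :: "vname \<Rightarrow> nat \<Rightarrow> nat"
  rreg :: "vname \<Rightarrow> real"
  rarr :: "vname \<Rightarrow> nat \<Rightarrow> real"

datatype wexp =
    WConst nat
  | WReg vname
  | WArr vname wexp
  | WAdd wexp wexp
  | WSub wexp wexp
  | WMul wexp wexp
  | WDiv wexp wexp
  | WMod wexp wexp

datatype rexp =
    ROfWord wexp
  | RReg vname
  | RArr vname wexp
  | RAdd rexp rexp
  | RSub rexp rexp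
  | RMul rexp rexp
  | RDiv rexp rexp

datatype bexp =
    WLess wexp wexp
  | WEq wexp wexp
  | RLess rexp rexp
  | REq rexp rexp
  | BNot bexp
  | BAnd bexp bexp

datatype com =
    Skip
  | WAssign vname wexp
  | WStore vname wexp wexp
  | RAssign vname rexp
  | RStore vname wexp rexp
  | Seq com com
  | Cond bexp com com
  | While bexp com

text \<open>
  Word arithmetic is modulo \<open>2 ^ w\<close>. Division by zero, of words or of reals, follows the
  conventions of HOL.
\<close>

primrec wval :: "nat \<Rightarrow> wexp \<Rightarrow> state \<Rightarrow> nat" where
  "wval w (WConst n) s = n mod 2 ^ w"
| "wval w (WReg x) s = wreg s x"
| "wval w (WArr a e) s = warr s a (wval w e s)"
| "wval w (WAdd e f) s = (wval w e s + wval w f s) mod 2 ^ w"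
| "wval w (WSub e f) s = nat ((int (wval w e s) - int (wval w f s)) mod 2 ^ w)"
| "wval w (WMul e f) s = (wval w e s * wval w f s) mod 2 ^ w"
| "wval w (WDiv e f) s = wval w e s div wval w f s"
| "wval w (WMod e f) s = wval w e s mod wval w f s"

primrec rval :: "nat \<Rightarrow> rexp \<Rightarrow> state \<Rightarrow> real" where
  "rval w (ROfWord e) s = real (wval w e s)"
| "rval w (RReg x) s = rreg s x"
| "rval w (RArr a e) s = rarr s a (wval w e s)"
| "rval w (RAdd e f) s = rval w e s + rval w f s"
| "rval w (RSub e f) s = rval w e s - rval w f s"
| "rval w (RMul e f) s = rval w e s * rval w f s"
| "rval w (RDiv e f) s = rval w e s / rval w f s"

primrec bval :: "nat \<Rightarrow> bexp \<Rightarrow> state \<Rightarrow> bool" where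
  "bval w (WLess e f) s \<longleftrightarrow> wval w e s < wval w f s"
| "bval w (WEq e f) s \<longleftrightarrow> wval w e s = wval w f s"
| "bval w (RLess e f) s \<longleftrightarrow> rval w e s < rval w f s"
| "bval w (REq e f) s \<longleftrightarrow> rval w e s = rval w f s"
| "bval w (BNot b) s \<longleftrightarrow> \<not> bval w b s"
| "bval w (BAnd b c) s \<longleftrightarrow> bval w b s \<and> bval w c s"

text \<open>
  \<open>exec w c s t s'\<close>: started in \<open>s\<close>, the program \<open>c\<close> halts in \<open>s'\<close> after \<open>t\<close> steps. Every
  assignment, store and evaluation of a branching condition is one step. The expressions in it
  have a size fixed by the program text, so this agrees with counting single machine operations
  up to a constant factor depending on the program only.
\<close>

inductive exec :: "nat \<Rightarrow> com \<Rightarrow> state \<Rightarrow> nat \<Rightarrow> state \<Rightarrow> bool" for w where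
  Skip: "exec w Skip s 1 s"
| WAssign: "exec w (WAssign x e) s 1 (s\<lparr>wreg := (wreg s)(x := wval w e s)\<rparr>)"
| WStore: "exec w (WStore a e f) s 1
    (s\<lparr>warr := (warr s)(a := (warr s a)(wval w e s := wval w f s))\<rparr>)"
| RAssign: "exec w (RAssign x e) s 1 (s\<lparr>rreg := (rreg s)(x := rval w e s)\<rparr>)"
| RStore: "exec w (RStore a e f) s 1
    (s\<lparr>rarr := (rarr s)(a := (rarr s a)(wval w e s := rval w f s))\<rparr>)"
| Seq: "\<lbrakk>exec w c1 s t1 s'; exec w c2 s' t2 s''\<rbrakk> \<Longrightarrow> exec w (Seq c1 c2) s (t1 + t2) s''"
| CondTrue: "\<lbrakk>bval w b s; exec w c1 s t s'\<rbrakk> \<Longrightarrow> exec w (Cond b c1 c2) s (t + 1) s'"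
| CondFalse: "\<lbrakk>\<not> bval w b s; exec w c2 s t s'\<rbrakk> \<Longrightarrow> exec w (Cond b c1 c2) s (t + 1) s'"
| WhileFalse: "\<not> bval w b s \<Longrightarrow> exec w (While b c) s 1 s"
| WhileTrue: "\<lbrakk>bval w b s; exec w c s t1 s'; exec w (While b c) s' t2 s''\<rbrakk>
    \<Longrightarrow> exec w (While b c) s (t1 + t2 + 1) s''"

lemma exec_deterministic:
  "exec w c s t s' \<Longrightarrow> exec w c s u s'' \<Longrightarrow> t = u \<and> s' = s''"
proof (induction arbitrary: u s'' rule: exec.induct)
  case Seq
  from Seq.prems show ?case by (cases rule: exec.cases) (use Seq.IH in blast)+
next
  case CondTrue
  from CondTrue.prems show ?case
    by (cases rule: exec.cases) (use CondTrue.hyps CondTrue.IH in blast)+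
next
  case CondFalse
  from CondFalse.prems show ?case
    by (cases rule: exec.cases) (use CondFalse.hyps CondFalse.IH in blast)+
next
  case WhileTrue
  from WhileTrue.prems show ?case
    by (cases rule: exec.cases) (use WhileTrue.hyps WhileTrue.IH in blast)+
qed (auto elim: exec.cases)

text \<open>
  Input: the dimension and the two sparse lists, indices in word arrays and values in real
  arrays. All other cells are initially zero. The output is returned in the same format.
\<close>

definition init_state :: "nat \<Rightarrow> (nat \<times> real) list \<Rightarrow> (nat \<times> real) list \<Rightarrow> state" where
  "init_state m xs ys =
    \<lparr>wreg = (\<lambda>_. 0)(''m'' := m, ''lenA'' := length xs, ''lenB'' := length ys),
     warr = (\<lambda>_ _. 0)(
       ''A'' := (\<lambda>i. if i < length xs then fst (xs ! i) else 0),
       ''B'' := (\<lambda>i. if i < length ys then fst (ys ! i) else 0)),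
     rreg = (\<lambda>_. 0),
     rarr = (\<lambda>_ _. 0)(
       ''A'' := (\<lambda>i. if i < length xs then snd (xs ! i) else 0),
       ''B'' := (\<lambda>i. if i < length ys then snd (ys ! i) else 0))\<rparr>"

definition result :: "state \<Rightarrow> (nat \<times> real) list" where
  "result s = map (\<lambda>i. (warr s ''C'' i, rarr s ''C'' i)) [0..<wreg s ''lenC'']"

text \<open>
  \<open>wrap_conv_algorithm c P T\<close>: on words of at least \<open>c * log 2 (m + 1)\<close> bits, i.e. of
  \<open>\<Omega>(log m)\<close> bits, \<open>P\<close> computes \<open>A \<star> B\<close> for all non-negative \<open>A\<close> and \<open>B\<close> of any positive
  dimension \<open>m\<close>, in at most \<open>T m (nnz (A \<star> B))\<close> steps.
\<close>

definition wrap_conv_algorithm :: "nat \<Rightarrow> com \<Rightarrow> (nat \<Rightarrow> nat \<Rightarrow> real) \<Rightarrow> bool" where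
  "wrap_conv_algorithm c P T \<longleftrightarrow>
    (\<forall>m w A B xs ys.
       m > 0 \<longrightarrow> (m + 1) ^ c \<le> 2 ^ w \<longrightarrow>
       A \<in> carrier_vec m \<longrightarrow> B \<in> carrier_vec m \<longrightarrow>
       (\<forall>i<m. A $ i \<ge> 0) \<longrightarrow> (\<forall>i<m. B $ i \<ge> 0) \<longrightarrow>
       sparse_rep xs A \<longrightarrow> sparse_rep ys B \<longrightarrow>
       (\<exists>t s. exec w P (init_state m xs ys) t s \<and>
          sparse_rep (result s) (A \<star> B) \<and>
          real t \<le> T m (nnz (A \<star> B))))"

end

theory Submission
  imports Defs "HOL-Computational_Algebra.Primes" "HOL-Computational_Algebra.Polynomial"
    "HOL-Real_Asymp.Real_Asymp"
begin

text \<open>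
  Write \<open>n\<close> for the number of non-zero entries of the output. Because the entries are non-negative
  there is no cancellation, so the support of the result is the sumset of the supports and both
  inputs have at most \<open>n\<close> non-zero entries. If they have at most \<open>log m\<close> of them, the quadratic
  algorithm is fast enough, since then their number is at most \<open>2 powr sqrt (log n * log (log m))\<close>.

  Otherwise the unwrapped convolution is computed at the scales \<open>2 ^ l\<close>, \<open>l\<close> decreasing, all indices
  being divided by \<open>2 ^ l\<close>. If \<open>S\<close> is the support at scale \<open>2 * q\<close>, the support at scale \<open>q\<close> is
  contained in \<open>{2 * k + e | k \<in> S, e \<le> 2}\<close>, so there are only \<open>O(n)\<close> candidates. Their values are
  recovered in \<open>O(log n)\<close> rounds. In each round, moduli \<open>p\<^sub>0, p\<^sub>1, \<dots> \<le> U\<close> are chosen greedily such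
  that \<open>x \<mapsto> (x mod p\<^sub>0, x mod p\<^sub>1, \<dots>)\<close> isolates at least half of the unresolved candidates. A prime
  modulus multiplying the number of collisions by \<open>O(log m * log U / U)\<close> exists, because a non-zero
  difference has fewer than \<open>log m + 2\<close> prime divisors, whereas there are \<open>\<Omega>(U / log U)\<close> primes up to
  \<open>U\<close>. The convolution is then a multivariate polynomial product of degree below \<open>W = 2 * U\<close> in each
  variable. It is evaluated on the grid \<open>{0..<W} ^ d\<close>, one axis after the other, multiplied pointwise,
  and interpolated back, folding each axis modulo its \<open>p\<close>.

  With \<open>U = 2 ^ (5 * s)\<close> and \<open>s\<close> about \<open>sqrt (log n * log (log m))\<close> the grid has \<open>n * 2 ^ O(s)\<close> points:
  each of the \<open>O(s / log (log m))\<close> axes wastes only a factor polylogarithmic in \<open>m\<close>.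
\<close>


subsection \<open>Prime counting\<close>

text \<open>A choice of moduli can be tested for collisions only against known positions, but the
  support of the output is unknown: this is the purpose of the scales, where the coarser level
  supplies the candidates. As these are explicit, every modulus up to \<open>U\<close> can be tried,
  which keeps the algorithm deterministic at a cost of about \<open>U\<close> per candidate and
  axis. Recovered values are subtracted from the hashed output, so each round concerns the
  unresolved candidates only.

  The size of \<open>U\<close> is a balance. A factor polynomial in \<open>U\<close> is paid in any
  case, and every axis loses the ratio between its length \<open>W\<close> and the factor
  \<open>R\<close> by which it thins the collisions, a power of \<open>log m\<close>. Larger moduli
  mean fewer axes; with \<open>s * s\<close> about \<open>log n * log (log m)\<close> both losses
  are \<open>2 ^ O(s)\<close>. The number \<open>n\<close> is unknown to the program, but the length
  \<open>N\<close> of the longer input satisfies \<open>N \<le> n \<le> N * N\<close>, so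
  \<open>log N\<close> replaces \<open>log n\<close> up to a factor of two.

  The reals contain no suitable roots of unity, hence evaluation at the integers below
  \<open>W\<close> and exact Lagrange interpolation; the factor \<open>W\<close> per entry is
  affordable.\<close>

lemma leibniz_triangle:
  fixes n k :: nat
  assumes "1 \<le> k" "k < n"
  shows "1 / real (Suc k * (n choose Suc k)) =
    1 / real (k * ((n - 1) choose k)) - 1 / real (k * (n choose k))"
proof -
  obtain n' where n: "n = Suc n'" using assms by (cases n) auto
  define c where "c = real (n choose k)"
  have c: "c > 0" using assms by (simp add: c_def zero_less_binomial_iff)
  have "k \<le> n'" using assms n by simp
  have *: "real (n' choose k) = c * real (n - k) / real n"
    using binomial_absorb_comp[of n k] n
    by (simp add: c_def field_simps flip: of_nat_mult)
  have **: "real (Suc k * (n choose Suc k)) = c * real (n - k)"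
    using binomial_absorption[of k n] binomial_absorb_comp[of n k]
    by (simp add: c_def algebra_simps flip: of_nat_mult)
  have nk: "real (n - k) = real n - real k" using assms by simp
  have "real n - real k > 0" "real k > 0" "real n > 0" using assms by auto
  then have "1 / (c * (real n - real k)) = 1 / (real k * (c * (real n - real k) / real n)) - 1 / (real k * c)"
    using c by (simp add: field_simps)
  then show ?thesis unfolding ** nk[symmetric] using * n by (simp add: c_def)
qed

text \<open>The numbers \<open>1 / (k * (n choose k))\<close> form the Leibniz harmonic triangle,
  and \<open>leibniz_triangle\<close> is its recurrence. The edge entries \<open>1 / n\<close>
  become integers when multiplied by a common multiple of \<open>1, ..., N\<close>, and differences
  of integers are integers, so \<open>L\<close> is a multiple of \<open>k * (N choose k)\<close>.
  This is Nair's route to lower bounds on least common multiples.\<close>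

lemma common_multiple_ge_binomial:
  fixes L :: nat
  assumes L: "L > 0" and dvd: "\<And>i. 1 \<le> i \<Longrightarrow> i \<le> N \<Longrightarrow> i dvd L"
    and k: "1 \<le> k" "k \<le> N"
  shows "k * (N choose k) \<le> L"
proof -
  have "real L * (1 / real (k * (n choose k))) \<in> \<int>" if "k \<le> n" "n \<le> N" for n
    using k(1) that
  proof (induction k arbitrary: n rule: dec_induct)
    case base
    then show ?case using dvd[of n] by (auto simp: dvd_def)
  next
    case (step k)
    have "real L * (1 / real (k * ((n - 1) choose k))) \<in> \<int>" "real L * (1 / real (k * (n choose k))) \<in> \<int>"
      using step by auto
    then have "real L * (1 / real (k * ((n - 1) choose k))) - real L * (1 / real (k * (n choose k))) \<in> \<int>"
      by (rule Ints_diff)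
    moreover have "real L * (1 / real (Suc k * (n choose Suc k))) =
      real L * (1 / real (k * ((n - 1) choose k))) - real L * (1 / real (k * (n choose k)))"
      using leibniz_triangle[of k n] step by (simp add: right_diff_distrib)
    ultimately show ?case by simp
  qed
  then have "real L / real (k * (N choose k)) \<in> \<int>" using k by simp
  then obtain z where z: "real L / real (k * (N choose k)) = of_int z" by (auto elim: Ints_cases)
  have pos: "real (k * (N choose k)) > 0" using k by (simp add: zero_less_binomial_iff)
  then have "real_of_int z > 0" using z L by (metis divide_pos_pos of_nat_0_less_iff)
  then have "real_of_int z \<ge> 1" by simp
  then have "1 \<le> real L / real (k * (N choose k))" unfolding z .
  then have "real (k * (N choose k)) \<le> real L" using pos by (subst (asm) le_divide_eq) (simp split: if_splits)
  then show ?thesis by linarith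
qed

text \<open>Chebyshev's lower bound without logarithms. \<open>L\<close> is the least common
  multiple of \<open>1, ..., 2 * j\<close>, a product of one prime power at most
  \<open>2 * j\<close> per prime, while the central binomial coefficient bounds it from
  below.\<close>

lemma power_card_primes_ge:
  assumes "j \<ge> 1"
  shows "4 ^ j \<le> 2 * (2 * j) ^ card {p::nat. prime p \<and> p \<le> 2 * j}"
proof -
  define n where "n = 2 * j"
  define S where "S = {p::nat. prime p \<and> p \<le> n}"
  define e where "e p = Max {e. p ^ e \<le> n}" for p :: nat
  define L where "L = (\<Prod>p\<in>S. p ^ e p)"
  have finS: "finite S" by (rule finite_subset[of _ "{..n}"]) (auto simp: S_def)
  have fin: "finite {e. p ^ e \<le> n}" if "prime p" for p :: nat
  proof (rule finite_subset[of _ "{..n}"])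
    show "{e. p ^ e \<le> n} \<subseteq> {..n}"
      using that by (auto dest!: prime_gt_1_nat) (meson le_trans less_imp_le less_exp order.trans power_gt_expt)
  qed simp
  have le: "p ^ e p \<le> n" if "prime p" for p
  proof -
    have "e p \<in> {e. p ^ e \<le> n}"
      unfolding e_def using assms by (intro Max_in fin that) (auto simp: n_def intro!: exI[of _ 0])
    then show ?thesis by simp
  qed
  have dvd: "i dvd L" if "1 \<le> i" "i \<le> n" for i
  proof (rule multiplicity_le_imp_dvd)
    show "i \<noteq> 0" using that by simp
    fix p :: nat assume p: "prime p"
    have "p ^ multiplicity p i \<le> n"
      using dvd_imp_le[OF multiplicity_dvd[of p i]] that by linarith
    then have "multiplicity p i \<le> e p" unfolding e_def using fin[OF p] by (intro Max_ge) auto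
    show "multiplicity p i \<le> multiplicity p L"
    proof (cases "p \<le> n")
      case True
      then have "p ^ e p dvd L" using p finS unfolding L_def by (intro dvd_prodI) (auto simp: S_def)
      moreover have "L \<noteq> 0" using finS by (auto simp: L_def S_def)
      ultimately have "e p \<le> multiplicity p L" using p by (intro multiplicity_geI) auto
      then show ?thesis using \<open>multiplicity p i \<le> e p\<close> by simp
    next
      case False
      then have "\<not> p dvd i" using that by (auto dest: dvd_imp_le)
      then show ?thesis by (simp add: not_dvd_imp_multiplicity_0)
    qed
  qed
  have Lpos: "L > 0" using finS by (auto simp: L_def S_def prime_gt_0_nat intro!: prod_pos)
  have "j * (n choose j) \<le> L"
    using assms by (intro common_multiple_ge_binomial Lpos dvd) (auto simp: n_def)
  moreover have "L \<le> n ^ card S"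
  proof -
    have "L \<le> (\<Prod>p\<in>S. n)" unfolding L_def using le by (intro prod_mono) (auto simp: S_def)
    then show ?thesis by simp
  qed
  ultimately have "j * (n choose j) \<le> n ^ card S" by simp
  then have "real j * real (n choose j) \<le> real (n ^ card S)"
    by (metis of_nat_le_iff of_nat_mult)
  moreover have "4 ^ j / (2 * real j) \<le> real (n choose j)"
    unfolding n_def using central_binomial_lower_bound[of j] assms by simp
  then have "4 ^ j \<le> 2 * (real j * real (n choose j))" using assms by (simp add: field_simps)
  ultimately have "real (4 ^ j) \<le> real (2 * n ^ card S)" by simp
  then have "4 ^ j \<le> 2 * n ^ card S" by (simp only: of_nat_le_iff)
  then show ?thesis by (simp add: n_def S_def)
qed

text \<open>With \<open>j = 2 ^ (u - 1)\<close> both sides of the preceding bound are powers of two,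
  so comparing exponents counts the primes.\<close>

lemma card_primes_le_power_of_two:
  assumes "u \<ge> 1"
  shows "2 ^ u - 1 \<le> u * card {p::nat. prime p \<and> p \<le> 2 ^ u}"
proof -
  obtain v where v: "u = Suc v" using assms by (cases u) auto
  have "(4::nat) ^ 2 ^ v \<le> 2 * (2 * 2 ^ v) ^ card {p::nat. prime p \<and> p \<le> 2 * 2 ^ v}"
    by (rule power_card_primes_ge) simp
  also have "(4::nat) ^ 2 ^ v = 2 ^ 2 ^ u"
    by (simp add: v power_mult flip: power2_eq_square)
  also have "2 * (2 * 2 ^ v) ^ card {p::nat. prime p \<and> p \<le> 2 * 2 ^ v} =
    (2::nat) ^ Suc (u * card {p::nat. prime p \<and> p \<le> 2 ^ u})"
    by (simp only: v power_Suc power_mult)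
  finally have "2 ^ u \<le> Suc (u * card {p::nat. prime p \<and> p \<le> 2 ^ u})"
    by (subst (asm) power_increasing_iff) auto
  then show ?thesis by simp
qed

section \<open>Prime divisors of differences and an averaging argument\<close>

lemma prod_coprime_dvd:
  fixes z :: nat
  assumes "finite S" "\<And>p. p \<in> S \<Longrightarrow> p dvd z" "\<And>p q. p \<in> S \<Longrightarrow> q \<in> S \<Longrightarrow> p \<noteq> q \<Longrightarrow> coprime p q"
  shows "\<Prod>S dvd z"
  using assms
proof (induction S)
  case (insert p S)
  then have "coprime p (\<Prod>S)" by (intro prod_coprime_right) auto
  with insert show ?case by (auto intro!: divides_mult)
qed simp

text \<open>The product of the distinct primes dividing \<open>z\<close> divides \<open>z\<close>,
  and each of them is at least two.\<close>

lemma card_prime_divisors_less: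
  assumes "0 < z" "z < 2 ^ L"
  shows "card {p::nat. prime p \<and> p \<le> U \<and> p dvd z} < L"
proof -
  let ?S = "{p::nat. prime p \<and> p \<le> U \<and> p dvd z}"
  have fin: "finite ?S" by (rule finite_subset[of _ "{..U}"]) auto
  have "2 ^ card ?S = (\<Prod>p\<in>?S. 2::nat)" by simp
  also have "\<dots> \<le> \<Prod>?S" by (rule prod_mono) (auto dest: prime_ge_2_nat)
  also have "\<Prod>?S \<le> z"
  proof (rule dvd_imp_le)
    show "\<Prod>?S dvd z"
      by (rule prod_coprime_dvd[OF fin]) (auto simp: primes_coprime)
  qed (use assms in simp)
  finally have "2 ^ card ?S < (2::nat) ^ L" using assms by linarith
  then show ?thesis by (rule power_less_imp_less_exp[rotated]) simp
qed

text \<open>Double counting of pairs of a prime and a multiple. Each \<open>z x\<close> has fewer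
  than \<open>L\<close> prime divisors, so the primes up to \<open>U\<close>, at least
  \<open>R * L\<close> in number, divide on average at most a fraction \<open>1 / R\<close> of the
  family.\<close>

lemma exists_prime_few_multiples:
  fixes z :: "'a \<Rightarrow> nat"
  assumes D: "finite D" and z: "\<And>x. x \<in> D \<Longrightarrow> 0 < z x \<and> z x < 2 ^ L"
    and card: "R * L \<le> card {p::nat. prime p \<and> p \<le> U}" and RL: "R * L > 0"
  shows "\<exists>p. prime p \<and> p \<le> U \<and> card {x \<in> D. p dvd z x} * R \<le> card D"
proof (rule ccontr)
  assume neg: "\<not> ?thesis"
  let ?P = "{p::nat. prime p \<and> p \<le> U}"
  have fin: "finite ?P" by (rule finite_subset[of _ "{..U}"]) auto
  \<comment> \<open>The successor keeps the assumed failure strict; the count below contradicts it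
    because \<open>R * L\<close> is positive.\<close>
  have "card ?P * Suc (card D) = (\<Sum>p\<in>?P. Suc (card D))" by simp
  also have "\<dots> \<le> (\<Sum>p\<in>?P. card {x \<in> D. p dvd z x} * R)"
    using neg by (intro sum_mono) (auto simp: not_le Suc_le_eq)
  also have "\<dots> = R * (\<Sum>p\<in>?P. \<Sum>x\<in>D. if p dvd z x then 1 else 0)"
    using D by (simp add: sum_distrib_left mult.commute sum.If_cases Int_def)
  also have "(\<Sum>p\<in>?P. \<Sum>x\<in>D. if p dvd z x then 1 else (0::nat)) = (\<Sum>x\<in>D. card {p::nat. prime p \<and> p \<le> U \<and> p dvd z x})"
    using fin by (subst sum.swap) (simp add: sum.If_cases Int_def conj_ac)
  also have "\<dots> \<le> (\<Sum>x\<in>D. L)"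
    using card_prime_divisors_less z by (intro sum_mono) (simp add: less_imp_le)
  finally have "card ?P * Suc (card D) \<le> R * L * card D" by (simp add: mult_ac)
  moreover have "R * L * Suc (card D) \<le> card ?P * Suc (card D)" using card by (rule mult_le_mono1)
  ultimately show False using RL by simp
qed

subsection \<open>Mixed-radix digits, tensors and interpolation\<close>

definition digit :: "nat \<Rightarrow> nat \<Rightarrow> nat \<Rightarrow> nat" where
  "digit W u i = i div W ^ u mod W"

text \<open>High part, new digit and low part are added up without any subtraction, the form in
  which \<open>axis_com\<close> computes addresses on words.\<close>

definition set_digit :: "nat \<Rightarrow> nat \<Rightarrow> nat \<Rightarrow> nat \<Rightarrow> nat" where
  "set_digit W a r i = i div W ^ Suc a * W ^ Suc a + r * W ^ a + i mod W ^ a"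

lemma digit_add_high:
  assumes "u < a"
  shows "digit W u (x + y * W ^ a) = digit W u x"
proof (cases "W = 0")
  case False
  have a: "W ^ a = W * W ^ (a - Suc u) * W ^ u" using assms
    by (metis Suc_diff_Suc add_diff_inverse_nat less_imp_le not_less power_Suc power_add mult.commute)
  have "(x + y * W ^ a) div W ^ u = (x + (y * (W * W ^ (a - Suc u))) * W ^ u) div W ^ u"
    unfolding a by (simp add: mult_ac)
  also have "\<dots> = x div W ^ u + W * (y * W ^ (a - Suc u))"
    using False by (subst div_mult_self1) (simp_all add: mult_ac)
  finally show ?thesis by (simp add: digit_def)
qed (use assms in \<open>simp add: digit_def zero_power\<close>)

lemma digit_mod_power: "u < a \<Longrightarrow> digit W u (i mod W ^ a) = digit W u i"
  using digit_add_high[of u a W "i mod W ^ a" "i div W ^ a"] by (simp add: mod_div_mult_eq)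

lemma digit_less: "W > 0 \<Longrightarrow> digit W u i < W"
  by (simp add: digit_def)

lemma digit_set_digit:
  assumes r: "r < W"
  shows "digit W u (set_digit W a r i) = (if u = a then r else digit W u i)"
proof -
  have W: "W > 0" using r by simp
  define h where "h = i div W ^ Suc a"
  have s: "set_digit W a r i = i mod W ^ a + (h * W + r) * W ^ a"
    by (simp add: set_digit_def h_def algebra_simps)
  have lo: "i mod W ^ a < W ^ a" using W by simp
  have d: "set_digit W a r i div W ^ a = h * W + r"
    unfolding s using lo W by (subst div_mult_self1) (auto simp: div_mult_self1)
  consider "u < a" | "u = a" | "u > a" by linarith
  then show ?thesis
  proof cases
    case 1
    then show ?thesis unfolding s by (simp add: digit_add_high digit_mod_power)
  next
    case 2
    then show ?thesis using d r by (simp add: digit_def)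
  next
    case 3
    then obtain v where v: "u = Suc a + v" by (metis less_iff_Suc_add add_Suc)
    have "set_digit W a r i div W ^ Suc a = h"
      using d r by (metis div_mult2_eq div_mult_self3 W add.commute add_cancel_right_right div_less mult.commute not_less0 power_Suc2 power_Suc)
    then have "set_digit W a r i div W ^ u = i div W ^ u"
      unfolding v power_add div_mult2_eq h_def by simp
    then show ?thesis using 3 by (simp add: digit_def)
  qed
qed

lemma set_digit_less:
  assumes "r < W" "a < d" "i < W ^ d"
  shows "set_digit W a r i < W ^ d"
proof -
  have W: "W > 0" using assms by simp
  define e where "e = d - Suc a"
  have d: "W ^ d = W ^ Suc a * W ^ e" using assms(2) by (simp add: e_def flip: power_add power_Suc)
  have h: "i div W ^ Suc a < W ^ e"
    using assms(3) unfolding d by (metis less_mult_imp_div_less mult.commute)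
  have "r * W ^ a + i mod W ^ a < Suc r * W ^ a" using W by simp
  also have "\<dots> \<le> W * W ^ a" using assms(1) by (intro mult_le_mono1) simp
  finally have "r * W ^ a + i mod W ^ a < W ^ Suc a" by simp
  then have "set_digit W a r i < Suc (i div W ^ Suc a) * W ^ Suc a" by (simp add: set_digit_def)
  also have "\<dots> \<le> W ^ e * W ^ Suc a" using h by (intro mult_le_mono1) simp
  finally show ?thesis by (simp add: d mult.commute)
qed

lemma digit_sum_less:
  fixes c :: "nat \<Rightarrow> nat"
  assumes "\<And>u. u < d \<Longrightarrow> c u < W"
  shows "(\<Sum>u<d. c u * W ^ u) < W ^ d"
  using assms
proof (induction d)
  case (Suc d)
  have "(\<Sum>u<Suc d. c u * W ^ u) < Suc (c d) * W ^ d" using Suc by simp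
  also have "\<dots> \<le> W * W ^ d" using Suc.prems[of d] by (intro mult_le_mono1) simp
  finally show ?case by simp
qed simp

lemma digit_digit_sum:
  fixes c :: "nat \<Rightarrow> nat"
  assumes "\<And>u. u < d \<Longrightarrow> c u < W" "u < d"
  shows "digit W u (\<Sum>u<d. c u * W ^ u) = c u"
  using assms
proof (induction d)
  case (Suc d)
  show ?case
  proof (cases "u = d")
    case True
    have "(\<Sum>u<d. c u * W ^ u) < W ^ d" using Suc.prems by (intro digit_sum_less) auto
    then show ?thesis using True Suc.prems(1)[of d] by (simp add: digit_def)
  next
    case False
    then show ?thesis using Suc by (simp add: digit_add_high)
  qed
qed simp

lemma mod_power_eq_digit_sum: "i mod W ^ d = (\<Sum>u<d. digit W u i * W ^ u)"
proof (induction d)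
  case (Suc d)
  have "i mod (W ^ d * W) = W ^ d * (i div W ^ d mod W) + i mod W ^ d" by (rule mod_mult2_eq)
  then show ?case using Suc by (simp add: digit_def mult_ac)
qed simp

lemma digit_sum_eq_iff:
  fixes c :: "nat \<Rightarrow> nat"
  assumes "\<And>u. u < d \<Longrightarrow> c u < W" "i < W ^ d"
  shows "(\<Sum>u<d. c u * W ^ u) = i \<longleftrightarrow> (\<forall>u<d. c u = digit W u i)"
  using digit_digit_sum[of d c W] mod_power_eq_digit_sum[of i W d] assms by auto

text \<open>The residues of \<open>x\<close> are the base \<open>W\<close> digits of one array
  address. All axes share the radix \<open>W\<close> instead of \<open>P u\<close>, because each
  needs room for \<open>W\<close> evaluation points; appending a modulus just adds a new top
  digit.\<close>

definition mkey :: "nat \<Rightarrow> (nat \<Rightarrow> nat) \<Rightarrow> nat \<Rightarrow> nat \<Rightarrow> nat" where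
  "mkey W P d x = (\<Sum>u<d. (x mod P u) * W ^ u)"

lemma mkey_0 [simp]: "mkey W P 0 x = 0"
  and mkey_Suc: "mkey W P (Suc d) x = mkey W P d x + x mod P d * W ^ d"
  by (simp_all add: mkey_def)

lemma mkey_cong: "(\<And>u. u < d \<Longrightarrow> P u = P' u) \<Longrightarrow> mkey W P d x = mkey W P' d x"
  by (simp add: mkey_def)

definition moduli :: "nat \<Rightarrow> (nat \<Rightarrow> nat) \<Rightarrow> nat \<Rightarrow> bool" where
  "moduli U P d \<longleftrightarrow> (\<forall>u<d. 0 < P u \<and> P u \<le> U)"

lemma mkey_less:
  assumes "moduli U P d" "U \<le> W"
  shows "mkey W P d x < W ^ d"
  unfolding mkey_def using assms
  by (intro digit_sum_less) (metis less_le_trans mod_less_divisor moduli_def order.trans)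

lemma mkey_eq_iff:
  assumes "moduli U P d" "U \<le> W" "i < W ^ d"
  shows "mkey W P d x = i \<longleftrightarrow> (\<forall>u<d. x mod P u = digit W u i)"
  unfolding mkey_def using assms
  by (intro digit_sum_eq_iff) (metis less_le_trans mod_less_divisor moduli_def order.trans)+

lemma mkey_eq_mkey_iff:
  assumes "moduli U P d" "U \<le> W"
  shows "mkey W P d x = mkey W P d y \<longleftrightarrow> (\<forall>u<d. x mod P u = y mod P u)"
proof -
  have "digit W u (mkey W P d y) = y mod P u" if "u < d" for u
    unfolding mkey_def using assms that
    by (intro digit_digit_sum[where c = "\<lambda>u. y mod P u"])
       (metis less_le_trans mod_less_divisor moduli_def order.trans)
  then show ?thesis using mkey_eq_iff[OF assms mkey_less[OF assms, of y], of x] by auto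
qed

text \<open>A sum of rank-one tensors of order \<open>d\<close>, flattened: term \<open>k\<close>
  has weight \<open>v k\<close> and factor \<open>F u k\<close> along axis \<open>u\<close>. The
  contents of the hash arrays have this form at every stage, and a transform along one axis changes
  only the factors of that axis.\<close>

definition tensor ::
  "nat \<Rightarrow> nat \<Rightarrow> 'k set \<Rightarrow> ('k \<Rightarrow> real) \<Rightarrow> (nat \<Rightarrow> 'k \<Rightarrow> nat \<Rightarrow> real) \<Rightarrow> nat \<Rightarrow> real" where
  "tensor W d I v F i = (\<Sum>k\<in>I. v k * (\<Prod>u<d. F u k (digit W u i)))"

lemma tensor_cong:
  assumes "W > 0" "\<And>u k e. u < d \<Longrightarrow> k \<in> I \<Longrightarrow> e < W \<Longrightarrow> F u k e = G u k e"
  shows "tensor W d I v F i = tensor W d I v G i"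
  unfolding tensor_def using assms by (intro sum.cong arg_cong2[of _ _ _ _ "(*)"] prod.cong refl) (auto simp: digit_less)

text \<open>The indices \<open>set_digit W a r i\<close> run through the fibre of \<open>i\<close>
  along axis \<open>a\<close>. The factors of the other axes are constant on it and can be taken out
  of the sum.\<close>

lemma tensor_axis:
  assumes W: "W > 0" and a: "a < d"
  shows "(\<Sum>r<W. M (digit W a i) r * tensor W d I v F (set_digit W a r i)) =
    tensor W d I v (F(a := \<lambda>k e. \<Sum>r<W. M e r * F a k r)) i"
proof -
  let ?c = "\<lambda>k. \<Prod>u\<in>{..<d} - {a}. F u k (digit W u i)"
  have 1: "(\<Prod>u<d. F u k (digit W u (set_digit W a r i))) = F a k r * ?c k" if "r < W" for k r
  proof -
    have "(\<Prod>u<d. F u k (digit W u (set_digit W a r i))) =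
      (\<Prod>u<d. F u k (if u = a then r else digit W u i))"
      using that by (simp add: digit_set_digit)
    also have "\<dots> = F a k r * (\<Prod>u\<in>{..<d} - {a}. F u k (if u = a then r else digit W u i))"
      using a by (subst prod.remove[of _ a]) auto
    also have "(\<Prod>u\<in>{..<d} - {a}. F u k (if u = a then r else digit W u i)) = ?c k"
      by (rule prod.cong) auto
    finally show ?thesis .
  qed
  have 2: "(\<Prod>u<d. (F(a := \<lambda>k e. \<Sum>r<W. M e r * F a k r)) u k (digit W u i)) =
     (\<Sum>r<W. M (digit W a i) r * F a k r) * ?c k" for k
    using a by (subst prod.remove[of _ a]) (auto intro!: prod.cong)
  have "(\<Sum>r<W. M (digit W a i) r * tensor W d I v F (set_digit W a r i)) =
    (\<Sum>r<W. \<Sum>k\<in>I. v k * (M (digit W a i) r * F a k r * ?c k))"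
    unfolding tensor_def by (simp add: 1 sum_distrib_left mult_ac)
  also have "\<dots> = (\<Sum>k\<in>I. \<Sum>r<W. v k * (M (digit W a i) r * F a k r * ?c k))" by (rule sum.swap)
  also have "\<dots> = tensor W d I v (F(a := \<lambda>k e. \<Sum>r<W. M e r * F a k r)) i"
    unfolding tensor_def 2 by (simp add: sum_distrib_left sum_distrib_right mult_ac)
  finally show ?thesis .
qed

lemma prod_of_bool: "finite S \<Longrightarrow> (\<Prod>u\<in>S. if Q u then 1 else (0::real)) = (if \<forall>u\<in>S. Q u then 1 else 0)"
  by (induction S rule: finite_induct) auto

text \<open>The product of the indicators of the single digits is the indicator of the whole key, so
  hashing amounts to summing weighted unit tensors.\<close>

lemma tensor_mkey:
  assumes "moduli U P d" "U \<le> W" "i < W ^ d" "finite I"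
  shows "tensor W d I v (\<lambda>u k e. if x k mod P u = e then 1 else 0) i =
    (\<Sum>k\<in>I. if mkey W P d (x k) = i then v k else 0)"
  unfolding tensor_def
  by (intro sum.cong refl) (auto simp: prod_of_bool mkey_eq_iff[OF assms(1-3)])

text \<open>The Lagrange basis polynomial of node \<open>e\<close> for the nodes below
  \<open>L\<close>. It makes sense also for \<open>L \<le> e\<close>, so that the linear factors can
  be multiplied in one by one, with the node \<open>e\<close> itself skipped.\<close>

definition lagrange_poly :: "nat \<Rightarrow> nat \<Rightarrow> real poly" where
  "lagrange_poly L e = (\<Prod>l\<in>{..<L} - {e}. smult (1 / (real e - real l)) [:- real l, 1:])"

lemma lagrange_poly_0: "lagrange_poly 0 e = 1"
  by (simp add: lagrange_poly_def)

lemma lagrange_poly_Suc_same: "lagrange_poly (Suc e) e = lagrange_poly e e"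
proof -
  have "{..<Suc e} - {e} = {..<e} - {e}" by auto
  then show ?thesis unfolding lagrange_poly_def by simp
qed

lemma lagrange_poly_Suc:
  assumes "L \<noteq> e"
  shows "lagrange_poly (Suc L) e = smult (1 / (real e - real L)) ([:- real L, 1:] * lagrange_poly L e)"
proof -
  have *: "{..<Suc L} - {e} = insert L ({..<L} - {e})" using assms by auto
  show ?thesis unfolding lagrange_poly_def * by (subst prod.insert) (simp_all only: mult_smult_left, auto)
qed

text \<open>Multiplication by \<open>(X - L) / (e - L)\<close> read on coefficients; this is the
  update performed by the inner loop of \<open>lagrange_com\<close>.\<close>

lemma coeff_lagrange_poly_Suc:
  assumes "L \<noteq> e"
  shows "coeff (lagrange_poly (Suc L) e) k =
    ((if k = 0 then 0 else coeff (lagrange_poly L e) (k - 1)) - real L * coeff (lagrange_poly L e) k) / (real e - real L)"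
  unfolding lagrange_poly_Suc[OF assms]
  by (cases k) (simp_all add: coeff_pCons algebra_simps diff_divide_distrib)

lemma degree_lagrange_poly:
  assumes "e < W"
  shows "degree (lagrange_poly W e) < W"
proof -
  have "degree (lagrange_poly W e) \<le> (\<Sum>l\<in>{..<W} - {e}. degree (smult (1 / (real e - real l)) [:- real l, 1:]))"
    unfolding lagrange_poly_def by (rule order.trans[OF degree_prod_sum_le]) (simp_all add: o_def)
  also have "\<dots> \<le> (\<Sum>l\<in>{..<W} - {e}. 1)" by (intro sum_mono) (simp add: degree_smult_le)
  also have "\<dots> < W" using assms by simp
  finally show ?thesis .
qed

lemma poly_lagrange_poly:
  assumes "e < W" "x < W"
  shows "poly (lagrange_poly W e) (real x) = (if x = e then 1 else 0)"
proof -
  have "poly (lagrange_poly W e) (real x) = (\<Prod>l\<in>{..<W} - {e}. (real x - real l) / (real e - real l))"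
    unfolding lagrange_poly_def poly_prod by (intro prod.cong) (auto simp: diff_divide_distrib)
  moreover have "\<dots> = (if x = e then 1 else 0)"
    using assms by (cases "x = e") (auto intro!: prod.neutral prod_zero bexI[of _ x])
  ultimately show ?thesis by simp
qed

text \<open>Interpolating \<open>X ^ r\<close> at \<open>W\<close> nodes gives back
  \<open>X ^ r\<close>, since the difference has degree below \<open>W\<close> and \<open>W\<close>
  roots. In matrix form, the coefficients of the Lagrange basis invert the Vandermonde
  matrix.\<close>

lemma lagrange_interpolation_coeff:
  assumes r: "r < W"
  shows "(\<Sum>e<W. coeff (lagrange_poly W e) k * real e ^ r) = (if k = r then 1 else 0)"
proof -
  define q where "q = (\<Sum>e<W. smult (real e ^ r) (lagrange_poly W e)) - monom 1 r"
  have "degree (\<Sum>e<W. smult (real e ^ r) (lagrange_poly W e)) < W"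
    using r by (intro degree_sum_less) (auto intro: degree_lagrange_poly)
  then have deg: "degree q < W"
    unfolding q_def using r by (intro degree_diff_less) (auto simp: degree_monom_eq)
  have "poly q (real x) = 0" if "x < W" for x
  proof -
    have "(\<Sum>e<W. real e ^ r * poly (lagrange_poly W e) (real x)) = (\<Sum>e<W. if e = x then real x ^ r else 0)"
      using that by (intro sum.cong) (auto simp: poly_lagrange_poly)
    then show ?thesis using that by (simp add: q_def poly_sum poly_monom)
  qed
  then have "real ` {..<W} \<subseteq> {x. poly q x = 0}" by auto
  moreover have "card (real ` {..<W}) = W" by (simp add: card_image inj_on_def)
  ultimately have "q = 0"
    using card_poly_roots_bound[of q] card_mono[OF poly_roots_finite[of q], of "real ` {..<W}"] deg by fastforce
  then have "coeff q k = 0" by simp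
  then show ?thesis by (simp add: q_def coeff_sum mult.commute split: if_splits)
qed

text \<open>The exponent \<open>r\<close> will be a sum of two residues modulo \<open>p\<close>,
  hence at most \<open>2 * p - 2\<close>, and the \<open>W = 2 * U\<close> nodes determine such a
  monomial. Reducing exponents modulo \<open>p\<close> adds coefficient \<open>k + p\<close> to
  coefficient \<open>k\<close>, so interpolation and reduction together are one matrix.\<close>

lemma folded_interpolation:
  assumes p: "0 < p" "p \<le> U" and W: "W = 2 * U" and r: "r < 2 * p - 1"
  shows "(\<Sum>e<W. (if k < p then coeff (lagrange_poly W e) k + coeff (lagrange_poly W e) (k + p) else 0) * real e ^ r) =
    (if r mod p = k then 1 else 0)"
proof (cases "k < p")
  case True
  have rW: "r < W" using assms by simp
  have "r mod p = k \<longleftrightarrow> k = r \<or> k + p = r"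
  proof (cases "r < p")
    case False
    then have "r mod p = r - p" using r by (simp add: mod_if)
    then show ?thesis using False True by auto
  qed (use True in auto)
  then show ?thesis
    using True p lagrange_interpolation_coeff[OF rW, of k] lagrange_interpolation_coeff[OF rW, of "k + p"]
    by (auto simp: distrib_right sum.distrib)
next
  case False
  then have "r mod p \<noteq> k" using p mod_less_divisor[of p r] by linarith
  with False show ?thesis by simp
qed

subsection \<open>Collisions and sumsets\<close>

definition collisions :: "nat \<Rightarrow> (nat \<Rightarrow> nat) \<Rightarrow> (nat \<Rightarrow> nat) \<Rightarrow> nat" where
  "collisions n xs f = card {(a, b). a < b \<and> b < n \<and> f (xs a) = f (xs b)}"

lemma finite_pairs_less: "finite {(a, b). a < b \<and> b < (n::nat) \<and> R a b}"
  by (rule finite_subset[of _ "{..<n} \<times> {..<n}"]) auto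

lemma collisions_0 [simp]: "collisions 0 xs f = 0"
  by (simp add: collisions_def)

text \<open>A new element collides with exactly the earlier elements of its bucket; this is why one
  counter per bucket suffices to count colliding pairs in linear time.\<close>

lemma collisions_Suc:
  "collisions (Suc n) xs f = collisions n xs f + card {t. t < n \<and> f (xs t) = f (xs n)}"
proof -
  have "{(a, b). a < b \<and> b < Suc n \<and> f (xs a) = f (xs b)} =
    {(a, b). a < b \<and> b < n \<and> f (xs a) = f (xs b)} \<union> (\<lambda>t. (t, n)) ` {t. t < n \<and> f (xs t) = f (xs n)}"
    by (auto simp: less_Suc_eq)
  moreover have "card ({(a, b). a < b \<and> b < n \<and> f (xs a) = f (xs b)} \<union>
      (\<lambda>t. (t, n)) ` {t. t < n \<and> f (xs t) = f (xs n)}) =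
    card {(a, b). a < b \<and> b < n \<and> f (xs a) = f (xs b)} +
      card ((\<lambda>t. (t, n)) ` {t. t < n \<and> f (xs t) = f (xs n)})"
    by (rule card_Un_disjoint) (auto intro: finite_pairs_less)
  moreover have "card ((\<lambda>t. (t, n)) ` {t. t < n \<and> f (xs t) = f (xs n)}) = card {t. t < n \<and> f (xs t) = f (xs n)}"
    by (simp add: card_image inj_on_def)
  ultimately show ?thesis by (simp add: collisions_def)
qed

lemma collisions_le: "collisions n xs f \<le> n * n"
proof -
  have "collisions n xs f \<le> card ({..<n} \<times> {..<n})"
    unfolding collisions_def by (rule card_mono) auto
  then show ?thesis by simp
qed

lemma collisions_cong:
  assumes "\<And>a. a < n \<Longrightarrow> f (xs a) = g (ys a)"
  shows "collisions n xs f = collisions n ys g"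
proof -
  have "{(a, b). a < b \<and> b < n \<and> f (xs a) = f (xs b)} = {(a, b). a < b \<and> b < n \<and> g (ys a) = g (ys b)}"
    using assms by (auto dest: order.strict_trans)
  then show ?thesis by (simp add: collisions_def)
qed

text \<open>Every index that is not alone in its bucket is an endpoint of a colliding pair, and a
  pair has two endpoints.\<close>

lemma card_not_isolated:
  "card {t. t < n \<and> (\<exists>t'<n. t' \<noteq> t \<and> f (xs t') = f (xs t))} \<le> 2 * collisions n xs f"
proof -
  let ?C = "{(a, b). a < b \<and> b < n \<and> f (xs a) = f (xs b)}"
  have fin: "finite ?C" by (rule finite_pairs_less)
  have "card {t. t < n \<and> (\<exists>t'<n. t' \<noteq> t \<and> f (xs t') = f (xs t))} \<le> card (fst ` ?C \<union> snd ` ?C)"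
  proof (intro card_mono subsetI)
    fix t assume "t \<in> {t. t < n \<and> (\<exists>t'<n. t' \<noteq> t \<and> f (xs t') = f (xs t))}"
    then obtain t' where t: "t < n" "t' < n" "t' \<noteq> t" "f (xs t') = f (xs t)" by auto
    show "t \<in> fst ` ?C \<union> snd ` ?C"
    proof (cases "t < t'")
      case True
      then have "(t, t') \<in> ?C" using t by auto
      then show ?thesis by (intro UnI1 image_eqI[where x = "(t, t')"]) simp_all
    next
      case False
      then have "(t', t) \<in> ?C" using t by auto
      then show ?thesis by (intro UnI2 image_eqI[where x = "(t', t)"]) simp_all
    qed
  qed (use fin in auto)
  also have "\<dots> \<le> card (fst ` ?C) + card (snd ` ?C)" by (rule card_Un_le)
  also have "\<dots> \<le> card ?C + card ?C" using fin by (intro add_mono card_image_le)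
  finally show ?thesis by (simp add: collisions_def)
qed

text \<open>Appending the residue modulo \<open>p\<close> keeps exactly those collisions whose
  difference \<open>p\<close> divides. Differences of distinct elements are positive and below
  \<open>2 ^ L\<close>, so the averaging argument applies to the colliding pairs.\<close>

lemma exists_good_modulus:
  assumes P: "moduli U P d" "U \<le> W" and inj: "inj_on xs {..<n}"
    and L: "\<And>t. t < n \<Longrightarrow> xs t < 2 ^ L"
    and R: "R * L \<le> card {p::nat. prime p \<and> p \<le> U}" "R * L > 0"
  shows "\<exists>p. 0 < p \<and> p \<le> U \<and>
    collisions n xs (\<lambda>x. mkey W P d x + x mod p * W ^ d) * R \<le> collisions n xs (mkey W P d)"
proof -
  define D where "D = {(a, b). a < b \<and> b < n \<and> mkey W P d (xs a) = mkey W P d (xs b)}"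
  have finD: "finite D" unfolding D_def by (rule finite_pairs_less)
  define z where "z = (\<lambda>(a, b). if xs a \<le> xs b then xs b - xs a else xs a - xs b)"
  have z: "0 < z x \<and> z x < 2 ^ L" if "x \<in> D" for x
  proof -
    obtain a b where ab: "x = (a, b)" by (cases x)
    have x: "x = (a, b)" "a < b" "b < n" using that unfolding ab D_def by auto
    then have "xs a \<noteq> xs b" using inj by (auto dest: inj_onD)
    then show ?thesis using x L[of a] L[of b] by (auto simp: z_def)
  qed
  obtain p where p: "prime p" "p \<le> U" "card {x \<in> D. p dvd z x} * R \<le> card D"
    using exists_prime_few_multiples[of D z L R U, OF finD z R] by blast
  have dvd: "p dvd z (a, b) \<longleftrightarrow> xs a mod p = xs b mod p" for a b
  proof (cases "xs a \<le> xs b")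
    case True
    have "z (a, b) = xs b - xs a" using True by (simp add: z_def)
    then show ?thesis by (metis True mod_eq_dvd_iff_nat)
  next
    case False
    then have "z (a, b) = xs a - xs b" by (simp add: z_def)
    then show ?thesis by (metis False mod_eq_dvd_iff_nat nat_le_linear)
  qed
  have key: "mkey W P d x + x mod p * W ^ d = mkey W (P(d := p)) (Suc d) x" for x
    using mkey_cong[of d P "P(d := p)"] by (simp add: mkey_Suc)
  have mod': "moduli U (P(d := p)) (Suc d)" using P p prime_gt_0_nat by (auto simp: moduli_def less_Suc_eq)
  have "{(a, b). a < b \<and> b < n \<and> mkey W (P(d := p)) (Suc d) (xs a) = mkey W (P(d := p)) (Suc d) (xs b)}
    = {x \<in> D. p dvd z x}"
    by (auto simp: D_def dvd mkey_eq_mkey_iff[OF P] mkey_eq_mkey_iff[OF mod' P(2)] less_Suc_eq)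
  then have "collisions n xs (\<lambda>x. mkey W P d x + x mod p * W ^ d) = card {x \<in> D. p dvd z x}"
    unfolding key collisions_def by simp
  moreover have "collisions n xs (mkey W P d) = card D" by (simp add: collisions_def D_def)
  ultimately show ?thesis using p prime_gt_0_nat[OF p(1)] by (intro exI[of _ p]) simp
qed

text \<open>The push-forward of the weights \<open>v\<close> along \<open>x\<close>. With pairs of
  entries as \<open>K\<close> and their products as weights, the unwrapped convolution, its wrapped
  form and the hashed tensor differ only in the choice of \<open>x\<close>.\<close>

definition bucket_sum :: "'k set \<Rightarrow> ('k \<Rightarrow> real) \<Rightarrow> ('k \<Rightarrow> nat) \<Rightarrow> nat \<Rightarrow> real" where
  "bucket_sum K v x y = (\<Sum>k\<in>K. if x k = y then v k else 0)"

text \<open>Here the sign of the input entries enters: positive weights cannot cancel, so the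
  support of the push-forward is the whole image of \<open>x\<close>.\<close>

lemma bucket_sum_pos:
  assumes "finite K" "\<And>k. k \<in> K \<Longrightarrow> v k > 0"
  shows "y \<in> x ` K \<Longrightarrow> bucket_sum K v x y > 0" "y \<notin> x ` K \<Longrightarrow> bucket_sum K v x y = 0"
proof -
  assume "y \<in> x ` K"
  then obtain k where k: "k \<in> K" "x k = y" by auto
  have "0 < (if x k = y then v k else 0)" using k assms by auto
  also have "\<dots> \<le> bucket_sum K v x y" unfolding bucket_sum_def
    using assms k(1) by (intro member_le_sum) (auto intro: less_imp_le)
  finally show "bucket_sum K v x y > 0" .
next
  assume "y \<notin> x ` K"
  then show "bucket_sum K v x y = 0" unfolding bucket_sum_def by (intro sum.neutral) auto
qed

text \<open>Push-forwards compose, so hashing all pairs of entries equals hashing the convolution.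
  \<open>T\<close> may be any finite superset of the positions, in particular a list of
  candidates.\<close>

lemma bucket_sum_comp:
  assumes "finite K" "finite T" "x ` K \<subseteq> T"
  shows "bucket_sum K v (\<lambda>k. f (x k)) y = (\<Sum>z\<in>T. if f z = y then bucket_sum K v x z else 0)"
proof -
  have "(\<Sum>z\<in>T. if f z = y then bucket_sum K v x z else 0) =
    (\<Sum>z\<in>T. \<Sum>k\<in>K. if f z = y \<and> x k = z then v k else 0)"
    unfolding bucket_sum_def by (intro sum.cong) auto
  also have "\<dots> = (\<Sum>k\<in>K. \<Sum>z\<in>T. if f z = y \<and> x k = z then v k else 0)" by (rule sum.swap)
  also have "\<dots> = (\<Sum>k\<in>K. if f (x k) = y then v k else 0)"
  proof (rule sum.cong)
    fix k assume k: "k \<in> K"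
    have "(\<Sum>z\<in>T. if f z = y \<and> x k = z then v k else 0) = (\<Sum>z\<in>T. if z = x k then (if f (x k) = y then v k else 0) else 0)"
      by (intro sum.cong) auto
    then show "(\<Sum>z\<in>T. if f z = y \<and> x k = z then v k else 0) = (if f (x k) = y then v k else 0)"
      using k assms by auto
  qed simp
  finally show ?thesis by (simp add: bucket_sum_def)
qed

text \<open>Both indices are divided before they are added: the convolution of the coarsened inputs
  is meant, not the coarsened convolution.\<close>

definition pair_pos :: "(nat \<Rightarrow> nat) \<Rightarrow> (nat \<Rightarrow> nat) \<Rightarrow> nat \<Rightarrow> nat \<times> nat \<Rightarrow> nat" where
  "pair_pos ai bi q k = ai (fst k) div q + bi (snd k) div q"

definition pair_val :: "(nat \<Rightarrow> real) \<Rightarrow> (nat \<Rightarrow> real) \<Rightarrow> nat \<times> nat \<Rightarrow> real" where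
  "pair_val av bv k = av (fst k) * bv (snd k)"

lemma pair_pos_1: "pair_pos ai bi 1 k = ai (fst k) + bi (snd k)"
  by (simp add: pair_pos_def)

text \<open>The offset \<open>e\<close> is the sum of the two bits dropped when the scale
  doubles.\<close>

lemma pair_pos_halve: "\<exists>e\<le>2. pair_pos ai bi q k = 2 * pair_pos ai bi (2 * q) k + e"
proof -
  have *: "x div q = 2 * (x div (2 * q)) + x div q mod 2" for x :: nat
    by (metis div_mult2_eq mult.commute mult_div_mod_eq)
  have "pair_pos ai bi q k = 2 * pair_pos ai bi (2 * q) k + (ai (fst k) div q mod 2 + bi (snd k) div q mod 2)"
  proof -
    have "x + y = 2 * (x' + y') + (r + t)" if "x = 2 * x' + r" "y = 2 * y' + t" for x y x' y' r t :: nat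
      using that by simp
    from this[OF * *] show ?thesis unfolding pair_pos_def .
  qed
  moreover have "ai (fst k) div q mod 2 + bi (snd k) div q mod 2 \<le> 2" by linarith
  ultimately show ?thesis by blast
qed

text \<open>The sum of the quotients is the quotient of the sum or one less, according to the carry
  of the remainders, so each position at scale \<open>1\<close> accounts for at most two positions
  at scale \<open>q\<close>.\<close>

lemma card_pair_pos_le:
  assumes K: "finite K" and q: "q > 0"
  shows "card (pair_pos ai bi q ` K) \<le> 2 * card (pair_pos ai bi 1 ` K)"
proof -
  let ?S = "pair_pos ai bi 1 ` K"
  have "pair_pos ai bi q ` K \<subseteq> (\<lambda>s. s div q) ` ?S \<union> (\<lambda>s. s div q - 1) ` ?S"
  proof
    fix y assume "y \<in> pair_pos ai bi q ` K"
    then obtain k where k: "k \<in> K" "y = pair_pos ai bi q k" by auto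
    let ?a = "ai (fst k)" and ?b = "bi (snd k)"
    have s: "?a + ?b \<in> ?S" using k by (auto simp: pair_pos_def image_iff)
    have "(?a + ?b) div q = y + (?a mod q + ?b mod q) div q"
      unfolding k pair_pos_def by (rule div_add1_eq)
    moreover have "(?a mod q + ?b mod q) div q < 2"
      using q mod_less_divisor[of q ?a] mod_less_divisor[of q ?b] by (intro less_mult_imp_div_less) linarith
    ultimately have "y = (?a + ?b) div q \<or> y = (?a + ?b) div q - 1" by linarith
    then show "y \<in> (\<lambda>s. s div q) ` ?S \<union> (\<lambda>s. s div q - 1) ` ?S" using s by blast
  qed
  then have "card (pair_pos ai bi q ` K) \<le> card ((\<lambda>s. s div q) ` ?S \<union> (\<lambda>s. s div q - 1) ` ?S)"
    using K by (intro card_mono) auto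
  also have "\<dots> \<le> card ((\<lambda>s. s div q) ` ?S) + card ((\<lambda>s. s div q - 1) ` ?S)" by (rule card_Un_le)
  also have "\<dots> \<le> card ?S + card ?S" using K by (intro add_mono card_image_le) auto
  finally show ?thesis by simp
qed

text \<open>Below \<open>2 * m\<close> a residue \<open>r\<close> has at most the two
  representatives \<open>r\<close> and \<open>r + m\<close>.\<close>

lemma card_le_card_mod:
  fixes m :: nat
  assumes "finite S" "\<And>s. s \<in> S \<Longrightarrow> s < 2 * m"
  shows "card S \<le> 2 * card ((\<lambda>s. s mod m) ` S)"
proof -
  let ?T = "(\<lambda>s. s mod m) ` S"
  have "S \<subseteq> ?T \<union> (\<lambda>r. r + m) ` ?T"
  proof
    fix s assume s: "s \<in> S"
    show "s \<in> ?T \<union> (\<lambda>r. r + m) ` ?T"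
    proof (cases "s < m")
      case True
      then have "s mod m = s" by simp
      then have "s \<in> ?T" using s by (intro image_eqI[of _ _ s]) simp_all
      then show ?thesis by blast
    next
      case False
      then have "s mod m + m = s" using assms(2)[OF s] le_mod_geq[of m s] by simp
      then have "s \<in> (\<lambda>r. r + m) ` ?T"
        by (intro image_eqI[OF sym imageI[OF s]])
      then show ?thesis by blast
    qed
  qed
  then have "card S \<le> card (?T \<union> (\<lambda>r. r + m) ` ?T)" using assms by (intro card_mono) auto
  also have "\<dots> \<le> card ?T + card ((\<lambda>r. r + m) ` ?T)" by (rule card_Un_le)
  also have "\<dots> \<le> card ?T + card ?T" using assms by (intro add_mono card_image_le) auto
  finally show ?thesis by simp
qed

section \<open>Sparse representations and the support of the wrapped convolution\<close>

lemma sparse_rep_sum: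
  assumes "sparse_rep xs A" "A \<in> carrier_vec m"
  shows "(\<Sum>i<length xs. g (fst (xs ! i)) * snd (xs ! i)) = (\<Sum>i<m. g i * A $ i)"
proof -
  have d: "distinct xs" and s: "set xs = {(i, A $ i) | i. i < m \<and> A $ i \<noteq> 0}"
    using assms by (auto simp: sparse_rep_def)
  have "(\<Sum>i<length xs. g (fst (xs ! i)) * snd (xs ! i)) = (\<Sum>p\<in>set xs. g (fst p) * snd p)"
    using sum.reindex_bij_betw[OF bij_betw_nth[OF d refl refl], of "\<lambda>p. g (fst p) * snd p"] by simp
  also have "set xs = (\<lambda>i. (i, A $ i)) ` {i. i < m \<and> A $ i \<noteq> 0}" using s by auto
  also have "(\<Sum>p\<in>\<dots>. g (fst p) * snd p) = (\<Sum>i\<in>{i. i < m \<and> A $ i \<noteq> 0}. g i * A $ i)"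
    by (subst sum.reindex) (auto simp: inj_on_def)
  also have "\<dots> = (\<Sum>i<m. g i * A $ i)" by (rule sum.mono_neutral_left) auto
  finally show ?thesis .
qed

lemma sparse_rep_nth:
  assumes "sparse_rep xs A" "A \<in> carrier_vec m" "i < length xs"
  shows "fst (xs ! i) < m" "snd (xs ! i) = A $ fst (xs ! i)" "snd (xs ! i) \<noteq> 0"
  using nth_mem[OF assms(3)] assms(1,2) by (auto simp: sparse_rep_def)

lemma sparse_rep_inj:
  assumes "sparse_rep xs A" "A \<in> carrier_vec m"
  shows "inj_on (\<lambda>i. fst (xs ! i)) {..<length xs}"
proof (rule inj_onI)
  fix i j assume ij: "i \<in> {..<length xs}" "j \<in> {..<length xs}" "fst (xs ! i) = fst (xs ! j)"
  then have "xs ! i = xs ! j"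
    using sparse_rep_nth[OF assms, of i] sparse_rep_nth[OF assms, of j] by (intro prod_eqI) auto
  then show "i = j" using ij assms by (auto simp: sparse_rep_def nth_eq_iff_index_eq)
qed

lemma add_mod_eq_iff:
  assumes "i < m" "j < m" "r < (m::nat)"
  shows "(i + j) mod m = r \<longleftrightarrow> j = nat ((int r - int i) mod int m)"
proof -
  have "(i + j) mod m = r \<longleftrightarrow> (int i + int j) mod int m = int r mod int m"
    using assms by (metis mod_less of_nat_add of_nat_eq_iff zmod_int)
  also have "\<dots> \<longleftrightarrow> int m dvd (int i + int j - int r)" by (rule mod_eq_dvd_iff)
  also have "\<dots> \<longleftrightarrow> int m dvd (int j - (int r - int i))" by (simp add: algebra_simps)
  also have "\<dots> \<longleftrightarrow> int j mod int m = (int r - int i) mod int m" by (rule mod_eq_dvd_iff[symmetric])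
  also have "\<dots> \<longleftrightarrow> j = nat ((int r - int i) mod int m)" using assms by auto
  finally show ?thesis .
qed

text \<open>For fixed \<open>i\<close> and \<open>r\<close> a single \<open>j\<close> satisfies
  \<open>(i + j) mod m = r\<close>, which turns the shifted index in \<open>\<star>\<close> into a
  sum of indicators. Both sums can then be restricted to the listed entries, since all others
  vanish.\<close>

lemma wrap_conv_eq_bucket_sum:
  assumes A: "sparse_rep xs A" "A \<in> carrier_vec m" and B: "sparse_rep ys B" "B \<in> carrier_vec m" and r: "r < m"
  shows "(A \<star> B) $ r = bucket_sum ({..<length xs} \<times> {..<length ys})
     (pair_val (\<lambda>i. snd (xs ! i)) (\<lambda>j. snd (ys ! j)))
     (\<lambda>k. pair_pos (\<lambda>i. fst (xs ! i)) (\<lambda>j. fst (ys ! j)) 1 k mod m) r"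
proof -
  have inner: "(\<Sum>j<m. (if (i + j) mod m = r then 1 else 0) * B $ j) = B $ nat ((int r - int i) mod int m)"
    if "i < m" for i
  proof -
    have "(\<Sum>j<m. (if (i + j) mod m = r then 1 else 0) * B $ j) =
      (\<Sum>j<m. if j = nat ((int r - int i) mod int m) then B $ j else 0)"
      using that r by (intro sum.cong) (auto simp: add_mod_eq_iff)
    moreover have "nat ((int r - int i) mod int m) < m" using r by (simp add: nat_less_iff)
    ultimately show ?thesis by simp
  qed
  have "(A \<star> B) $ r = (\<Sum>i<m. B $ nat ((int r - int i) mod int m) * A $ i)"
    using A r by (simp add: wrap_conv_def Let_def mult.commute)
  also have "\<dots> = (\<Sum>i<m. (\<Sum>j<m. (if (i + j) mod m = r then 1 else 0) * B $ j) * A $ i)"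
    by (intro sum.cong) (auto simp: inner)
  also have "\<dots> = (\<Sum>i<length xs. (\<Sum>j<length ys. (if (fst (xs ! i) + fst (ys ! j)) mod m = r then 1 else 0) * snd (ys ! j)) * snd (xs ! i))"
    unfolding sparse_rep_sum[OF A, symmetric] sparse_rep_sum[OF B, symmetric] ..
  also have "\<dots> = (\<Sum>i<length xs. \<Sum>j<length ys. if (fst (xs ! i) + fst (ys ! j)) mod m = r then snd (xs ! i) * snd (ys ! j) else 0)"
    by (auto simp: sum_distrib_right intro!: sum.cong)
  finally show ?thesis
    unfolding bucket_sum_def pair_val_def pair_pos_1 by (simp add: sum.cartesian_product case_prod_beta)
qed

text \<open>Translation by the fixed index \<open>bi 0\<close> is injective modulo \<open>m\<close>,
  so already one row of the sumset has \<open>na\<close> elements.\<close>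

lemma length_le_card_sumset:
  fixes ai bi :: "nat \<Rightarrow> nat"
  assumes inj: "inj_on ai {..<na}" and lt: "\<And>i. i < na \<Longrightarrow> ai i < m" and nb: "nb > 0"
  shows "na \<le> card ((\<lambda>k. (ai (fst k) + bi (snd k)) mod m) ` ({..<na} \<times> {..<nb}))"
proof -
  have "inj_on (\<lambda>i. (ai i + bi 0) mod m) {..<na}"
  proof (rule inj_onI)
    fix i j assume ij: "i \<in> {..<na}" "j \<in> {..<na}" "(ai i + bi 0) mod m = (ai j + bi 0) mod m"
    have m: "m > 0" using ij(1) lt by force
    have "ai i' = nat ((int ((ai i' + bi 0) mod m) - int (bi 0 mod m)) mod int m)" if "i' < na" for i'
      using add_mod_eq_iff[of "bi 0 mod m" m "ai i'" "(ai i' + bi 0) mod m"] lt[OF that] m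
      by (simp add: mod_simps add.commute)
    then have "ai i = ai j" using ij by (metis lessThan_iff)
    then show "i = j" using inj ij by (auto dest: inj_onD)
  qed
  then have "na = card ((\<lambda>i. (ai i + bi 0) mod m) ` {..<na})" by (simp add: card_image)
  also have "\<dots> \<le> card ((\<lambda>k. (ai (fst k) + bi (snd k)) mod m) ` ({..<na} \<times> {..<nb}))"
    using nb by (intro card_mono) (auto intro!: image_eqI[where x = "(_, 0)"])
  finally show ?thesis .
qed

lemma sumset_commute:
  fixes ai bi :: "nat \<Rightarrow> nat"
  shows
  "(\<lambda>k. (ai (fst k) + bi (snd k)) mod m) ` ({..<na} \<times> {..<nb}) =
   (\<lambda>k. (bi (fst k) + ai (snd k)) mod (m::nat)) ` ({..<nb} \<times> {..<na})"
proof -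
  have "(\<lambda>k. (f (fst k) + g (snd k)) mod m) ` ({..<n} \<times> {..<n'}) \<subseteq>
    (\<lambda>k. (g (fst k) + f (snd k)) mod m) ` ({..<n'} \<times> {..<n})" for f g :: "nat \<Rightarrow> nat" and n n'
  proof
    fix y assume "y \<in> (\<lambda>k. (f (fst k) + g (snd k)) mod m) ` ({..<n} \<times> {..<n'})"
    then obtain i j where "i < n" "j < n'" "y = (g j + f i) mod m" by (auto simp: add.commute)
    then show "y \<in> (\<lambda>k. (g (fst k) + f (snd k)) mod m) ` ({..<n'} \<times> {..<n})"
      by (intro image_eqI[where x = "(j, i)"]) auto
  qed
  from this[of ai bi na nb] this[of bi ai nb na] show ?thesis by (rule equalityI)
qed

subsection \<open>Running times of programs\<close>

abbreviation seq_com :: "com \<Rightarrow> com \<Rightarrow> com"  (infixr \<open>;;\<close> 60) where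
  "c1 ;; c2 \<equiv> Seq c1 c2"

primrec wr_wreg :: "com \<Rightarrow> vname set" where
  "wr_wreg Skip = {}"
| "wr_wreg (WAssign x e) = {x}"
| "wr_wreg (WStore a e f) = {}"
| "wr_wreg (RAssign x e) = {}"
| "wr_wreg (RStore a e f) = {}"
| "wr_wreg (Seq c1 c2) = wr_wreg c1 \<union> wr_wreg c2"
| "wr_wreg (Cond b c1 c2) = wr_wreg c1 \<union> wr_wreg c2"
| "wr_wreg (While b c) = wr_wreg c"

primrec wr_warr :: "com \<Rightarrow> vname set" where
  "wr_warr Skip = {}"
| "wr_warr (WAssign x e) = {}"
| "wr_warr (WStore a e f) = {a}"
| "wr_warr (RAssign x e) = {}"
| "wr_warr (RStore a e f) = {}"
| "wr_warr (Seq c1 c2) = wr_warr c1 \<union> wr_warr c2"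
| "wr_warr (Cond b c1 c2) = wr_warr c1 \<union> wr_warr c2"
| "wr_warr (While b c) = wr_warr c"

primrec wr_rreg :: "com \<Rightarrow> vname set" where
  "wr_rreg Skip = {}"
| "wr_rreg (WAssign x e) = {}"
| "wr_rreg (WStore a e f) = {}"
| "wr_rreg (RAssign x e) = {x}"
| "wr_rreg (RStore a e f) = {}"
| "wr_rreg (Seq c1 c2) = wr_rreg c1 \<union> wr_rreg c2"
| "wr_rreg (Cond b c1 c2) = wr_rreg c1 \<union> wr_rreg c2"
| "wr_rreg (While b c) = wr_rreg c"

primrec wr_rarr :: "com \<Rightarrow> vname set" where
  "wr_rarr Skip = {}"
| "wr_rarr (WAssign x e) = {}"
| "wr_rarr (WStore a e f) = {}"
| "wr_rarr (RAssign x e) = {}"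
| "wr_rarr (RStore a e f) = {a}"
| "wr_rarr (Seq c1 c2) = wr_rarr c1 \<union> wr_rarr c2"
| "wr_rarr (Cond b c1 c2) = wr_rarr c1 \<union> wr_rarr c2"
| "wr_rarr (While b c) = wr_rarr c"

text \<open>What a program may change is read off its text, so loop invariants have to mention only
  the registers and arrays that the loop writes.\<close>

definition frame :: "com \<Rightarrow> state \<Rightarrow> state \<Rightarrow> bool" where
  "frame c s s' \<longleftrightarrow>
     (\<forall>x. x \<notin> wr_wreg c \<longrightarrow> wreg s' x = wreg s x) \<and>
     (\<forall>x. x \<notin> wr_warr c \<longrightarrow> warr s' x = warr s x) \<and>
     (\<forall>x. x \<notin> wr_rreg c \<longrightarrow> rreg s' x = rreg s x) \<and>
     (\<forall>x. x \<notin> wr_rarr c \<longrightarrow> rarr s' x = rarr s x)"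

lemma frame_wreg: "frame c s s' \<Longrightarrow> x \<notin> wr_wreg c \<Longrightarrow> wreg s' x = wreg s x"
  and frame_warr: "frame c s s' \<Longrightarrow> x \<notin> wr_warr c \<Longrightarrow> warr s' x = warr s x"
  and frame_rreg: "frame c s s' \<Longrightarrow> x \<notin> wr_rreg c \<Longrightarrow> rreg s' x = rreg s x"
  and frame_rarr: "frame c s s' \<Longrightarrow> x \<notin> wr_rarr c \<Longrightarrow> rarr s' x = rarr s x"
  by (simp_all add: frame_def)

lemmas frameD = frame_wreg frame_warr frame_rreg frame_rarr

lemma frame_refl: "frame c s s"
  by (simp add: frame_def)

lemma frame_trans: "frame c s s' \<Longrightarrow> frame c s' s'' \<Longrightarrow> frame c s s''"
  by (simp add: frame_def)

lemma exec_frame: "exec w c s t s' \<Longrightarrow> frame c s s'"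
  by (induction rule: exec.induct) (auto simp: frame_def)

definition runs :: "nat \<Rightarrow> com \<Rightarrow> state \<Rightarrow> nat \<Rightarrow> (state \<Rightarrow> bool) \<Rightarrow> bool" where
  "runs w c s t Q \<longleftrightarrow> (\<exists>t' s'. exec w c s t' s' \<and> t' \<le> t \<and> Q s')"

lemma runs_conseq:
  assumes "runs w c s t' Q'" "t' \<le> t" "\<And>s'. Q' s' \<Longrightarrow> frame c s s' \<Longrightarrow> Q s'"
  shows "runs w c s t Q"
  using assms unfolding runs_def by (meson exec_frame order.trans)

lemma runs_Seq:
  assumes "runs w c1 s u Qa"
    and "\<And>s'. Qa s' \<Longrightarrow> frame c1 s s' \<Longrightarrow> runs w c2 s' v Q"
    and "u + v \<le> t"
  shows "runs w (c1 ;; c2) s t Q"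
proof -
  obtain u' s1 where 1: "exec w c1 s u' s1" "u' \<le> u" "Qa s1" using assms(1) by (auto simp: runs_def)
  obtain v' s2 where 2: "exec w c2 s1 v' s2" "v' \<le> v" "Q s2"
    using assms(2)[OF 1(3) exec_frame[OF 1(1)]] by (auto simp: runs_def)
  show ?thesis unfolding runs_def
    by (rule exI[of _ "u' + v'"], rule exI[of _ s2]) (use 1 2 assms(3) in \<open>auto intro: exec.Seq\<close>)
qed

lemma runs_Cond:
  assumes "bval w b s \<Longrightarrow> runs w c1 s t Q" "\<not> bval w b s \<Longrightarrow> runs w c2 s t Q" "t + 1 \<le> t'"
  shows "runs w (Cond b c1 c2) s t' Q"
proof (cases "bval w b s")
  case True
  from assms(1)[OF this] obtain t1 s1 where "exec w c1 s t1 s1" "t1 \<le> t" "Q s1" by (auto simp: runs_def)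
  with True assms(3) show ?thesis unfolding runs_def
    by (intro exI[of _ "t1 + 1"] exI[of _ s1]) (auto intro: exec.CondTrue[simplified])
next
  case False
  from assms(2)[OF this] obtain t1 s1 where "exec w c2 s t1 s1" "t1 \<le> t" "Q s1" by (auto simp: runs_def)
  with False assms(3) show ?thesis unfolding runs_def
    by (intro exI[of _ "t1 + 1"] exI[of _ s1]) (auto intro: exec.CondFalse[simplified])
qed

text \<open>The invariant carries the number \<open>k\<close> of completed iterations, and
  \<open>bound\<close> limits \<open>k\<close> whenever the guard holds; termination and running
  time come from the same premise.\<close>

lemma runs_While:
  assumes init: "I 0 s"
    and step: "\<And>k s'. I k s' \<Longrightarrow> frame c s s' \<Longrightarrow> bval w b s' \<Longrightarrow> runs w c s' tb (I (Suc k))"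
    and bound: "\<And>k s'. I k s' \<Longrightarrow> frame c s s' \<Longrightarrow> bval w b s' \<Longrightarrow> k < n"
    and t: "n * (tb + 1) + 1 \<le> t"
    and post: "\<And>k s'. I k s' \<Longrightarrow> frame c s s' \<Longrightarrow> \<not> bval w b s' \<Longrightarrow> Q s'"
  shows "runs w (While b c) s t Q"
proof -
  have "\<exists>t'' s''. exec w (While b c) s' t'' s'' \<and> t'' \<le> d * (tb + 1) + 1 \<and> Q s''"
    if "I k s'" "frame c s s'" "n - k = d" for k s' d
    using that
  proof (induction d arbitrary: k s')
    case 0
    then have "\<not> bval w b s'" using bound[of k s'] by auto
    then show ?case using exec.WhileFalse[of w b s' c] post[OF 0(1,2)] by fastforce
  next
    case (Suc d)
    show ?case
    proof (cases "bval w b s'")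
      case True
      obtain t1 s1 where 1: "exec w c s' t1 s1" "t1 \<le> tb" "I (Suc k) s1"
        using step[OF Suc.prems(1,2) True] by (auto simp: runs_def)
      have "frame c s s1" using frame_trans[OF Suc.prems(2) exec_frame[OF 1(1)]] .
      moreover have "n - Suc k = d" using Suc.prems by simp
      ultimately obtain t2 s2 where 2: "exec w (While b c) s1 t2 s2" "t2 \<le> d * (tb + 1) + 1" "Q s2"
        using Suc.IH[OF 1(3)] by blast
      show ?thesis
        using exec.WhileTrue[OF True 1(1) 2(1)] 1 2 by (intro exI[of _ "t1 + t2 + 1"] exI[of _ s2]) simp
    next
      case False
      show ?thesis using exec.WhileFalse[OF False] post[OF Suc.prems(1,2) False] by fastforce
    qed
  qed
  from this[OF init frame_refl refl] show ?thesis using t unfolding runs_def by fastforce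
qed

definition for_com :: "vname \<Rightarrow> vname \<Rightarrow> com \<Rightarrow> com" where
  "for_com i x c = WAssign i (WConst 0) ;;
     While (WLess (WReg i) (WReg x)) (c ;; WAssign i (WAdd (WReg i) (WConst 1)))"

lemma wr_for [simp]:
  "wr_wreg (for_com i x c) = insert i (wr_wreg c)"
  "wr_warr (for_com i x c) = wr_warr c"
  "wr_rreg (for_com i x c) = wr_rreg c"
  "wr_rarr (for_com i x c) = wr_rarr c"
  by (auto simp: for_com_def)

lemma runs_WAssign:
  "1 \<le> t \<Longrightarrow> Q (s\<lparr>wreg := (wreg s)(x := wval w e s)\<rparr>) \<Longrightarrow> runs w (WAssign x e) s t Q"
  unfolding runs_def using exec.WAssign by blast

text \<open>Premise \<open>ins\<close> says that the invariant ignores the loop counter, whose value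
  is handed to \<open>step\<close> separately. Each iteration costs two extra steps for test and
  increment; the other two are the initialisation and the last test.\<close>

lemma runs_for:
  assumes N: "wreg s x = N" "N < 2 ^ w"
    and fresh: "i \<noteq> x" "i \<notin> wr_wreg c" "x \<notin> wr_wreg c"
    and ins: "\<And>k s' v. I k s' \<Longrightarrow> I k (s'\<lparr>wreg := (wreg s')(i := v)\<rparr>)"
    and init: "I 0 s"
    and step: "\<And>k s'. I k s' \<Longrightarrow> k < N \<Longrightarrow> wreg s' i = k \<Longrightarrow> frame (for_com i x c) s s' \<Longrightarrow>
      runs w c s' tb (I (Suc k))"
    and t: "N * (tb + 2) + 2 \<le> t"
    and post: "\<And>s'. I N s' \<Longrightarrow> frame (for_com i x c) s s' \<Longrightarrow> Q s'"
  shows "runs w (for_com i x c) s t Q"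
  unfolding for_com_def
proof (rule runs_Seq)
  let ?J = "\<lambda>k s'. I k s' \<and> wreg s' i = k \<and> k \<le> N \<and> frame (for_com i x c) s s'"
  show "runs w (WAssign i (WConst 0)) s 1 (?J 0)"
    using ins[OF init] by (intro runs_WAssign) (auto simp: frame_def)
  fix s0 assume s0: "?J 0 s0"
  show "runs w (While (WLess (WReg i) (WReg x)) (c ;; WAssign i (WAdd (WReg i) (WConst 1)))) s0 (N * (tb + 2) + 1) Q"
  proof (rule runs_While[where I = "?J" and n = N and tb = "tb + 1"])
    show "?J 0 s0" by (rule s0)
    fix k s' assume J: "?J k s'" and b: "bval w (WLess (WReg i) (WReg x)) s'"
    have wx: "wreg s' x = N" using J fresh N by (auto simp: frame_def)
    have k: "k < N" using J b wx by simp
    then show "k < N" .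
    show "runs w (c ;; WAssign i (WAdd (WReg i) (WConst 1))) s' (tb + 1) (?J (Suc k))"
    proof (rule runs_Seq)
      show "runs w c s' tb (I (Suc k))" using step J k by blast
      fix s1 assume 1: "I (Suc k) s1" "frame c s' s1"
      have "wreg s1 i = k" using 1(2) fresh J by (simp add: frame_def)
      moreover have "frame (for_com i x c) s (s1\<lparr>wreg := (wreg s1)(i := v)\<rparr>)" for v
        using J 1(2) by (auto simp: frame_def)
      moreover have "(1::nat) mod 2 ^ w = 1" using k N by (cases w) auto
      ultimately show "runs w (WAssign i (WAdd (WReg i) (WConst 1))) s1 1 (?J (Suc k))"
        using ins[OF 1(1)] k N by (intro runs_WAssign) auto
    qed simp
  next
    fix k s' assume J: "?J k s'" and b: "\<not> bval w (WLess (WReg i) (WReg x)) s'"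
    have wx: "wreg s' x = N" using J fresh N by (auto simp: frame_def)
    then have "k = N" using J b by auto
    then show "Q s'" using J post by blast
  qed simp
qed (use t in simp)

section \<open>Symbolic evaluation of straight-line programs\<close>

primrec loop_free :: "com \<Rightarrow> bool" where
  "loop_free Skip = True"
| "loop_free (WAssign x e) = True"
| "loop_free (WStore a e f) = True"
| "loop_free (RAssign x e) = True"
| "loop_free (RStore a e f) = True"
| "loop_free (Seq c1 c2) = (loop_free c1 \<and> loop_free c2)"
| "loop_free (Cond b c1 c2) = (loop_free c1 \<and> loop_free c2)"
| "loop_free (While b c) = False"

text \<open>Evaluating straight-line code symbolically turns the correctness of a loop body into a
  goal about record updates.\<close>

primrec final :: "nat \<Rightarrow> com \<Rightarrow> state \<Rightarrow> state" where
  "final w Skip s = s"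
| "final w (WAssign x e) s = s\<lparr>wreg := (wreg s)(x := wval w e s)\<rparr>"
| "final w (WStore a e f) s =
    s\<lparr>warr := (warr s)(a := (warr s a)(wval w e s := wval w f s))\<rparr>"
| "final w (RAssign x e) s = s\<lparr>rreg := (rreg s)(x := rval w e s)\<rparr>"
| "final w (RStore a e f) s =
    s\<lparr>rarr := (rarr s)(a := (rarr s a)(wval w e s := rval w f s))\<rparr>"
| "final w (Seq c1 c2) s = final w c2 (final w c1 s)"
| "final w (Cond b c1 c2) s = (if bval w b s then final w c1 s else final w c2 s)"
| "final w (While b c) s = s"

text \<open>Both branches of a conditional are charged, so that the bound depends on the program
  text alone.\<close>

primrec steps :: "com \<Rightarrow> nat" where
  "steps Skip = 1"
| "steps (WAssign x e) = 1"
| "steps (WStore a e f) = 1"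
| "steps (RAssign x e) = 1"
| "steps (RStore a e f) = 1"
| "steps (Seq c1 c2) = steps c1 + steps c2"
| "steps (Cond b c1 c2) = steps c1 + steps c2 + 1"
| "steps (While b c) = 1"

lemma exec_loop_free: "loop_free c \<Longrightarrow> \<exists>t. exec w c s t (final w c s) \<and> t \<le> steps c"
proof (induction c arbitrary: s)
  case (Seq c1 c2)
  then obtain t1 where "exec w c1 s t1 (final w c1 s)" "t1 \<le> steps c1" by auto
  moreover obtain t2 where "exec w c2 (final w c1 s) t2 (final w c2 (final w c1 s))" "t2 \<le> steps c2"
    using Seq by auto
  ultimately show ?case by (intro exI[of _ "t1 + t2"]) (auto intro: exec.Seq)
next
  case (Cond b c1 c2)
  obtain t1 where 1: "exec w c1 s t1 (final w c1 s)" "t1 \<le> steps c1" using Cond by auto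
  obtain t2 where 2: "exec w c2 s t2 (final w c2 s)" "t2 \<le> steps c2" using Cond by auto
  show ?case
  proof (cases "bval w b s")
    case True
    then show ?thesis using exec.CondTrue[OF True 1(1)] 1 by (intro exI[of _ "t1 + 1"]) auto
  next
    case False
    then show ?thesis using exec.CondFalse[OF False 2(1)] 2 by (intro exI[of _ "t2 + 1"]) auto
  qed
qed (auto intro: exec.intros intro!: exI[of _ "1::nat"] simp flip: One_nat_def)

lemma runs_final:
  assumes "loop_free c" "steps c \<le> t" "Q (final w c s)"
  shows "runs w c s t Q"
  using exec_loop_free[OF assms(1), of w s] assms(2,3) unfolding runs_def by (meson order.trans)

subsection \<open>The sparse convolution by hashing into a dense tensor\<close>

lemma runs_block_Seq:
  assumes "loop_free c1" "runs w c2 (final w c1 s) v Q" "steps c1 + v \<le> t"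
  shows "runs w (c1 ;; c2) s t Q"
  by (rule runs_Seq[where u = "steps c1" and v = v and Qa = "\<lambda>s'. s' = final w c1 s"])
     (use assms in \<open>auto intro: runs_final\<close>)

lemma runs_Seq_block:
  assumes "runs w c1 s u Q1" "loop_free c2"
    and "\<And>s'. Q1 s' \<Longrightarrow> frame c1 s s' \<Longrightarrow> Q (final w c2 s')" "u + steps c2 \<le> t"
  shows "runs w (c1 ;; c2) s t Q"
  by (rule runs_Seq[OF assms(1), where v = "steps c2"]) (use assms in \<open>auto intro: runs_final\<close>)

definition hash_com :: com where
  "hash_com =
    (WAssign ''h'' (WConst 0) ;; WAssign ''hs'' (WConst 1)) ;;
    for_com ''hu'' ''d'' (
      WAssign ''h'' (WAdd (WReg ''h'') (WMul (WMod (WReg ''x'') (WArr ''P'' (WReg ''hu''))) (WReg ''hs''))) ;;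
      WAssign ''hs'' (WMul (WReg ''hs'') (WReg ''W'')))"

lemma wr_hash [simp]:
  "wr_wreg hash_com = {''h'', ''hs'', ''hu''}" "wr_warr hash_com = {}"
  "wr_rreg hash_com = {}" "wr_rarr hash_com = {}"
  by (auto simp: hash_com_def)

lemma power_less_word_size:
  assumes "2 \<le> (W::nat)" "W ^ d < 2 ^ w"
  shows "d < 2 ^ w" "k \<le> d \<Longrightarrow> W ^ k < 2 ^ w"
proof -
  have "d < 2 ^ d" by (rule less_exp)
  also have "\<dots> \<le> W ^ d" using assms(1) by (rule power_mono) simp
  finally show "d < 2 ^ w" using assms(2) by simp
  show "W ^ k < 2 ^ w" if "k \<le> d"
    using power_increasing[OF that, of W] assms by linarith
qed

text \<open>A partial key is itself a key, for an initial segment of the moduli, and hence below a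
  power of \<open>W\<close> that is at most \<open>W ^ d\<close>; no word operation
  overflows.\<close>

lemma runs_hash:
  assumes s: "wreg s ''d'' = d" "wreg s ''W'' = W" "warr s ''P'' = P" "wreg s ''x'' = x"
    and P: "moduli U P d" "U \<le> W" and W: "2 \<le> W" "W ^ d < 2 ^ w" "0 < w"
  shows "runs w hash_com s (4 * d + 4) (\<lambda>s'. wreg s' ''h'' = mkey W P d x)"
  unfolding hash_com_def
proof (rule runs_block_Seq)
  let ?s = "final w (WAssign ''h'' (WConst 0) ;; WAssign ''hs'' (WConst 1)) s"
  show "runs w (for_com ''hu'' ''d'' (
      WAssign ''h'' (WAdd (WReg ''h'') (WMul (WMod (WReg ''x'') (WArr ''P'' (WReg ''hu''))) (WReg ''hs''))) ;;
      WAssign ''hs'' (WMul (WReg ''hs'') (WReg ''W'')))) ?s (4 * d + 2) (\<lambda>s'. wreg s' ''h'' = mkey W P d x)"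
  proof (rule runs_for[where N = d and tb = 2 and I = "\<lambda>k s'. wreg s' ''h'' = mkey W P k x \<and> wreg s' ''hs'' = W ^ k"])
    fix k s'
    assume I: "wreg s' ''h'' = mkey W P k x \<and> wreg s' ''hs'' = W ^ k" and k: "k < d" "wreg s' ''hu'' = k"
      and fr: "frame (for_com ''hu'' ''d'' (
      WAssign ''h'' (WAdd (WReg ''h'') (WMul (WMod (WReg ''x'') (WArr ''P'' (WReg ''hu''))) (WReg ''hs''))) ;;
      WAssign ''hs'' (WMul (WReg ''hs'') (WReg ''W'')))) ?s s'"
    have v: "wreg s' ''x'' = x" "warr s' ''P'' = P" "wreg s' ''W'' = W"
      using s by (simp_all add: frameD[OF fr])
    have "mkey W P (Suc k) x < W ^ Suc k"
      using P k by (intro mkey_less[where U = U]) (auto simp: moduli_def)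
    then have "mkey W P k x + x mod P k * W ^ k < 2 ^ w" "W ^ k * W < 2 ^ w"
      using power_less_word_size(2)[OF W(1,2), of "Suc k"] k by (simp_all add: mkey_Suc mult.commute)
    then show "runs w (WAssign ''h'' (WAdd (WReg ''h'') (WMul (WMod (WReg ''x'') (WArr ''P'' (WReg ''hu''))) (WReg ''hs''))) ;;
      WAssign ''hs'' (WMul (WReg ''hs'') (WReg ''W''))) s' 2
      (\<lambda>s'. wreg s' ''h'' = mkey W P (Suc k) x \<and> wreg s' ''hs'' = W ^ Suc k)"
      using I k v by (intro runs_final) (auto simp: mkey_Suc mult.commute)
  qed (use s W power_less_word_size[OF W(1,2)] in \<open>auto simp: one_less_power\<close>)
qed simp_all

section \<open>Scattering the inputs and transforming along one axis\<close>

definition fold_com :: "vname \<Rightarrow> vname \<Rightarrow> vname \<Rightarrow> com" where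
  "fold_com X n F = for_com ''i'' n (
     WAssign ''x'' (WDiv (WArr X (WReg ''i'')) (WReg ''pw'')) ;;
     hash_com ;;
     RStore F (WReg ''h'') (RAdd (RArr F (WReg ''h'')) (RArr X (WReg ''i''))))"

lemma wr_fold [simp]:
  "wr_wreg (fold_com X n F) = {''i'', ''x'', ''h'', ''hs'', ''hu''}" "wr_warr (fold_com X n F) = {}"
  "wr_rreg (fold_com X n F) = {}" "wr_rarr (fold_com X n F) = {F}"
  by (auto simp: fold_com_def)

lemma runs_fold:
  assumes s: "wreg s ''d'' = d" "wreg s ''W'' = W" "warr s ''P'' = P" "wreg s ''pw'' = q"
      "wreg s n = N" "warr s X = ai" "rarr s X = av"
    and zero: "\<And>i. i < W ^ d \<Longrightarrow> rarr s F i = 0"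
    and names: "X \<noteq> F" "n \<notin> {''i'', ''x'', ''h'', ''hs'', ''hu''}" and N: "N < 2 ^ w"
    and P: "moduli U P d" "U \<le> W" and W: "2 \<le> W" "W ^ d < 2 ^ w" "0 < w"
  shows "runs w (fold_com X n F) s (N * (4 * d + 8) + 2)
     (\<lambda>s'. \<forall>i<W ^ d. rarr s' F i = (\<Sum>j<N. if mkey W P d (ai j div q) = i then av j else 0))"
  unfolding fold_com_def
proof (rule runs_for[where N = N and tb = "4 * d + 6" and
    I = "\<lambda>k s'. \<forall>i<W ^ d. rarr s' F i = (\<Sum>j<k. if mkey W P d (ai j div q) = i then av j else 0)"])
  fix k s'
  let ?c = "WAssign ''x'' (WDiv (WArr X (WReg ''i'')) (WReg ''pw'')) ;;
     hash_com ;;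
     RStore F (WReg ''h'') (RAdd (RArr F (WReg ''h'')) (RArr X (WReg ''i'')))"
  assume I: "\<forall>i<W ^ d. rarr s' F i = (\<Sum>j<k. if mkey W P d (ai j div q) = i then av j else 0)"
    and k: "k < N" "wreg s' ''i'' = k" and fr: "frame (for_com ''i'' n ?c) s s'"
  have v: "wreg s' ''d'' = d" "wreg s' ''W'' = W" "warr s' ''P'' = P" "wreg s' ''pw'' = q"
      "warr s' X = ai" "rarr s' X = av"
    using s names by (simp_all add: frameD[OF fr])
  show "runs w ?c s' (4 * d + 6)
    (\<lambda>s'. \<forall>i<W ^ d. rarr s' F i = (\<Sum>j<Suc k. if mkey W P d (ai j div q) = i then av j else 0))"
  proof (rule runs_block_Seq[where v = "4 * d + 5"])
    let ?s = "final w (WAssign ''x'' (WDiv (WArr X (WReg ''i'')) (WReg ''pw''))) s'"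
    have h: "runs w hash_com ?s (4 * d + 4) (\<lambda>s'. wreg s' ''h'' = mkey W P d (ai k div q))"
      using v k by (intro runs_hash[OF _ _ _ _ P W]) auto
    show "runs w (hash_com ;; RStore F (WReg ''h'') (RAdd (RArr F (WReg ''h'')) (RArr X (WReg ''i'')))) ?s (4 * d + 5)
      (\<lambda>s'. \<forall>i<W ^ d. rarr s' F i = (\<Sum>j<Suc k. if mkey W P d (ai j div q) = i then av j else 0))"
    proof (rule runs_Seq_block[OF h])
      fix s1 assume h: "wreg s1 ''h'' = mkey W P d (ai k div q)" and fr1: "frame hash_com ?s s1"
      show "\<forall>i<W ^ d. rarr (final w (RStore F (WReg ''h'') (RAdd (RArr F (WReg ''h'')) (RArr X (WReg ''i'')))) s1) F i =
        (\<Sum>j<Suc k. if mkey W P d (ai j div q) = i then av j else 0)"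
        using I h v k mkey_less[OF P, of "ai k div q"] by (auto simp: frameD[OF fr1])
    qed simp_all
  qed simp_all
qed (use s names N zero in auto)

definition clear_com :: "vname \<Rightarrow> com" where
  "clear_com F = for_com ''i'' ''st'' (RStore F (WReg ''i'') (ROfWord (WConst 0)))"

lemma wr_clear [simp]:
  "wr_wreg (clear_com F) = {''i''}" "wr_warr (clear_com F) = {}"
  "wr_rreg (clear_com F) = {}" "wr_rarr (clear_com F) = {F}"
  by (auto simp: clear_com_def)

lemma runs_clear:
  assumes s: "wreg s ''st'' = Q" and Q: "Q < 2 ^ w"
  shows "runs w (clear_com F) s (3 * Q + 2) (\<lambda>s'. \<forall>i<Q. rarr s' F i = 0)"
  unfolding clear_com_def
  by (rule runs_for[where N = Q and tb = 1 and I = "\<lambda>k s'. \<forall>i<k. rarr s' F i = 0"])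
     (use s Q in \<open>auto intro!: runs_final simp: less_Suc_eq\<close>)

text \<open>A fibre along axis \<open>a\<close> is an arithmetic progression with start
  \<open>b\<close> and step \<open>sa = W ^ a\<close>. Results are gathered in \<open>TM\<close>,
  because every entry of a fibre is still an input for the others; a second loop copies them
  back.\<close>

definition axis_com :: "vname \<Rightarrow> vname \<Rightarrow> com" where
  "axis_com M F =
    WAssign ''sb'' (WMul (WReg ''sa'') (WReg ''W'')) ;;
    for_com ''i'' ''st'' (
      (WAssign ''eb'' (WMul (WMod (WDiv (WReg ''i'') (WReg ''sa'')) (WReg ''W'')) (WReg ''W'')) ;;
       WAssign ''b'' (WAdd (WMul (WDiv (WReg ''i'') (WReg ''sb'')) (WReg ''sb'')) (WMod (WReg ''i'') (WReg ''sa''))) ;;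
       RAssign ''acc'' (ROfWord (WConst 0))) ;;
      for_com ''r'' ''W'' (
        RAssign ''acc'' (RAdd (RReg ''acc'')
          (RMul (RArr M (WAdd (WReg ''eb'') (WReg ''r''))) (RArr F (WAdd (WReg ''b'') (WMul (WReg ''r'') (WReg ''sa''))))))) ;;
      RStore ''TM'' (WReg ''i'') (RReg ''acc'')) ;;
    for_com ''i'' ''st'' (RStore F (WReg ''i'') (RArr ''TM'' (WReg ''i'')))"

lemma wr_axis [simp]:
  "wr_wreg (axis_com M F) = {''sb'', ''i'', ''eb'', ''b'', ''r''}" "wr_warr (axis_com M F) = {}"
  "wr_rreg (axis_com M F) = {''acc''}" "wr_rarr (axis_com M F) = {''TM'', F}"
  by (auto simp: axis_com_def)

lemma runs_axis_inner:
  assumes s: "wreg s ''sa'' = W ^ a" "wreg s ''W'' = W" "wreg s ''eb'' = digit W a k * W"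
      "wreg s ''b'' = k div W ^ Suc a * W ^ Suc a + k mod W ^ a" "rreg s ''acc'' = 0"
      "rarr s M = Mf" "rarr s F = f"
    and k: "k < W ^ d" and a: "a < d" and W: "2 \<le> W" "W ^ d < 2 ^ w" "W * W < 2 ^ w"
  shows "runs w (for_com ''r'' ''W'' (
        RAssign ''acc'' (RAdd (RReg ''acc'')
          (RMul (RArr M (WAdd (WReg ''eb'') (WReg ''r''))) (RArr F (WAdd (WReg ''b'') (WMul (WReg ''r'') (WReg ''sa'')))))))) s
      (3 * W + 2) (\<lambda>s'. rreg s' ''acc'' = (\<Sum>r<W. Mf (digit W a k * W + r) * f (set_digit W a r k)))"
proof (rule runs_for[where N = W and tb = 1 and
     I = "\<lambda>j s'. rreg s' ''acc'' = (\<Sum>r<j. Mf (digit W a k * W + r) * f (set_digit W a r k))"])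
  fix r s'
  let ?c = "RAssign ''acc'' (RAdd (RReg ''acc'')
          (RMul (RArr M (WAdd (WReg ''eb'') (WReg ''r''))) (RArr F (WAdd (WReg ''b'') (WMul (WReg ''r'') (WReg ''sa''))))))"
  assume I: "rreg s' ''acc'' = (\<Sum>r<r. Mf (digit W a k * W + r) * f (set_digit W a r k))"
    and r: "r < W" "wreg s' ''r'' = r" and fr: "frame (for_com ''r'' ''W'' ?c) s s'"
  have v: "wreg s' ''sa'' = W ^ a" "wreg s' ''eb'' = digit W a k * W"
      "wreg s' ''b'' = k div W ^ Suc a * W ^ Suc a + k mod W ^ a" "rarr s' M = Mf" "rarr s' F = f"
    using s by (simp_all add: frameD[OF fr])
  have sd: "k div W ^ Suc a * W ^ Suc a + k mod W ^ a + r * W ^ a = set_digit W a r k"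
    by (simp add: set_digit_def)
  have "set_digit W a r k < 2 ^ w" using set_digit_less[OF r(1) a k] W by linarith
  then have 1: "k div W ^ Suc a * W ^ Suc a + k mod W ^ a + r * W ^ a < 2 ^ w" "r * W ^ a < 2 ^ w"
    unfolding sd[symmetric] by linarith+
  have "digit W a k * W + r < Suc (digit W a k) * W" using r by simp
  also have "\<dots> \<le> W * W" using digit_less[of W a k] W by (intro mult_le_mono1) simp
  finally have 2: "digit W a k * W + r < 2 ^ w" using W by linarith
  show "runs w ?c s' 1 (\<lambda>s'. rreg s' ''acc'' = (\<Sum>r<Suc r. Mf (digit W a k * W + r) * f (set_digit W a r k)))"
    using I v r 1 2 sd by (intro runs_final) (simp_all del: power_Suc)
qed (use s W le_less_trans[OF le_square W(3)] in auto)

text \<open>Each of the \<open>W ^ d\<close> outputs reads one fibre of length \<open>W\<close>, so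
  treating an axis costs only a factor \<open>W\<close> above the size of the tensor.\<close>

lemma runs_axis:
  assumes s: "wreg s ''sa'' = W ^ a" "wreg s ''W'' = W" "wreg s ''st'' = W ^ d"
      "rarr s M = Mf" "rarr s F = f"
    and names: "M \<noteq> ''TM''" "F \<noteq> ''TM''" "M \<noteq> F"
    and a: "a < d" and W: "2 \<le> W" "W ^ d < 2 ^ w" "W * W < 2 ^ w"
  shows "runs w (axis_com M F) s (W ^ d * (3 * W + 13) + 5)
    (\<lambda>s'. \<forall>k<W ^ d. rarr s' F k = (\<Sum>r<W. Mf (digit W a k * W + r) * f (set_digit W a r k)))"
proof -
  let ?i = "for_com ''r'' ''W'' (
        RAssign ''acc'' (RAdd (RReg ''acc'')
          (RMul (RArr M (WAdd (WReg ''eb'') (WReg ''r''))) (RArr F (WAdd (WReg ''b'') (WMul (WReg ''r'') (WReg ''sa'')))))))"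
  let ?pre = "WAssign ''eb'' (WMul (WMod (WDiv (WReg ''i'') (WReg ''sa'')) (WReg ''W'')) (WReg ''W'')) ;;
       WAssign ''b'' (WAdd (WMul (WDiv (WReg ''i'') (WReg ''sb'')) (WReg ''sb'')) (WMod (WReg ''i'') (WReg ''sa''))) ;;
       RAssign ''acc'' (ROfWord (WConst 0))"
  let ?body = "?pre ;; ?i ;; RStore ''TM'' (WReg ''i'') (RReg ''acc'')"
  let ?g = "\<lambda>k. \<Sum>r<W. Mf (digit W a k * W + r) * f (set_digit W a r k)"
  let ?sb = "WAssign ''sb'' (WMul (WReg ''sa'') (WReg ''W''))"
  have Wa: "W ^ a * W < 2 ^ w" using power_less_word_size(2)[OF W(1,2), of "Suc a"] a by (simp add: mult.commute)
  have loop1: "runs w (for_com ''i'' ''st'' ?body) (final w ?sb s) (W ^ d * (3 * W + 8) + 2)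
     (\<lambda>s'. \<forall>k<W ^ d. rarr s' ''TM'' k = ?g k)"
  proof (rule runs_for[where N = "W ^ d" and tb = "3 * W + 6" and I = "\<lambda>j s'. rarr s' F = f \<and> (\<forall>k<j. rarr s' ''TM'' k = ?g k)"])
    fix k s'
    assume I: "rarr s' F = f \<and> (\<forall>j<k. rarr s' ''TM'' j = ?g j)"
      and k: "k < W ^ d" "wreg s' ''i'' = k" and fr: "frame (for_com ''i'' ''st'' ?body) (final w ?sb s) s'"
    have v: "wreg s' ''sa'' = W ^ a" "wreg s' ''W'' = W" "wreg s' ''sb'' = W ^ Suc a" "rarr s' M = Mf"
      using s names Wa by (simp_all add: frameD[OF fr] mult.commute)
    have d: "digit W a k * W < 2 ^ w"
    proof -
      have "digit W a k * W \<le> W * W" using digit_less[of W a k] W by (intro mult_le_mono1) simp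
      then show ?thesis using W by linarith
    qed
    \<comment> \<open>The base address of the fibre is the index with digit \<open>a\<close> set to
      zero.\<close>
    have "k div W ^ Suc a * W ^ Suc a + k mod W ^ a \<le> set_digit W a 0 k" by (simp add: set_digit_def)
    also have "\<dots> < W ^ d" using set_digit_less[OF _ a k(1), of 0] W by simp
    finally have b: "k div W ^ Suc a * W ^ Suc a + k mod W ^ a < 2 ^ w" using W by simp
    then have b': "k div W ^ Suc a * W ^ Suc a < 2 ^ w" by linarith
    show "runs w ?body s' (3 * W + 6) (\<lambda>s'. rarr s' F = f \<and> (\<forall>j<Suc k. rarr s' ''TM'' j = ?g j))"
    proof (rule runs_block_Seq[where v = "3 * W + 3"])
      have i: "runs w ?i (final w ?pre s') (3 * W + 2) (\<lambda>s'. rreg s' ''acc'' = ?g k)"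
        using v I k d b b' by (intro runs_axis_inner[OF _ _ _ _ _ _ _ k(1) a W]) (simp_all add: digit_def del: power_Suc)
      show "runs w (?i ;; RStore ''TM'' (WReg ''i'') (RReg ''acc'')) (final w ?pre s') (3 * W + 3)
         (\<lambda>s'. rarr s' F = f \<and> (\<forall>j<Suc k. rarr s' ''TM'' j = ?g j))"
      proof (rule runs_Seq_block[OF i])
        fix s1 assume 1: "rreg s1 ''acc'' = ?g k" and fr1: "frame ?i (final w ?pre s') s1"
        show "rarr (final w (RStore ''TM'' (WReg ''i'') (RReg ''acc'')) s1) F = f \<and>
          (\<forall>j<Suc k. rarr (final w (RStore ''TM'' (WReg ''i'') (RReg ''acc'')) s1) ''TM'' j = ?g j)"
          using 1 I k names by (auto simp: frameD[OF fr1] less_Suc_eq)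
      qed simp_all
    qed simp_all
  qed (use s W in auto)
  show ?thesis unfolding axis_com_def
  proof (rule runs_block_Seq[where v = "W ^ d * (3 * W + 13) + 4"])
    show "runs w (for_com ''i'' ''st'' ?body ;; for_com ''i'' ''st'' (RStore F (WReg ''i'') (RArr ''TM'' (WReg ''i''))))
      (final w ?sb s) (W ^ d * (3 * W + 13) + 4) (\<lambda>s'. \<forall>k<W ^ d. rarr s' F k = ?g k)"
    proof (rule runs_Seq[OF loop1, where v = "W ^ d * 3 + 2"])
      fix s1 assume 1: "\<forall>k<W ^ d. rarr s1 ''TM'' k = ?g k" and fr1: "frame (for_com ''i'' ''st'' ?body) (final w ?sb s) s1"
      have st: "wreg s1 ''st'' = W ^ d" using s by (simp add: frameD[OF fr1])
      show "runs w (for_com ''i'' ''st'' (RStore F (WReg ''i'') (RArr ''TM'' (WReg ''i'')))) s1 (W ^ d * 3 + 2)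
         (\<lambda>s'. \<forall>k<W ^ d. rarr s' F k = ?g k)"
        by (rule runs_for[where N = "W ^ d" and tb = 1 and
            I = "\<lambda>j s'. rarr s' ''TM'' = rarr s1 ''TM'' \<and> (\<forall>k<j. rarr s' F k = ?g k)"])
           (use st W names 1 in \<open>auto intro!: runs_final simp: less_Suc_eq\<close>)
    qed (simp add: algebra_simps)
  qed simp_all
qed

text \<open>\<open>W ^ d\<close> and \<open>W * W\<close> are the sizes of the tensor and of the
  matrices, so these two bounds make every address fit into a word.\<close>

definition params :: "nat \<Rightarrow> nat \<Rightarrow> nat \<Rightarrow> (nat \<Rightarrow> nat) \<Rightarrow> nat \<Rightarrow> bool" where
  "params w W U P d \<longleftrightarrow> moduli U P d \<and> W = 2 * U \<and> 0 < U \<and> W ^ d < 2 ^ w \<and> W * W < 2 ^ w"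

definition hash_state :: "nat \<Rightarrow> (nat \<Rightarrow> nat) \<Rightarrow> nat \<Rightarrow> state \<Rightarrow> bool" where
  "hash_state W P d s \<longleftrightarrow> wreg s ''d'' = d \<and> wreg s ''W'' = W \<and> wreg s ''st'' = W ^ d \<and> warr s ''P'' = P"

lemma params_facts:
  assumes "params w W U P d"
  shows "moduli U P d" "U \<le> W" "2 \<le> W" "0 < W" "W ^ d < 2 ^ w" "W * W < 2 ^ w" "0 < w" "d < 2 ^ w" "W < 2 ^ w"
    "W = 2 * U" "0 < U"
proof -
  show 1: "moduli U P d" "U \<le> W" "2 \<le> W" "0 < W" "W ^ d < 2 ^ w" "W * W < 2 ^ w" "W = 2 * U" "0 < U"
    using assms by (auto simp: params_def)
  show 2: "W < 2 ^ w" using le_less_trans[OF le_square 1(6)] .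
  show "d < 2 ^ w" using power_less_word_size(1)[OF 1(3,5)] .
  show "0 < w" using 1 2 by (cases w) auto
qed

lemma row_index:
  assumes "r < (W::nat)"
  shows "(e * W + r) div W = e" "(e * W + r) mod W = r"
  using assms by auto

lemma row_index_less:
  assumes "e < W" "r < (W::nat)"
  shows "e * W + r < W * W"
proof -
  have "e * W + r < Suc e * W" using assms by simp
  also have "\<dots> \<le> W * W" using assms by (intro mult_le_mono1) simp
  finally show ?thesis .
qed

section \<open>Tables of the Vandermonde matrix and of its inverse\<close>

definition vandermonde_com :: com where
  "vandermonde_com = for_com ''e'' ''W'' (
     (WAssign ''eb'' (WMul (WReg ''e'') (WReg ''W'')) ;; RAssign ''v'' (ROfWord (WConst 1))) ;;
     for_com ''r'' ''W'' (
       RStore ''MV'' (WAdd (WReg ''eb'') (WReg ''r'')) (RReg ''v'') ;;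
       RAssign ''v'' (RMul (RReg ''v'') (ROfWord (WReg ''e'')))))"

lemma wr_vandermonde [simp]:
  "wr_wreg vandermonde_com = {''e'', ''eb'', ''r''}" "wr_warr vandermonde_com = {}"
  "wr_rreg vandermonde_com = {''v''}" "wr_rarr vandermonde_com = {''MV''}"
  by (auto simp: vandermonde_com_def)

definition is_vandermonde :: "nat \<Rightarrow> (nat \<Rightarrow> real) \<Rightarrow> bool" where
  "is_vandermonde W f \<longleftrightarrow> (\<forall>j<W * W. f j = real (j div W) ^ (j mod W))"

lemma runs_vandermonde:
  assumes s: "wreg s ''W'' = W" and W: "W * W < 2 ^ w" "0 < w"
  shows "runs w vandermonde_com s (W * (4 * W + 6) + 2) (\<lambda>s'. is_vandermonde W (rarr s' ''MV''))"
  unfolding vandermonde_com_def is_vandermonde_def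
proof (rule runs_for[where N = W and tb = "4 * W + 4" and
    I = "\<lambda>e s'. \<forall>j<e * W. rarr s' ''MV'' j = real (j div W) ^ (j mod W)"])
  fix e s'
  let ?pre = "WAssign ''eb'' (WMul (WReg ''e'') (WReg ''W'')) ;; RAssign ''v'' (ROfWord (WConst 1))"
  let ?in = "RStore ''MV'' (WAdd (WReg ''eb'') (WReg ''r'')) (RReg ''v'') ;;
       RAssign ''v'' (RMul (RReg ''v'') (ROfWord (WReg ''e'')))"
  assume I: "\<forall>j<e * W. rarr s' ''MV'' j = real (j div W) ^ (j mod W)"
    and e: "e < W" "wreg s' ''e'' = e" and fr: "frame (for_com ''e'' ''W'' (?pre ;; for_com ''r'' ''W'' ?in)) s s'"
  have v: "wreg s' ''W'' = W" using s by (simp add: frameD[OF fr])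
  have eW: "e * W < 2 ^ w" using row_index_less[of e W 0] e W by linarith
  show "runs w (?pre ;; for_com ''r'' ''W'' ?in) s' (4 * W + 4)
    (\<lambda>s'. \<forall>j<Suc e * W. rarr s' ''MV'' j = real (j div W) ^ (j mod W))"
  proof (rule runs_block_Seq[where v = "4 * W + 2"])
    show "runs w (for_com ''r'' ''W'' ?in) (final w ?pre s') (4 * W + 2)
      (\<lambda>s'. \<forall>j<Suc e * W. rarr s' ''MV'' j = real (j div W) ^ (j mod W))"
    proof (rule runs_for[where N = W and tb = 2 and
        I = "\<lambda>r s'. rreg s' ''v'' = real e ^ r \<and> (\<forall>j<e * W + r. rarr s' ''MV'' j = real (j div W) ^ (j mod W))"])
      fix r s1
      assume J: "rreg s1 ''v'' = real e ^ r \<and> (\<forall>j<e * W + r. rarr s1 ''MV'' j = real (j div W) ^ (j mod W))"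
        and r: "r < W" "wreg s1 ''r'' = r" and fr1: "frame (for_com ''r'' ''W'' ?in) (final w ?pre s') s1"
      have v1: "wreg s1 ''eb'' = e * W" "wreg s1 ''e'' = e"
        using v e eW by (simp_all add: frameD[OF fr1])
      show "runs w ?in s1 2 (\<lambda>s'. rreg s' ''v'' = real e ^ Suc r \<and>
          (\<forall>j<e * W + Suc r. rarr s' ''MV'' j = real (j div W) ^ (j mod W)))"
        using J v1 r row_index_less[OF e(1) r(1)] W row_index[OF r(1), of e]
        by (intro runs_final) (auto simp: less_Suc_eq)
    qed (use v I W e le_less_trans[OF le_square W(1)] in \<open>auto simp: add.commute one_less_power\<close>)
  qed simp_all
qed (use s le_less_trans[OF le_square W(1)] in auto)

text \<open>Row \<open>e\<close> starts as the constant polynomial one and takes up the factors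
  \<open>(X - l) / (e - l)\<close> in place. A new coefficient depends on the old one and on its
  lower neighbour, which has just been overwritten and is therefore saved in
  \<open>pr\<close>.\<close>

definition lagrange_com :: com where
  "lagrange_com = for_com ''e'' ''W'' (
     (WAssign ''eb'' (WMul (WReg ''e'') (WReg ''W'')) ;; RStore ''Z'' (WReg ''eb'') (ROfWord (WConst 1))) ;;
     for_com ''l'' ''W'' (Cond (WEq (WReg ''l'') (WReg ''e'')) Skip (
       RAssign ''pr'' (ROfWord (WConst 0)) ;;
       for_com ''r'' ''W'' (
         RAssign ''old'' (RArr ''Z'' (WAdd (WReg ''eb'') (WReg ''r''))) ;;
         RStore ''Z'' (WAdd (WReg ''eb'') (WReg ''r''))
           (RDiv (RSub (RReg ''pr'') (RMul (ROfWord (WReg ''l'')) (RReg ''old'')))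
             (RSub (ROfWord (WReg ''e'')) (ROfWord (WReg ''l'')))) ;;
         RAssign ''pr'' (RReg ''old'')))))"

lemma wr_lagrange [simp]:
  "wr_wreg lagrange_com = {''e'', ''eb'', ''l'', ''r''}" "wr_warr lagrange_com = {}"
  "wr_rreg lagrange_com = {''pr'', ''old''}" "wr_rarr lagrange_com = {''Z''}"
  by (auto simp: lagrange_com_def)

definition is_lagrange :: "nat \<Rightarrow> (nat \<Rightarrow> real) \<Rightarrow> bool" where
  "is_lagrange W f \<longleftrightarrow> (\<forall>j<W * W. f j = coeff (lagrange_poly W (j div W)) (j mod W))"

text \<open>Coefficient \<open>k\<close> of the product uses only coefficients \<open>k - 1\<close>
  and \<open>k\<close>, so working on \<open>W\<close> coefficients loses nothing. While the loop
  runs, the cells below \<open>r\<close> belong to the new polynomial and the others to the old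
  one.\<close>

lemma runs_lagrange_factor:
  assumes s: "wreg s ''W'' = W" "wreg s ''eb'' = e * W" "wreg s ''e'' = e" "wreg s ''l'' = l"
    and Z: "\<And>k. k < W \<Longrightarrow> rarr s ''Z'' (e * W + k) = coeff (lagrange_poly l e) k"
    and e: "e < W" "l \<noteq> e" and W: "W * W < 2 ^ w" "0 < w"
  shows "runs w (RAssign ''pr'' (ROfWord (WConst 0)) ;;
       for_com ''r'' ''W'' (
         RAssign ''old'' (RArr ''Z'' (WAdd (WReg ''eb'') (WReg ''r''))) ;;
         RStore ''Z'' (WAdd (WReg ''eb'') (WReg ''r''))
           (RDiv (RSub (RReg ''pr'') (RMul (ROfWord (WReg ''l'')) (RReg ''old'')))
             (RSub (ROfWord (WReg ''e'')) (ROfWord (WReg ''l'')))) ;;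
         RAssign ''pr'' (RReg ''old''))) s (5 * W + 3)
     (\<lambda>s'. (\<forall>k<W. rarr s' ''Z'' (e * W + k) = coeff (lagrange_poly (Suc l) e) k) \<and>
        (\<forall>j. j < e * W \<or> j \<ge> Suc e * W \<longrightarrow> rarr s' ''Z'' j = rarr s ''Z'' j))"
proof (rule runs_block_Seq[where v = "5 * W + 2"])
  let ?c = "RAssign ''old'' (RArr ''Z'' (WAdd (WReg ''eb'') (WReg ''r''))) ;;
         RStore ''Z'' (WAdd (WReg ''eb'') (WReg ''r''))
           (RDiv (RSub (RReg ''pr'') (RMul (ROfWord (WReg ''l'')) (RReg ''old'')))
             (RSub (ROfWord (WReg ''e'')) (ROfWord (WReg ''l'')))) ;;
         RAssign ''pr'' (RReg ''old'')"
  let ?s = "final w (RAssign ''pr'' (ROfWord (WConst 0))) s"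
  let ?I = "\<lambda>r s'. rreg s' ''pr'' = (if r = 0 then 0 else coeff (lagrange_poly l e) (r - 1)) \<and>
      (\<forall>k<W. rarr s' ''Z'' (e * W + k) = coeff (lagrange_poly (if k < r then Suc l else l) e) k) \<and>
      (\<forall>j. j < e * W \<or> j \<ge> Suc e * W \<longrightarrow> rarr s' ''Z'' j = rarr s ''Z'' j)"
  show "runs w (for_com ''r'' ''W'' ?c) ?s (5 * W + 2)
     (\<lambda>s'. (\<forall>k<W. rarr s' ''Z'' (e * W + k) = coeff (lagrange_poly (Suc l) e) k) \<and>
        (\<forall>j. j < e * W \<or> j \<ge> Suc e * W \<longrightarrow> rarr s' ''Z'' j = rarr s ''Z'' j))"
  proof (rule runs_for[where N = W and tb = 3 and I = ?I])
    fix r s'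
    assume I: "?I r s'" and r: "r < W" "wreg s' ''r'' = r" and fr: "frame (for_com ''r'' ''W'' ?c) ?s s'"
    have v: "wreg s' ''eb'' = e * W" "wreg s' ''e'' = e" "wreg s' ''l'' = l"
      using s by (simp_all add: frameD[OF fr])
    have b: "e * W + r < 2 ^ w" using row_index_less[OF e(1) r(1)] W by linarith
    have old: "rarr s' ''Z'' (e * W + r) = coeff (lagrange_poly l e) r" using I r by auto
    have new: "(rreg s' ''pr'' - real l * rarr s' ''Z'' (e * W + r)) / (real e - real l) =
      coeff (lagrange_poly (Suc l) e) r"
      using I old coeff_lagrange_poly_Suc[OF e(2), of r] by auto
    show "runs w ?c s' 3 (?I (Suc r))"
      using I v b r new old by (intro runs_final) (auto simp: less_Suc_eq)
  qed (use s Z W le_less_trans[OF le_square W(1)] in auto)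
qed simp_all

lemma runs_lagrange:
  assumes s: "wreg s ''W'' = W" and Z: "\<And>j. rarr s ''Z'' j = 0" and W: "W * W < 2 ^ w" "0 < w"
  shows "runs w lagrange_com s (W * (W * (5 * W + 6) + 6) + 2) (\<lambda>s'. is_lagrange W (rarr s' ''Z''))"
  unfolding lagrange_com_def is_lagrange_def
\<comment> \<open>Rows not reached yet must be zero, so that storing a single one makes row
  \<open>e\<close> the constant polynomial.\<close>
proof (rule runs_for[where N = W and tb = "W * (5 * W + 6) + 4" and
    I = "\<lambda>e s'. (\<forall>j<e * W. rarr s' ''Z'' j = coeff (lagrange_poly W (j div W)) (j mod W)) \<and>
      (\<forall>j\<ge>e * W. rarr s' ''Z'' j = 0)"])
  fix e s'
  let ?pre = "WAssign ''eb'' (WMul (WReg ''e'') (WReg ''W'')) ;; RStore ''Z'' (WReg ''eb'') (ROfWord (WConst 1))"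
  let ?fac = "RAssign ''pr'' (ROfWord (WConst 0)) ;;
       for_com ''r'' ''W'' (
         RAssign ''old'' (RArr ''Z'' (WAdd (WReg ''eb'') (WReg ''r''))) ;;
         RStore ''Z'' (WAdd (WReg ''eb'') (WReg ''r''))
           (RDiv (RSub (RReg ''pr'') (RMul (ROfWord (WReg ''l'')) (RReg ''old'')))
             (RSub (ROfWord (WReg ''e'')) (ROfWord (WReg ''l'')))) ;;
         RAssign ''pr'' (RReg ''old''))"
  let ?in = "Cond (WEq (WReg ''l'') (WReg ''e'')) Skip ?fac"
  assume I: "(\<forall>j<e * W. rarr s' ''Z'' j = coeff (lagrange_poly W (j div W)) (j mod W)) \<and>
      (\<forall>j\<ge>e * W. rarr s' ''Z'' j = 0)"
    and e: "e < W" "wreg s' ''e'' = e" and fr: "frame (for_com ''e'' ''W'' (?pre ;; for_com ''l'' ''W'' ?in)) s s'"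
  have v: "wreg s' ''W'' = W" using s by (simp add: frameD[OF fr])
  have eW: "e * W < 2 ^ w" using row_index_less[of e W 0] e W by linarith
  let ?s = "final w ?pre s'"
  have sZ: "rarr ?s ''Z'' = (rarr s' ''Z'')(e * W := 1)" using v e eW W by (simp add: one_less_power)
  let ?J = "\<lambda>l s1. (\<forall>k<W. rarr s1 ''Z'' (e * W + k) = coeff (lagrange_poly l e) k) \<and>
     (\<forall>j. j < e * W \<or> j \<ge> Suc e * W \<longrightarrow> rarr s1 ''Z'' j = rarr s' ''Z'' j)"
  show "runs w (?pre ;; for_com ''l'' ''W'' ?in) s' (W * (5 * W + 6) + 4)
    (\<lambda>s'. (\<forall>j<Suc e * W. rarr s' ''Z'' j = coeff (lagrange_poly W (j div W)) (j mod W)) \<and>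
      (\<forall>j\<ge>Suc e * W. rarr s' ''Z'' j = 0))"
  proof (rule runs_block_Seq[where v = "W * (5 * W + 6) + 2"])
    show "runs w (for_com ''l'' ''W'' ?in) ?s (W * (5 * W + 6) + 2)
      (\<lambda>s'. (\<forall>j<Suc e * W. rarr s' ''Z'' j = coeff (lagrange_poly W (j div W)) (j mod W)) \<and>
      (\<forall>j\<ge>Suc e * W. rarr s' ''Z'' j = 0))"
    proof (rule runs_for[where N = W and tb = "5 * W + 4" and I = ?J])
      fix l s1
      assume J: "?J l s1" and l: "l < W" "wreg s1 ''l'' = l" and fr1: "frame (for_com ''l'' ''W'' ?in) ?s s1"
      have v1: "wreg s1 ''eb'' = e * W" "wreg s1 ''e'' = e" "wreg s1 ''W'' = W"
        using v e eW by (simp_all add: frameD[OF fr1])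
      show "runs w ?in s1 (5 * W + 4) (?J (Suc l))"
      proof (rule runs_Cond[where t = "5 * W + 3"])
        assume "bval w (WEq (WReg ''l'') (WReg ''e'')) s1"
        then have "l = e" using l v1 by simp
        then show "runs w Skip s1 (5 * W + 3) (?J (Suc l))"
          using J by (intro runs_final) (auto simp: lagrange_poly_Suc_same)
      next
        assume "\<not> bval w (WEq (WReg ''l'') (WReg ''e'')) s1"
        then have le: "l \<noteq> e" using l v1 by simp
        show "runs w ?fac s1 (5 * W + 3) (?J (Suc l))"
          by (rule runs_conseq[OF runs_lagrange_factor[OF v1(3,1,2) l(2) _ e(1) le W]]) (use J in auto)
      qed simp
    next
      show "?J 0 ?s"
        unfolding sZ using I e by (auto simp: lagrange_poly_0 coeff_1 add.commute)
      fix s1 assume J: "?J W s1"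
      show "(\<forall>j<Suc e * W. rarr s1 ''Z'' j = coeff (lagrange_poly W (j div W)) (j mod W)) \<and>
          (\<forall>j\<ge>Suc e * W. rarr s1 ''Z'' j = 0)"
      proof (intro conjI allI impI)
        fix j assume j: "j < Suc e * W"
        show "rarr s1 ''Z'' j = coeff (lagrange_poly W (j div W)) (j mod W)"
        proof (cases "j < e * W")
          case True
          then show ?thesis using J I by auto
        next
          case False
          then obtain k where k: "j = e * W + k" "k < W" using j by (auto simp: not_less le_iff_add)
          then show ?thesis using J row_index[OF k(2), of e] by auto
        qed
      next
        fix j assume "j \<ge> Suc e * W"
        then show "rarr s1 ''Z'' j = 0" using J I by auto
      qed
    qed (use v le_less_trans[OF le_square W(1)] in auto)
  qed simp_all
qed (use s Z le_less_trans[OF le_square W(1)] in auto)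

text \<open>The product of two sums of rank-one terms runs over pairs of terms; this is where the
  pairs of input entries arise.\<close>

lemma tensor_mult:
  assumes "finite I" "finite J"
  shows "tensor W d I v F i * tensor W d J v' G i =
    tensor W d (I \<times> J) (\<lambda>k. v (fst k) * v' (snd k)) (\<lambda>u k e. F u (fst k) e * G u (snd k) e) i"
  unfolding tensor_def sum_product sum.cartesian_product
  by (auto simp: prod.distrib case_prod_beta mult_ac intro!: sum.cong)

section \<open>Evaluation, pointwise product and folded interpolation, axis by axis\<close>

definition forward_com :: com where
  "forward_com = WAssign ''sa'' (WConst 1) ;;
     for_com ''u'' ''d'' (axis_com ''MV'' ''FA'' ;; axis_com ''MV'' ''FB'' ;;
       WAssign ''sa'' (WMul (WReg ''sa'') (WReg ''W'')))"

lemma wr_forward [simp]: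
  "wr_wreg forward_com = {''sa'', ''u'', ''sb'', ''i'', ''eb'', ''b'', ''r''}" "wr_warr forward_com = {}"
  "wr_rreg forward_com = {''acc''}" "wr_rarr forward_com = {''TM'', ''FA'', ''FB''}"
  by (auto simp: forward_com_def)

lemma axis_tensor:
  assumes W: "0 < W" and a: "a < d" and f: "\<And>i. i < W ^ d \<Longrightarrow> f i = tensor W d I v F i"
    and g: "\<And>k. k < W ^ d \<Longrightarrow> g k = (\<Sum>r<W. M (digit W a k * W + r) * f (set_digit W a r k))"
    and FG: "\<And>u k e. u < d \<Longrightarrow> k \<in> I \<Longrightarrow> e < W \<Longrightarrow>
       (if u = a then (\<Sum>r<W. M (e * W + r) * F a k r) else F u k e) = G u k e"
    and i: "i < W ^ d"
  shows "g i = tensor W d I v G i"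
proof -
  have "g i = (\<Sum>r<W. M (digit W a i * W + r) * tensor W d I v F (set_digit W a r i))"
    using g[OF i] set_digit_less[OF _ a i] by (simp add: f)
  also have "\<dots> = tensor W d I v (F(a := \<lambda>k e. \<Sum>r<W. M (e * W + r) * F a k r)) i"
    by (rule tensor_axis[OF W a, where M = "\<lambda>e r. M (e * W + r)"])
  also have "\<dots> = tensor W d I v G i"
    by (rule tensor_cong[OF W]) (simp add: FG[symmetric])
  finally show ?thesis .
qed

text \<open>The factors after \<open>a\<close> axes have been treated: these axes hold the values of
  a monomial at all points \<open>e\<close>, the others still its coefficients.\<close>

definition part_eval :: "(nat \<Rightarrow> nat) \<Rightarrow> ('k \<Rightarrow> nat) \<Rightarrow> nat \<Rightarrow> nat \<Rightarrow> 'k \<Rightarrow> nat \<Rightarrow> real" where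
  "part_eval P x a u k e = (if u < a then real e ^ (x k mod P u) else if x k mod P u = e then 1 else 0)"

lemma part_eval_step:
  assumes P: "moduli U P d" "U \<le> W" and M: "is_vandermonde W M" and u: "u < d" and e: "e < W"
  shows "(if u = a then (\<Sum>r<W. M (e * W + r) * part_eval P x a a k r) else part_eval P x a u k e) =
    part_eval P x (Suc a) u k e"
proof (cases "u = a")
  case True
  have lt: "x k mod P a < W"
    using P u True by (metis less_le_trans mod_less_divisor moduli_def order.trans)
  have "(\<Sum>r<W. M (e * W + r) * part_eval P x a a k r) =
    (\<Sum>r<W. if r = x k mod P a then real e ^ r else 0)"
    using M row_index_less[OF e] row_index[of _ W e]
    by (intro sum.cong) (auto simp: part_eval_def is_vandermonde_def)
  then show ?thesis using True lt by (simp add: part_eval_def)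
qed (auto simp: part_eval_def)

lemma runs_forward:
  assumes pa: "params w W U P d" and h: "hash_state W P d s" and MV: "is_vandermonde W (rarr s ''MV'')"
    and FA: "\<And>i. i < W ^ d \<Longrightarrow> rarr s ''FA'' i = tensor W d I v (part_eval P x 0) i"
    and FB: "\<And>i. i < W ^ d \<Longrightarrow> rarr s ''FB'' i = tensor W d J v' (part_eval P y 0) i"
  shows "runs w forward_com s (d * (2 * (W ^ d * (3 * W + 13)) + 13) + 3)
    (\<lambda>s'. \<forall>i<W ^ d. rarr s' ''FA'' i = tensor W d I v (part_eval P x d) i \<and>
       rarr s' ''FB'' i = tensor W d J v' (part_eval P y d) i)"
  unfolding forward_com_def
proof (rule runs_block_Seq)
  note pf = params_facts[OF pa]
  let ?s = "final w (WAssign ''sa'' (WConst 1)) s"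
  let ?c = "axis_com ''MV'' ''FA'' ;; axis_com ''MV'' ''FB'' ;; WAssign ''sa'' (WMul (WReg ''sa'') (WReg ''W''))"
  let ?I = "\<lambda>a s'. wreg s' ''sa'' = W ^ a \<and> (\<forall>i<W ^ d. rarr s' ''FA'' i = tensor W d I v (part_eval P x a) i \<and>
       rarr s' ''FB'' i = tensor W d J v' (part_eval P y a) i)"
  show "runs w (for_com ''u'' ''d'' ?c) ?s (d * (2 * (W ^ d * (3 * W + 13)) + 13) + 2)
    (\<lambda>s'. \<forall>i<W ^ d. rarr s' ''FA'' i = tensor W d I v (part_eval P x d) i \<and>
       rarr s' ''FB'' i = tensor W d J v' (part_eval P y d) i)"
  proof (rule runs_for[where N = d and tb = "2 * (W ^ d * (3 * W + 13)) + 11" and I = ?I])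
    fix a s'
    assume I: "?I a s'" and a: "a < d" "wreg s' ''u'' = a" and fr: "frame (for_com ''u'' ''d'' ?c) ?s s'"
    have v: "wreg s' ''W'' = W" "wreg s' ''st'' = W ^ d" "is_vandermonde W (rarr s' ''MV'')"
      using h MV by (simp_all add: frameD[OF fr] hash_state_def)
    have Wa: "W ^ a * W < 2 ^ w"
      using power_less_word_size(2)[OF pf(3,5), of "Suc a"] a by (simp add: mult.commute)
    show "runs w ?c s' (2 * (W ^ d * (3 * W + 13)) + 11) (?I (Suc a))"
    proof (rule runs_Seq)
      show "runs w (axis_com ''MV'' ''FA'') s' (W ^ d * (3 * W + 13) + 5) (\<lambda>s1. \<forall>k<W ^ d. rarr s1 ''FA'' k =
          (\<Sum>r<W. rarr s' ''MV'' (digit W a k * W + r) * rarr s' ''FA'' (set_digit W a r k)))"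
        using I v a by (intro runs_axis pf) auto
      fix s1 assume 1: "\<forall>k<W ^ d. rarr s1 ''FA'' k =
          (\<Sum>r<W. rarr s' ''MV'' (digit W a k * W + r) * rarr s' ''FA'' (set_digit W a r k))"
        and fr1: "frame (axis_com ''MV'' ''FA'') s' s1"
      have 1: "rarr s1 ''FA'' i = tensor W d I v (part_eval P x (Suc a)) i" if "i < W ^ d" for i
        using I 1 that by (intro axis_tensor[OF pf(4) a(1) _ _ part_eval_step[OF pf(1,2) v(3)]]) auto
      have v1: "wreg s1 ''W'' = W" "wreg s1 ''st'' = W ^ d" "rarr s1 ''MV'' = rarr s' ''MV''"
          "wreg s1 ''sa'' = W ^ a" "rarr s1 ''FB'' = rarr s' ''FB''"
        using v I by (simp_all add: frameD[OF fr1])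
      show "runs w (axis_com ''MV'' ''FB'' ;; WAssign ''sa'' (WMul (WReg ''sa'') (WReg ''W''))) s1
        (W ^ d * (3 * W + 13) + 6) (?I (Suc a))"
      proof (rule runs_Seq_block)
        show "runs w (axis_com ''MV'' ''FB'') s1 (W ^ d * (3 * W + 13) + 5) (\<lambda>s2. \<forall>k<W ^ d. rarr s2 ''FB'' k =
          (\<Sum>r<W. rarr s' ''MV'' (digit W a k * W + r) * rarr s' ''FB'' (set_digit W a r k)))"
          using v1 a by (intro runs_axis pf) auto
        fix s2 assume 2: "\<forall>k<W ^ d. rarr s2 ''FB'' k =
          (\<Sum>r<W. rarr s' ''MV'' (digit W a k * W + r) * rarr s' ''FB'' (set_digit W a r k))"
          and fr2: "frame (axis_com ''MV'' ''FB'') s1 s2"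
        have 2: "rarr s2 ''FB'' i = tensor W d J v' (part_eval P y (Suc a)) i" if "i < W ^ d" for i
          using I 2 that by (intro axis_tensor[OF pf(4) a(1) _ _ part_eval_step[OF pf(1,2) v(3)]]) auto
        show "?I (Suc a) (final w (WAssign ''sa'' (WMul (WReg ''sa'') (WReg ''W''))) s2)"
          using 1 2 v1 Wa by (simp add: frameD[OF fr2] mult.commute)
      qed simp_all
    qed simp
  qed (use h pf FA FB in \<open>auto simp: hash_state_def one_less_power\<close>)
qed simp_all

text \<open>One matrix both inverts the evaluation and folds exponents modulo \<open>P a\<close>; it
  is rebuilt for each axis, since the moduli differ. The table \<open>Z\<close> is read transposed:
  row \<open>r\<close> of \<open>Z\<close> belongs to evaluation point \<open>r\<close>, which is a
  column here.\<close>

definition fill_com :: com where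
  "fill_com = WAssign ''p'' (WArr ''P'' (WReg ''u'')) ;;
     for_com ''e'' ''W'' (
       WAssign ''eb'' (WMul (WReg ''e'') (WReg ''W'')) ;;
       for_com ''r'' ''W'' (
         Cond (WLess (WReg ''e'') (WReg ''p''))
           (WAssign ''b'' (WAdd (WMul (WReg ''r'') (WReg ''W'')) (WReg ''e'')) ;;
            RStore ''MN'' (WAdd (WReg ''eb'') (WReg ''r''))
              (RAdd (RArr ''Z'' (WReg ''b'')) (RArr ''Z'' (WAdd (WReg ''b'') (WReg ''p'')))))
           (RStore ''MN'' (WAdd (WReg ''eb'') (WReg ''r'')) (ROfWord (WConst 0)))))"

lemma wr_fill [simp]:
  "wr_wreg fill_com = {''p'', ''e'', ''eb'', ''r'', ''b''}" "wr_warr fill_com = {}"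
  "wr_rreg fill_com = {}" "wr_rarr fill_com = {''MN''}"
  by (auto simp: fill_com_def)

definition folded_entry :: "nat \<Rightarrow> nat \<Rightarrow> nat \<Rightarrow> nat \<Rightarrow> real" where
  "folded_entry W p k e =
     (if k < p then coeff (lagrange_poly W e) k + coeff (lagrange_poly W e) (k + p) else 0)"

lemma runs_fill:
  assumes pa: "params w W U P d" and h: "hash_state W P d s" and Z: "is_lagrange W (rarr s ''Z'')"
    and u: "wreg s ''u'' = a" "a < d"
  shows "runs w fill_com s (W * (7 * W + 5) + 3)
    (\<lambda>s'. \<forall>j<W * W. rarr s' ''MN'' j = folded_entry W (P a) (j div W) (j mod W))"
  unfolding fill_com_def
proof (rule runs_block_Seq)
  note pf = params_facts[OF pa]
  let ?s = "final w (WAssign ''p'' (WArr ''P'' (WReg ''u''))) s"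
  let ?in = "Cond (WLess (WReg ''e'') (WReg ''p''))
           (WAssign ''b'' (WAdd (WMul (WReg ''r'') (WReg ''W'')) (WReg ''e'')) ;;
            RStore ''MN'' (WAdd (WReg ''eb'') (WReg ''r''))
              (RAdd (RArr ''Z'' (WReg ''b'')) (RArr ''Z'' (WAdd (WReg ''b'') (WReg ''p'')))))
           (RStore ''MN'' (WAdd (WReg ''eb'') (WReg ''r'')) (ROfWord (WConst 0)))"
  let ?eb = "WAssign ''eb'' (WMul (WReg ''e'') (WReg ''W''))"
  let ?g = "\<lambda>j. folded_entry W (P a) (j div W) (j mod W)"
  have p: "0 < P a" "P a \<le> U" using pf(1) u by (auto simp: moduli_def)
  show "runs w (for_com ''e'' ''W'' (?eb ;; for_com ''r'' ''W'' ?in)) ?s (W * (7 * W + 5) + 2)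
    (\<lambda>s'. \<forall>j<W * W. rarr s' ''MN'' j = ?g j)"
  proof (rule runs_for[where N = W and tb = "7 * W + 3" and I = "\<lambda>e s'. \<forall>j<e * W. rarr s' ''MN'' j = ?g j"])
    fix e s'
    assume I: "\<forall>j<e * W. rarr s' ''MN'' j = ?g j" and e: "e < W" "wreg s' ''e'' = e"
      and fr: "frame (for_com ''e'' ''W'' (?eb ;; for_com ''r'' ''W'' ?in)) ?s s'"
    have v: "wreg s' ''W'' = W" "wreg s' ''p'' = P a" "rarr s' ''Z'' = rarr s ''Z''"
      using h u by (simp_all add: frameD[OF fr] hash_state_def)
    have eW: "e * W < 2 ^ w" using row_index_less[of e W 0] e pf by linarith
    show "runs w (?eb ;; for_com ''r'' ''W'' ?in) s' (7 * W + 3) (\<lambda>s'. \<forall>j<Suc e * W. rarr s' ''MN'' j = ?g j)"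
    proof (rule runs_block_Seq[where v = "7 * W + 2"])
      show "runs w (for_com ''r'' ''W'' ?in) (final w ?eb s') (7 * W + 2) (\<lambda>s'. \<forall>j<Suc e * W. rarr s' ''MN'' j = ?g j)"
      proof (rule runs_for[where N = W and tb = 5 and I = "\<lambda>r s'. \<forall>j<e * W + r. rarr s' ''MN'' j = ?g j"])
        fix r s1
        assume J: "\<forall>j<e * W + r. rarr s1 ''MN'' j = ?g j" and r: "r < W" "wreg s1 ''r'' = r"
          and fr1: "frame (for_com ''r'' ''W'' ?in) (final w ?eb s') s1"
        have v1: "wreg s1 ''eb'' = e * W" "wreg s1 ''e'' = e" "wreg s1 ''W'' = W" "wreg s1 ''p'' = P a"
            "rarr s1 ''Z'' = rarr s ''Z''"
          using v e eW by (simp_all add: frameD[OF fr1])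
        have b1: "e * W + r < 2 ^ w" "r * W + e < 2 ^ w" "r * W < 2 ^ w"
          using row_index_less[OF e(1) r(1)] row_index_less[OF r(1) e(1)] pf by linarith+
        \<comment> \<open>Since \<open>e < P a\<close> and \<open>2 * P a \<le> W\<close>, the
          folded partner stays within the same row of \<open>Z\<close>.\<close>
        have ep: "e + P a < W" if "e < P a" using that p pf by linarith
        have b2: "r * W + e + P a < W * W" if "e < P a"
          using row_index_less[OF r(1) ep[OF that]] by (simp add: add.assoc)
        have b2': "r * W + e + P a < 2 ^ w" if "e < P a" using b2[OF that] pf by linarith
        have z: "rarr s ''Z'' (r * W + e) = coeff (lagrange_poly W r) e"
          using Z row_index_less[OF r(1) e(1)] row_index[OF e(1)] by (simp add: is_lagrange_def)
        have z': "rarr s ''Z'' (r * W + e + P a) = coeff (lagrange_poly W r) (e + P a)" if "e < P a"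
          using Z b2[OF that] row_index[OF ep[OF that], of r] by (simp add: is_lagrange_def add.assoc)
        have "(if e < P a then rarr s ''Z'' (r * W + e) + rarr s ''Z'' (r * W + e + P a) else 0) = ?g (e * W + r)"
          using row_index[OF r(1), of e] z z' by (simp add: folded_entry_def)
        then show "runs w ?in s1 5 (\<lambda>s'. \<forall>j<e * W + Suc r. rarr s' ''MN'' j = ?g j)"
          using J v1 r b1 b2' by (intro runs_final) (auto simp: less_Suc_eq)
      qed (use v I pf in \<open>auto simp: add.commute\<close>)
    qed simp_all
  qed (use h pf in \<open>auto simp: hash_state_def\<close>)
qed simp_all

definition inverse_com :: com where
  "inverse_com = WAssign ''sa'' (WConst 1) ;;
     for_com ''u'' ''d'' (fill_com ;; axis_com ''MN'' ''FA'' ;;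
       WAssign ''sa'' (WMul (WReg ''sa'') (WReg ''W'')))"

lemma wr_inverse [simp]:
  "wr_wreg inverse_com = {''sa'', ''u'', ''p'', ''e'', ''sb'', ''i'', ''eb'', ''b'', ''r''}" "wr_warr inverse_com = {}"
  "wr_rreg inverse_com = {''acc''}" "wr_rarr inverse_com = {''MN'', ''TM'', ''FA''}"
  by (auto simp: inverse_com_def)

text \<open>The counterpart of \<open>part_eval\<close> on the way back. Untreated axes carry a sum
  of two residues as exponent, not yet reduced; treated axes carry the residue of the sum.\<close>

definition part_interp ::
  "(nat \<Rightarrow> nat) \<Rightarrow> ('k \<Rightarrow> nat) \<Rightarrow> ('l \<Rightarrow> nat) \<Rightarrow> nat \<Rightarrow> nat \<Rightarrow> 'k \<times> 'l \<Rightarrow> nat \<Rightarrow> real" where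
  "part_interp P x y a u k e =
     (if u < a then if (x (fst k) + y (snd k)) mod P u = e then 1 else 0
      else real e ^ (x (fst k) mod P u + y (snd k) mod P u))"

lemma part_interp_step:
  assumes P: "moduli U P d" and W: "W = 2 * U" and M: "\<And>j. j < W * W \<Longrightarrow> M j = folded_entry W (P a) (j div W) (j mod W)"
    and u: "u < d" and e: "e < W"
  shows "(if u = a then (\<Sum>r<W. M (e * W + r) * part_interp P x y a a k r) else part_interp P x y a u k e) =
    part_interp P x y (Suc a) u k e"
proof (cases "u = a")
  case True
  let ?r = "x (fst k) mod P a + y (snd k) mod P a"
  have p: "0 < P a" "P a \<le> U" using P u True by (auto simp: moduli_def)
  have r: "?r < 2 * P a - 1"
    using mod_less_divisor[OF p(1), of "x (fst k)"] mod_less_divisor[OF p(1), of "y (snd k)"] by linarith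
  have "(\<Sum>r<W. M (e * W + r) * part_interp P x y a a k r) = (\<Sum>r<W. folded_entry W (P a) e r * real r ^ ?r)"
    using M row_index_less[OF e] row_index[of _ W e] by (intro sum.cong) (auto simp: part_interp_def)
  also have "\<dots> = (if ?r mod P a = e then 1 else 0)"
    unfolding folded_entry_def by (rule folded_interpolation[OF p W r])
  finally show ?thesis using True by (simp add: part_interp_def mod_simps)
qed (auto simp: part_interp_def)

lemma runs_inverse:
  assumes pa: "params w W U P d" and h: "hash_state W P d s" and Z: "is_lagrange W (rarr s ''Z'')"
    and FA: "\<And>i. i < W ^ d \<Longrightarrow> rarr s ''FA'' i = tensor W d I v (part_interp P x y 0) i"
  shows "runs w inverse_com s (d * (W ^ d * (3 * W + 13) + W * (7 * W + 5) + 11) + 3)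
    (\<lambda>s'. \<forall>i<W ^ d. rarr s' ''FA'' i = tensor W d I v (part_interp P x y d) i)"
  unfolding inverse_com_def
proof (rule runs_block_Seq)
  note pf = params_facts[OF pa]
  let ?s = "final w (WAssign ''sa'' (WConst 1)) s"
  let ?c = "fill_com ;; axis_com ''MN'' ''FA'' ;; WAssign ''sa'' (WMul (WReg ''sa'') (WReg ''W''))"
  let ?I = "\<lambda>a s'. wreg s' ''sa'' = W ^ a \<and> (\<forall>i<W ^ d. rarr s' ''FA'' i = tensor W d I v (part_interp P x y a) i)"
  show "runs w (for_com ''u'' ''d'' ?c) ?s (d * (W ^ d * (3 * W + 13) + W * (7 * W + 5) + 11) + 2)
    (\<lambda>s'. \<forall>i<W ^ d. rarr s' ''FA'' i = tensor W d I v (part_interp P x y d) i)"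
  proof (rule runs_for[where N = d and tb = "W ^ d * (3 * W + 13) + W * (7 * W + 5) + 9" and I = ?I])
    fix a s'
    assume I: "?I a s'" and a: "a < d" "wreg s' ''u'' = a" and fr: "frame (for_com ''u'' ''d'' ?c) ?s s'"
    have h': "hash_state W P d s'" "is_lagrange W (rarr s' ''Z'')"
      using h Z by (simp_all add: frameD[OF fr] hash_state_def)
    have Wa: "W ^ a * W < 2 ^ w"
      using power_less_word_size(2)[OF pf(3,5), of "Suc a"] a by (simp add: mult.commute)
    show "runs w ?c s' (W ^ d * (3 * W + 13) + W * (7 * W + 5) + 9) (?I (Suc a))"
    proof (rule runs_Seq[OF runs_fill[OF pa h' a(2,1)]])
      fix s1 assume 1: "\<forall>j<W * W. rarr s1 ''MN'' j = folded_entry W (P a) (j div W) (j mod W)"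
        and fr1: "frame fill_com s' s1"
      have v1: "wreg s1 ''W'' = W" "wreg s1 ''st'' = W ^ d" "wreg s1 ''sa'' = W ^ a" "rarr s1 ''FA'' = rarr s' ''FA''"
        using h' I by (simp_all add: frameD[OF fr1] hash_state_def)
      show "runs w (axis_com ''MN'' ''FA'' ;; WAssign ''sa'' (WMul (WReg ''sa'') (WReg ''W''))) s1
        (W ^ d * (3 * W + 13) + 6) (?I (Suc a))"
      proof (rule runs_Seq_block)
        show "runs w (axis_com ''MN'' ''FA'') s1 (W ^ d * (3 * W + 13) + 5) (\<lambda>s2. \<forall>k<W ^ d. rarr s2 ''FA'' k =
          (\<Sum>r<W. rarr s1 ''MN'' (digit W a k * W + r) * rarr s' ''FA'' (set_digit W a r k)))"
          using v1 a by (intro runs_axis pf) auto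
        fix s2 assume 2: "\<forall>k<W ^ d. rarr s2 ''FA'' k =
          (\<Sum>r<W. rarr s1 ''MN'' (digit W a k * W + r) * rarr s' ''FA'' (set_digit W a r k))"
          and fr2: "frame (axis_com ''MN'' ''FA'') s1 s2"
        have 2: "rarr s2 ''FA'' i = tensor W d I v (part_interp P x y (Suc a)) i" if "i < W ^ d" for i
          using I 1 2 that by (intro axis_tensor[OF pf(4) a(1) _ _ part_interp_step[where M = "rarr s1 ''MN''", OF pf(1,10)]]) auto
        show "?I (Suc a) (final w (WAssign ''sa'' (WMul (WReg ''sa'') (WReg ''W''))) s2)"
          using 2 v1 Wa by (simp add: frameD[OF fr2] mult.commute)
      qed simp_all
    qed simp
  qed (use h pf FA in \<open>auto simp: hash_state_def one_less_power\<close>)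
qed simp_all

definition conv_com :: com where
  "conv_com = clear_com ''FA'' ;; clear_com ''FB'' ;;
     fold_com ''A'' ''lenA'' ''FA'' ;; fold_com ''B'' ''lenB'' ''FB'' ;; forward_com ;;
     for_com ''i'' ''st'' (RStore ''FA'' (WReg ''i'') (RMul (RArr ''FA'' (WReg ''i'')) (RArr ''FB'' (WReg ''i'')))) ;;
     inverse_com"

lemma wr_conv [simp]:
  "wr_wreg conv_com = {''i'', ''x'', ''h'', ''hs'', ''hu'', ''sa'', ''u'', ''p'', ''e'', ''sb'', ''eb'', ''b'', ''r''}"
  "wr_warr conv_com = {}" "wr_rreg conv_com = {''acc''}" "wr_rarr conv_com = {''MN'', ''TM'', ''FA'', ''FB''}"
  by (auto simp: conv_com_def)

definition input_state ::
  "nat \<Rightarrow> (nat \<Rightarrow> nat) \<Rightarrow> (nat \<Rightarrow> real) \<Rightarrow> nat \<Rightarrow> (nat \<Rightarrow> nat) \<Rightarrow> (nat \<Rightarrow> real) \<Rightarrow> state \<Rightarrow> bool" where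
  "input_state na ai av nb bi bv s \<longleftrightarrow> wreg s ''lenA'' = na \<and> wreg s ''lenB'' = nb \<and>
     warr s ''A'' = ai \<and> warr s ''B'' = bi \<and> rarr s ''A'' = av \<and> rarr s ''B'' = bv"

definition conv_time :: "nat \<Rightarrow> nat \<Rightarrow> nat \<Rightarrow> nat" where
  "conv_time n W d = n * (4 * d + 8) +
     d * (3 * (W ^ d * (3 * W + 13)) + W * (7 * W + 5) + 24) + 9 * W ^ d + 16"

text \<open>Pointwise multiplication adds exponents, so the product tensor consists of the monomials
  of all pairs of entries. The later stages are verified before the earlier ones, so that each
  precondition is on hand when its predecessor has to establish it.\<close>

lemma runs_conv:
  assumes pa: "params w W U P d" and h: "hash_state W P d s" and inp: "input_state na ai av nb bi bv s"
    and n: "na < 2 ^ w" "nb < 2 ^ w" and q: "wreg s ''pw'' = q"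
    and mats: "is_vandermonde W (rarr s ''MV'')" "is_lagrange W (rarr s ''Z'')"
  shows "runs w conv_com s (conv_time (na + nb) W d)
    (\<lambda>s'. \<forall>i<W ^ d. rarr s' ''FA'' i =
       bucket_sum ({..<na} \<times> {..<nb}) (pair_val av bv) (\<lambda>k. mkey W P d (pair_pos ai bi q k)) i)"
  unfolding conv_com_def
proof -
  note pf = params_facts[OF pa]
  let ?Q = "W ^ d"
  let ?x = "\<lambda>i. ai i div q" and ?y = "\<lambda>i. bi i div q"
  let ?K = "{..<na} \<times> {..<nb}"
  let ?mul = "for_com ''i'' ''st'' (RStore ''FA'' (WReg ''i'') (RMul (RArr ''FA'' (WReg ''i'')) (RArr ''FB'' (WReg ''i''))))"
  let ?post = "\<lambda>s'. \<forall>i<?Q. rarr s' ''FA'' i = bucket_sum ?K (pair_val av bv) (\<lambda>k. mkey W P d (pair_pos ai bi q k)) i"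
  define ti where "ti = d * (W ^ d * (3 * W + 13) + W * (7 * W + 5) + 11) + 3"
  define tf where "tf = d * (2 * (W ^ d * (3 * W + 13)) + 13) + 3"
  have inv: "runs w inverse_com s' ti ?post"
    if hs: "hash_state W P d s'" "is_lagrange W (rarr s' ''Z'')"
      and FA: "\<And>i. i < ?Q \<Longrightarrow> rarr s' ''FA'' i = tensor W d ?K (pair_val av bv) (part_interp P ?x ?y 0) i" for s'
    unfolding ti_def
  proof (rule runs_conseq[OF runs_inverse[OF pa hs FA]])
    fix s2 assume "\<forall>i<?Q. rarr s2 ''FA'' i = tensor W d ?K (pair_val av bv) (part_interp P ?x ?y d) i"
    moreover have "tensor W d ?K (pair_val av bv) (part_interp P ?x ?y d) i =
      bucket_sum ?K (pair_val av bv) (\<lambda>k. mkey W P d (pair_pos ai bi q k)) i" if "i < ?Q" for i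
    proof -
      have "tensor W d ?K (pair_val av bv) (part_interp P ?x ?y d) i =
        tensor W d ?K (pair_val av bv) (\<lambda>u k e. if pair_pos ai bi q k mod P u = e then 1 else 0) i"
        by (rule tensor_cong[OF pf(4)]) (simp add: part_interp_def pair_pos_def)
      also have "\<dots> = bucket_sum ?K (pair_val av bv) (\<lambda>k. mkey W P d (pair_pos ai bi q k)) i"
        unfolding bucket_sum_def by (rule tensor_mkey[OF pf(1,2) that]) simp
      finally show ?thesis .
    qed
    ultimately show "?post s2" by simp
  qed simp_all
  have mul: "runs w (?mul ;; inverse_com) s' (3 * ?Q + 2 + ti) ?post"
    if hs: "hash_state W P d s'" "is_lagrange W (rarr s' ''Z'')"
      and F: "\<forall>i<?Q. rarr s' ''FA'' i = tensor W d {..<na} av (part_eval P ?x d) i \<and>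
        rarr s' ''FB'' i = tensor W d {..<nb} bv (part_eval P ?y d) i" for s'
  proof (rule runs_Seq)
    show "runs w ?mul s' (3 * ?Q + 2) (\<lambda>s1. \<forall>i<?Q. rarr s1 ''FA'' i = rarr s' ''FA'' i * rarr s' ''FB'' i)"
      by (rule runs_for[where N = ?Q and tb = 1 and
          I = "\<lambda>k s1. (\<forall>i<k. rarr s1 ''FA'' i = rarr s' ''FA'' i * rarr s' ''FB'' i) \<and>
            (\<forall>i\<ge>k. rarr s1 ''FA'' i = rarr s' ''FA'' i) \<and> rarr s1 ''FB'' = rarr s' ''FB''"])
         (use hs pf in \<open>auto intro!: runs_final simp: hash_state_def less_Suc_eq\<close>)
    fix s1 assume 1: "\<forall>i<?Q. rarr s1 ''FA'' i = rarr s' ''FA'' i * rarr s' ''FB'' i" and fr: "frame ?mul s' s1"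
    show "runs w inverse_com s1 ti ?post"
    proof (rule inv)
      show "hash_state W P d s1" "is_lagrange W (rarr s1 ''Z'')"
        using hs by (simp_all add: hash_state_def frameD[OF fr])
      fix i assume i: "i < ?Q"
      have "rarr s1 ''FA'' i = tensor W d ?K (\<lambda>k. av (fst k) * bv (snd k))
        (\<lambda>u k e. part_eval P ?x d u (fst k) e * part_eval P ?y d u (snd k) e) i"
        using 1 F i by (simp add: tensor_mult)
      also have "\<dots> = tensor W d ?K (pair_val av bv) (part_interp P ?x ?y 0) i"
        unfolding pair_val_def
        by (rule tensor_cong[OF pf(4)]) (simp add: part_eval_def part_interp_def power_add)
      finally show "rarr s1 ''FA'' i = tensor W d ?K (pair_val av bv) (part_interp P ?x ?y 0) i" .
    qed
  qed simp
  have fwd: "runs w (forward_com ;; ?mul ;; inverse_com) s' (tf + (3 * ?Q + 2 + ti)) ?post"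
    if hs: "hash_state W P d s'" "is_lagrange W (rarr s' ''Z'')" "is_vandermonde W (rarr s' ''MV'')"
      and FA: "\<forall>i<?Q. rarr s' ''FA'' i = (\<Sum>j<na. if mkey W P d (ai j div q) = i then av j else 0)"
      and FB: "\<forall>i<?Q. rarr s' ''FB'' i = (\<Sum>j<nb. if mkey W P d (bi j div q) = i then bv j else 0)" for s'
  proof (rule runs_Seq)
    show "runs w forward_com s' tf (\<lambda>s1. \<forall>i<?Q. rarr s1 ''FA'' i = tensor W d {..<na} av (part_eval P ?x d) i \<and>
        rarr s1 ''FB'' i = tensor W d {..<nb} bv (part_eval P ?y d) i)"
      unfolding tf_def
    proof (rule runs_forward[OF pa hs(1,3)])
      fix i assume i: "i < ?Q"
      show "rarr s' ''FA'' i = tensor W d {..<na} av (part_eval P ?x 0) i"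
        using FA i tensor_mkey[OF pf(1,2) i, of "{..<na}" av ?x] by (simp add: part_eval_def[abs_def])
      show "rarr s' ''FB'' i = tensor W d {..<nb} bv (part_eval P ?y 0) i"
        using FB i tensor_mkey[OF pf(1,2) i, of "{..<nb}" bv ?y] by (simp add: part_eval_def[abs_def])
    qed
    fix s1 assume 1: "\<forall>i<?Q. rarr s1 ''FA'' i = tensor W d {..<na} av (part_eval P ?x d) i \<and>
        rarr s1 ''FB'' i = tensor W d {..<nb} bv (part_eval P ?y d) i" and fr: "frame forward_com s' s1"
    show "runs w (?mul ;; inverse_com) s1 (3 * ?Q + 2 + ti) ?post"
      by (rule mul[OF _ _ 1]) (use hs in \<open>simp_all add: hash_state_def frameD[OF fr]\<close>)
  qed simp
  let ?good = "\<lambda>s'. hash_state W P d s' \<and> input_state na ai av nb bi bv s' \<and> wreg s' ''pw'' = q \<and>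
      is_lagrange W (rarr s' ''Z'') \<and> is_vandermonde W (rarr s' ''MV'')"
  have good: "?good s" using h inp q mats by simp
  show "runs w (clear_com ''FA'' ;; clear_com ''FB'' ;;
     fold_com ''A'' ''lenA'' ''FA'' ;; fold_com ''B'' ''lenB'' ''FB'' ;; forward_com ;; ?mul ;; inverse_com) s
     (conv_time (na + nb) W d) ?post"
  proof (rule runs_Seq[where v = "3 * ?Q + 2 + ((na * (4 * d + 8) + 2) + ((nb * (4 * d + 8) + 2) + (tf + (3 * ?Q + 2 + ti))))"])
    show "runs w (clear_com ''FA'') s (3 * ?Q + 2) (\<lambda>s'. \<forall>i<?Q. rarr s' ''FA'' i = 0)"
      by (rule runs_clear) (use h pf in \<open>simp_all add: hash_state_def\<close>)
    fix s1 assume 1: "\<forall>i<?Q. rarr s1 ''FA'' i = 0" and fr1: "frame (clear_com ''FA'') s s1"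
    have good1: "?good s1" using good by (simp add: hash_state_def input_state_def frameD[OF fr1])
    show "runs w (clear_com ''FB'' ;; fold_com ''A'' ''lenA'' ''FA'' ;; fold_com ''B'' ''lenB'' ''FB'' ;;
        forward_com ;; ?mul ;; inverse_com) s1
        (3 * ?Q + 2 + ((na * (4 * d + 8) + 2) + ((nb * (4 * d + 8) + 2) + (tf + (3 * ?Q + 2 + ti))))) ?post"
    proof (rule runs_Seq)
      show "runs w (clear_com ''FB'') s1 (3 * ?Q + 2) (\<lambda>s'. \<forall>i<?Q. rarr s' ''FB'' i = 0)"
        by (rule runs_clear) (use good1 pf in \<open>simp_all add: hash_state_def\<close>)
      fix s2 assume 2: "\<forall>i<?Q. rarr s2 ''FB'' i = 0" and fr2: "frame (clear_com ''FB'') s1 s2"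
      have good2: "?good s2" using good1 by (simp add: hash_state_def input_state_def frameD[OF fr2])
      have z2: "\<forall>i<?Q. rarr s2 ''FA'' i = 0" using 1 by (simp add: frameD[OF fr2])
      show "runs w (fold_com ''A'' ''lenA'' ''FA'' ;; fold_com ''B'' ''lenB'' ''FB'' ;;
        forward_com ;; ?mul ;; inverse_com) s2
        ((na * (4 * d + 8) + 2) + ((nb * (4 * d + 8) + 2) + (tf + (3 * ?Q + 2 + ti)))) ?post"
      proof (rule runs_Seq)
        show "runs w (fold_com ''A'' ''lenA'' ''FA'') s2 (na * (4 * d + 8) + 2)
          (\<lambda>s'. \<forall>i<?Q. rarr s' ''FA'' i = (\<Sum>j<na. if mkey W P d (ai j div q) = i then av j else 0))"
          using good2 z2 by (intro runs_fold[OF _ _ _ _ _ _ _ _ _ _ n(1) pf(1,2,3,5,7)])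
            (auto simp: hash_state_def input_state_def)
        fix s3 assume 3: "\<forall>i<?Q. rarr s3 ''FA'' i = (\<Sum>j<na. if mkey W P d (ai j div q) = i then av j else 0)"
          and fr3: "frame (fold_com ''A'' ''lenA'' ''FA'') s2 s3"
        have good3: "?good s3" using good2 by (simp add: hash_state_def input_state_def frameD[OF fr3])
        have z3: "\<forall>i<?Q. rarr s3 ''FB'' i = 0" using 2 by (simp add: frameD[OF fr3])
        show "runs w (fold_com ''B'' ''lenB'' ''FB'' ;; forward_com ;; ?mul ;; inverse_com) s3
          ((nb * (4 * d + 8) + 2) + (tf + (3 * ?Q + 2 + ti))) ?post"
        proof (rule runs_Seq)
          show "runs w (fold_com ''B'' ''lenB'' ''FB'') s3 (nb * (4 * d + 8) + 2)
            (\<lambda>s'. \<forall>i<?Q. rarr s' ''FB'' i = (\<Sum>j<nb. if mkey W P d (bi j div q) = i then bv j else 0))"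
            using good3 z3 by (intro runs_fold[OF _ _ _ _ _ _ _ _ _ _ n(2) pf(1,2,3,5,7)])
              (auto simp: hash_state_def input_state_def)
          fix s4 assume 4: "\<forall>i<?Q. rarr s4 ''FB'' i = (\<Sum>j<nb. if mkey W P d (bi j div q) = i then bv j else 0)"
            and fr4: "frame (fold_com ''B'' ''lenB'' ''FB'') s3 s4"
          show "runs w (forward_com ;; ?mul ;; inverse_com) s4 (tf + (3 * ?Q + 2 + ti)) ?post"
            by (rule fwd[OF _ _ _ _ 4]) (use good3 3 in \<open>simp_all add: hash_state_def frameD[OF fr4]\<close>)
        qed simp
      qed simp
    qed simp
  qed (simp add: conv_time_def tf_def ti_def algebra_simps)
qed

subsection \<open>Greedy choice of the moduli\<close>

lemma word_size_pos: "1 < (2::nat) ^ w \<Longrightarrow> 0 < w"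
  by (cases w) auto

definition cand_key :: wexp where
  "cand_key = WAdd (WArr ''K'' (WReg ''t'')) (WMul (WMod (WArr ''Un'' (WReg ''t'')) (WReg ''p'')) (WReg ''st''))"

text \<open>The second loop clears just the counters that were touched, so that a trial modulus
  costs time linear in the number of candidates and not in the size of the tensor.\<close>

definition count_com :: com where
  "count_com = WAssign ''c'' (WConst 0) ;;
     for_com ''t'' ''nU'' (
       WAssign ''k'' cand_key ;;
       WAssign ''c'' (WAdd (WReg ''c'') (WArr ''cnt'' (WReg ''k''))) ;;
       WStore ''cnt'' (WReg ''k'') (WAdd (WArr ''cnt'' (WReg ''k'')) (WConst 1))) ;;
     for_com ''t'' ''nU'' (WAssign ''k'' cand_key ;; WStore ''cnt'' (WReg ''k'') (WConst 0))"

lemma wr_count [simp]: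
  "wr_wreg count_com = {''c'', ''t'', ''k''}" "wr_warr count_com = {''cnt''}"
  "wr_rreg count_com = {}" "wr_rarr count_com = {}"
  by (auto simp: count_com_def)

lemma card_less_Suc_eq:
  "card {t. t < Suc k \<and> Q t} = card {t. t < k \<and> Q t} + (if Q k then 1 else 0)"
proof -
  have "{t. t < Suc k \<and> Q t} = {t. t < k \<and> Q t} \<union> (if Q k then {k} else {})"
    by (auto simp: less_Suc_eq)
  then show ?thesis by simp
qed

lemma card_less_le: "card {t. t < (k::nat) \<and> Q t} \<le> k"
  using card_mono[of "{..<k}" "{t. t < k \<and> Q t}"] by auto

lemma runs_count:
  assumes s: "wreg s ''nU'' = n" "wreg s ''p'' = p" "wreg s ''st'' = st" "warr s ''K'' = K" "warr s ''Un'' = xs"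
      "warr s ''cnt'' = (\<lambda>_. 0)"
    and g: "\<And>t. t < n \<Longrightarrow> g t = K t + (xs t mod p) * st" and gw: "\<And>t. t < n \<Longrightarrow> g t < 2 ^ w"
    and n: "4 * (n * n) < 2 ^ w"
  shows "runs w count_com s (9 * n + 5)
    (\<lambda>s'. wreg s' ''c'' = collisions n g (\<lambda>x. x) \<and> warr s' ''cnt'' = (\<lambda>_. 0))"
  unfolding count_com_def
proof (rule runs_block_Seq)
  have nn: "n < 2 ^ w" using le_square[of n] n by linarith
  have key: "wval w cand_key s' = g t"
    if "t < n" "wreg s' ''t'' = t" "warr s' ''K'' = K" "warr s' ''Un'' = xs" "wreg s' ''p'' = p" "wreg s' ''st'' = st"
    for s' t
  proof -
    have "K t + (xs t mod p) * st < 2 ^ w" using g[OF that(1)] gw[OF that(1)] by simp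
    then show ?thesis using that g[OF that(1)] by (simp add: cand_key_def)
  qed
  let ?s = "final w (WAssign ''c'' (WConst 0)) s"
  let ?b1 = "WAssign ''k'' cand_key ;;
       WAssign ''c'' (WAdd (WReg ''c'') (WArr ''cnt'' (WReg ''k''))) ;;
       WStore ''cnt'' (WReg ''k'') (WAdd (WArr ''cnt'' (WReg ''k'')) (WConst 1))"
  let ?b2 = "WAssign ''k'' cand_key ;; WStore ''cnt'' (WReg ''k'') (WConst 0)"
  let ?l1 = "for_com ''t'' ''nU'' ?b1" and ?l2 = "for_com ''t'' ''nU'' ?b2"
  let ?c = "\<lambda>k j. card {t. t < k \<and> g t = j}"
  show "runs w (?l1 ;; ?l2) ?s (9 * n + 4) (\<lambda>s'. wreg s' ''c'' = collisions n g (\<lambda>x. x) \<and> warr s' ''cnt'' = (\<lambda>_. 0))"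
  proof (rule runs_Seq[where u = "5 * n + 2" and v = "4 * n + 2"])
    show "runs w ?l1 ?s (5 * n + 2) (\<lambda>s'. wreg s' ''c'' = collisions n g (\<lambda>x. x) \<and> warr s' ''cnt'' = ?c n)"
    proof (rule runs_for[where N = n and tb = 3 and
        I = "\<lambda>k s'. wreg s' ''c'' = collisions k g (\<lambda>x. x) \<and> warr s' ''cnt'' = ?c k"])
      fix k s'
      assume I: "wreg s' ''c'' = collisions k g (\<lambda>x. x) \<and> warr s' ''cnt'' = ?c k" and k: "k < n" "wreg s' ''t'' = k"
        and fr: "frame ?l1 ?s s'"
      have e: "wval w cand_key s' = g k" using s k by (intro key) (simp_all add: frameD[OF fr])
      have "collisions (Suc k) g (\<lambda>x. x) \<le> Suc k * Suc k" by (rule collisions_le)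
      also have "\<dots> \<le> n * n" using k by (intro mult_le_mono) auto
      finally have b1: "collisions k g (\<lambda>x. x) + ?c k (g k) < 2 ^ w"
        using n by (simp add: collisions_Suc)
      have "?c k (g k) + 1 \<le> n" using card_less_le[of k "\<lambda>t. g t = g k"] k by linarith
      then have b2: "?c k (g k) + 1 < 2 ^ w" using nn by linarith
      have "1 < (2::nat) ^ w" using b2 by linarith
      then have "0 < w" by (rule word_size_pos)
      then show "runs w ?b1 s' 3 (\<lambda>s'. wreg s' ''c'' = collisions (Suc k) g (\<lambda>x. x) \<and> warr s' ''cnt'' = ?c (Suc k))"
        using I k e b1 b2 by (intro runs_final) (auto simp: collisions_Suc card_less_Suc_eq fun_eq_iff)
    qed (use s nn in auto)
    fix s1 assume 1: "wreg s1 ''c'' = collisions n g (\<lambda>x. x) \<and> warr s1 ''cnt'' = ?c n" and fr1: "frame ?l1 ?s s1"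
    have v1: "wreg s1 ''nU'' = n" "warr s1 ''K'' = K" "warr s1 ''Un'' = xs" "wreg s1 ''p'' = p" "wreg s1 ''st'' = st"
      using s by (simp_all add: frameD[OF fr1])
    show "runs w ?l2 s1 (4 * n + 2) (\<lambda>s'. wreg s' ''c'' = collisions n g (\<lambda>x. x) \<and> warr s' ''cnt'' = (\<lambda>_. 0))"
    \<comment> \<open>A counter is zero once one of its elements has been visited; counters without
      elements are zero throughout.\<close>
    proof (rule runs_for[where N = n and tb = 2 and
        I = "\<lambda>k s'. wreg s' ''c'' = collisions n g (\<lambda>x. x) \<and> warr s' ''cnt'' = (\<lambda>j. if \<exists>t<k. g t = j then 0 else ?c n j)"])
      fix k s'
      assume I: "wreg s' ''c'' = collisions n g (\<lambda>x. x) \<and> warr s' ''cnt'' = (\<lambda>j. if \<exists>t<k. g t = j then 0 else ?c n j)"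
        and k: "k < n" "wreg s' ''t'' = k" and fr: "frame ?l2 s1 s'"
      have e: "wval w cand_key s' = g k" using v1 k by (intro key) (simp_all add: frameD[OF fr])
      show "runs w ?b2 s' 2 (\<lambda>s'. wreg s' ''c'' = collisions n g (\<lambda>x. x) \<and>
          warr s' ''cnt'' = (\<lambda>j. if \<exists>t<Suc k. g t = j then 0 else ?c n j))"
        using I e by (intro runs_final) (auto simp: fun_eq_iff less_Suc_eq)
    next
      fix s' assume "wreg s' ''c'' = collisions n g (\<lambda>x. x) \<and> warr s' ''cnt'' = (\<lambda>j. if \<exists>t<n. g t = j then 0 else ?c n j)"
      moreover have "(\<lambda>j. if \<exists>t<n. g t = j then 0 else ?c n j) = (\<lambda>_. 0)" by (auto simp: fun_eq_iff)
      ultimately show "wreg s' ''c'' = collisions n g (\<lambda>x. x) \<and> warr s' ''cnt'' = (\<lambda>_. 0)" by simp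
    qed (use v1 1 nn in auto)
  qed simp_all
qed simp_all

text \<open>All numbers from \<open>1\<close> to \<open>U\<close> are tried. The best of them is at
  least as good as the best prime, for which the averaging argument vouches, so primality is never
  tested.\<close>

definition best_com :: com where
  "best_com = (WAssign ''be'' (WMul (WReg ''nU'') (WReg ''nU'')) ;; WAssign ''bp'' (WConst 1)) ;;
     for_com ''q'' ''U'' (
       WAssign ''p'' (WAdd (WReg ''q'') (WConst 1)) ;;
       count_com ;;
       Cond (WLess (WReg ''c'') (WReg ''be''))
         (WAssign ''be'' (WReg ''c'') ;; WAssign ''bp'' (WReg ''p'')) Skip)"

lemma wr_best [simp]:
  "wr_wreg best_com = {''be'', ''bp'', ''q'', ''p'', ''c'', ''t'', ''k''}" "wr_warr best_com = {''cnt''}"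
  "wr_rreg best_com = {}" "wr_rarr best_com = {}"
  by (auto simp: best_com_def)

lemma runs_best:
  assumes s: "wreg s ''nU'' = n" "wreg s ''U'' = U" "wreg s ''st'' = st" "warr s ''K'' = K" "warr s ''Un'' = xs"
      "warr s ''cnt'' = (\<lambda>_. 0)"
    and gw: "\<And>t p. t < n \<Longrightarrow> 0 < p \<Longrightarrow> p \<le> U \<Longrightarrow> K t + (xs t mod p) * st < 2 ^ w"
    and n: "4 * (n * n) < 2 ^ w" and U: "0 < U" "U < 2 ^ w"
  shows "runs w best_com s (U * (9 * n + 12) + 4)
    (\<lambda>s'. warr s' ''cnt'' = (\<lambda>_. 0) \<and> 0 < wreg s' ''bp'' \<and> wreg s' ''bp'' \<le> U \<and>
      (\<forall>p. 0 < p \<and> p \<le> U \<longrightarrow> wreg s' ''be'' \<le> collisions n (\<lambda>t. K t + (xs t mod p) * st) (\<lambda>x. x)) \<and>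
      collisions n (\<lambda>t. K t + (xs t mod wreg s' ''bp'') * st) (\<lambda>x. x) \<le> wreg s' ''be'')"
  unfolding best_com_def
proof (rule runs_block_Seq)
  let ?pre = "WAssign ''be'' (WMul (WReg ''nU'') (WReg ''nU'')) ;; WAssign ''bp'' (WConst 1)"
  let ?if = "Cond (WLess (WReg ''c'') (WReg ''be''))
         (WAssign ''be'' (WReg ''c'') ;; WAssign ''bp'' (WReg ''p'')) Skip"
  let ?p = "WAssign ''p'' (WAdd (WReg ''q'') (WConst 1))"
  let ?b = "?p ;; count_com ;; ?if"
  let ?col = "\<lambda>p. collisions n (\<lambda>t. K t + (xs t mod p) * st) (\<lambda>x. x)"
  let ?I = "\<lambda>k s'. warr s' ''cnt'' = (\<lambda>_. 0) \<and> 0 < wreg s' ''bp'' \<and> wreg s' ''bp'' \<le> U \<and>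
      (\<forall>p. 0 < p \<and> p \<le> k \<longrightarrow> wreg s' ''be'' \<le> ?col p) \<and> ?col (wreg s' ''bp'') \<le> wreg s' ''be''"
  show "runs w (for_com ''q'' ''U'' ?b) (final w ?pre s) (U * (9 * n + 12) + 2) (?I U)"
  proof (rule runs_for[where N = U and tb = "9 * n + 10" and I = ?I])
    fix k s'
    assume I: "?I k s'" and k: "k < U" "wreg s' ''q'' = k" and fr: "frame (for_com ''q'' ''U'' ?b) (final w ?pre s) s'"
    have v: "wreg s' ''nU'' = n" "wreg s' ''st'' = st" "warr s' ''K'' = K" "warr s' ''Un'' = xs"
      using s by (simp_all add: frameD[OF fr])
    have k1: "k + 1 < 2 ^ w" using k U by linarith
    then have w1: "(1::nat) mod 2 ^ w = 1" by (intro mod_less) linarith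
    show "runs w ?b s' (9 * n + 10) (?I (Suc k))"
    proof (rule runs_block_Seq[where v = "9 * n + 9"])
      show "runs w (count_com ;; ?if) (final w ?p s') (9 * n + 9) (?I (Suc k))"
      proof (rule runs_Seq_block)
        show "runs w count_com (final w ?p s') (9 * n + 5)
          (\<lambda>s'. wreg s' ''c'' = ?col (Suc k) \<and> warr s' ''cnt'' = (\<lambda>_. 0))"
          using v I k k1 w1 gw[of _ "Suc k"] n by (intro runs_count[where p = "Suc k"]) auto
        fix s1 assume 1: "wreg s1 ''c'' = ?col (Suc k) \<and> warr s1 ''cnt'' = (\<lambda>_. 0)"
          and fr1: "frame count_com (final w ?p s') s1"
        have v1: "wreg s1 ''p'' = Suc k" "wreg s1 ''be'' = wreg s' ''be''" "wreg s1 ''bp'' = wreg s' ''bp''"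
          using k k1 w1 by (simp_all add: frameD[OF fr1])
        show "?I (Suc k) (final w ?if s1)"
          using I 1 v1 k by (auto simp: le_Suc_eq)
      qed simp_all
    qed simp_all
  next
    have "1 < (2::nat) ^ w" using U by linarith
    then have "0 < w" by (rule word_size_pos)
    then have "n * n mod 2 ^ w = n * n" "(1::nat) mod 2 ^ w = 1" using n by auto
    \<comment> \<open>The initial best, modulus \<open>1\<close> with \<open>n * n\<close> as its
      bound, is legitimate because \<open>collisions_le\<close> holds for every key.\<close>
    then show "?I 0 (final w ?pre s)" using s U collisions_le by auto
  qed (use s U in auto)
qed simp_all

text \<open>The cached keys in \<open>K\<close> gain one digit each, so that no key is recomputed
  from scratch during the search.\<close>

definition update_com :: com where
  "update_com = WStore ''P'' (WReg ''d'') (WReg ''bp'') ;;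
     for_com ''t'' ''nU'' (WStore ''K'' (WReg ''t'')
       (WAdd (WArr ''K'' (WReg ''t'')) (WMul (WMod (WArr ''Un'' (WReg ''t'')) (WReg ''bp'')) (WReg ''st'')))) ;;
     WAssign ''d'' (WAdd (WReg ''d'') (WConst 1)) ;;
     WAssign ''st'' (WMul (WReg ''st'') (WReg ''W'')) ;;
     WAssign ''pa'' (WReg ''be'')"

lemma wr_update [simp]:
  "wr_wreg update_com = {''t'', ''d'', ''st'', ''pa''}" "wr_warr update_com = {''P'', ''K''}"
  "wr_rreg update_com = {}" "wr_rarr update_com = {}"
  by (auto simp: update_com_def)

lemma runs_update:
  assumes s: "wreg s ''nU'' = n" "wreg s ''W'' = W" "wreg s ''st'' = st" "wreg s ''bp'' = p" "wreg s ''d'' = d"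
      "wreg s ''be'' = c" "warr s ''K'' = K" "warr s ''Un'' = xs" "warr s ''P'' = P"
    and gw: "\<And>t. t < n \<Longrightarrow> K t + (xs t mod p) * st < 2 ^ w"
    and n: "n < 2 ^ w" and d: "Suc d < 2 ^ w" and st: "st * W < 2 ^ w"
  shows "runs w update_com s (3 * n + 6)
    (\<lambda>s'. wreg s' ''d'' = Suc d \<and> wreg s' ''st'' = st * W \<and> wreg s' ''pa'' = c \<and> warr s' ''P'' = P(d := p) \<and>
       (\<forall>t<n. warr s' ''K'' t = K t + (xs t mod p) * st))"
  unfolding update_com_def
proof (rule runs_block_Seq)
  let ?P = "WStore ''P'' (WReg ''d'') (WReg ''bp'')"
  let ?l = "for_com ''t'' ''nU'' (WStore ''K'' (WReg ''t'')
       (WAdd (WArr ''K'' (WReg ''t'')) (WMul (WMod (WArr ''Un'' (WReg ''t'')) (WReg ''bp'')) (WReg ''st''))))"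
  let ?e = "WAssign ''d'' (WAdd (WReg ''d'') (WConst 1)) ;;
     WAssign ''st'' (WMul (WReg ''st'') (WReg ''W'')) ;; WAssign ''pa'' (WReg ''be'')"
  have w1: "(1::nat) mod 2 ^ w = 1" using d by (intro mod_less) linarith
  show "runs w (?l ;; ?e) (final w ?P s) (3 * n + 5)
    (\<lambda>s'. wreg s' ''d'' = Suc d \<and> wreg s' ''st'' = st * W \<and> wreg s' ''pa'' = c \<and> warr s' ''P'' = P(d := p) \<and>
       (\<forall>t<n. warr s' ''K'' t = K t + (xs t mod p) * st))"
  proof (rule runs_Seq_block)
    show "runs w ?l (final w ?P s) (3 * n + 2) (\<lambda>s'. \<forall>t<n. warr s' ''K'' t = K t + (xs t mod p) * st)"
    proof (rule runs_for[where N = n and tb = 1 and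
        I = "\<lambda>k s'. \<forall>t. warr s' ''K'' t = (if t < k then K t + (xs t mod p) * st else K t)"])
      fix k s'
      assume I: "\<forall>t. warr s' ''K'' t = (if t < k then K t + (xs t mod p) * st else K t)"
        and k: "k < n" "wreg s' ''t'' = k" and fr: "frame ?l (final w ?P s) s'"
      have v: "wreg s' ''st'' = st" "wreg s' ''bp'' = p" "warr s' ''Un'' = xs"
        using s by (simp_all add: frameD[OF fr])
      have b: "K k + (xs k mod p) * st < 2 ^ w" using gw[OF k(1)] .
      then have b': "(xs k mod p) * st < 2 ^ w" by linarith
      show "runs w (WStore ''K'' (WReg ''t'') (WAdd (WArr ''K'' (WReg ''t''))
        (WMul (WMod (WArr ''Un'' (WReg ''t'')) (WReg ''bp'')) (WReg ''st'')))) s' 1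
        (\<lambda>s'. \<forall>t. warr s' ''K'' t = (if t < Suc k then K t + (xs t mod p) * st else K t))"
        using I k v b b' by (intro runs_final) auto
    qed (use s n in auto)
    fix s1 assume 1: "\<forall>t<n. warr s1 ''K'' t = K t + (xs t mod p) * st" and fr1: "frame ?l (final w ?P s) s1"
    have v1: "wreg s1 ''d'' = d" "wreg s1 ''st'' = st" "wreg s1 ''W'' = W" "wreg s1 ''be'' = c" "warr s1 ''P'' = P(d := p)"
      using s by (simp_all add: frameD[OF fr1])
    show "wreg (final w ?e s1) ''d'' = Suc d \<and> wreg (final w ?e s1) ''st'' = st * W \<and>
      wreg (final w ?e s1) ''pa'' = c \<and> warr (final w ?e s1) ''P'' = P(d := p) \<and>
       (\<forall>t<n. warr (final w ?e s1) ''K'' t = K t + (xs t mod p) * st)"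
      using v1 1 st d w1 by simp
  qed simp_all
qed simp_all

text \<open>\<open>pa\<close> bounds the number of colliding pairs. Once \<open>4 * pa\<close> is at
  most the number of candidates, \<open>card_not_isolated\<close> leaves at most half of them in
  shared buckets.\<close>

definition select_com :: com where
  "select_com = (WAssign ''d'' (WConst 0) ;; WAssign ''st'' (WConst 1) ;;
       WAssign ''pa'' (WMul (WReg ''nU'') (WReg ''nU''))) ;;
     for_com ''t'' ''nU'' (WStore ''K'' (WReg ''t'') (WConst 0)) ;;
     While (WLess (WReg ''nU'') (WMul (WConst 4) (WReg ''pa''))) (best_com ;; update_com)"

lemma wr_select [simp]:
  "wr_wreg select_com = {''d'', ''st'', ''pa'', ''be'', ''bp'', ''q'', ''p'', ''c'', ''t'', ''k''}"
  "wr_warr select_com = {''cnt'', ''P'', ''K''}"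
  "wr_rreg select_com = {}" "wr_rarr select_com = {}"
  by (auto simp: select_com_def)

definition select_time :: "nat \<Rightarrow> nat \<Rightarrow> nat \<Rightarrow> nat" where
  "select_time n U D = D * (U * (9 * n + 12) + 3 * n + 11) + 3 * n + 6"

text \<open>The moduli are chosen greedily. Every step divides the number of colliding pairs by at least
  \<open>R\<close>, so the loop cannot be entered with \<open>4 * n \<le> R ^ k\<close>.\<close>

lemma runs_select:
  assumes s: "wreg s ''nU'' = n" "wreg s ''U'' = U" "wreg s ''W'' = W" "warr s ''Un'' = xs"
      "warr s ''cnt'' = (\<lambda>_. 0)"
    and inj: "inj_on xs {..<n}" and L: "\<And>t. t < n \<Longrightarrow> xs t < 2 ^ L"
    and R: "R * L \<le> card {p::nat. prime p \<and> p \<le> U}" "R * L > 0"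
    and W: "W = 2 * U" "0 < U" "W < 2 ^ w" and n: "4 * (n * n) < 2 ^ w" "0 < n"
    and Q: "\<And>k. R ^ k < 4 * n \<Longrightarrow> W ^ Suc k \<le> Q" "Q < 2 ^ w"
    and D: "\<And>k. R ^ k < 4 * n \<Longrightarrow> k < D"
  shows "runs w select_com s (select_time n U D)
    (\<lambda>s'. \<exists>d P. hash_state W P d s' \<and> moduli U P d \<and> d \<le> D \<and> W ^ d \<le> Q \<and>
       (\<forall>t<n. warr s' ''K'' t = mkey W P d (xs t)) \<and> 4 * collisions n xs (mkey W P d) \<le> n \<and>
       warr s' ''cnt'' = (\<lambda>_. 0))"
  unfolding select_com_def
proof (rule runs_block_Seq)
  have Q1: "1 \<le> Q" using Q(1)[of 0] n W by simp
  have nn: "n < 2 ^ w" using le_square[of n] n by linarith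
  have n2: "n * n < 2 ^ w" using n by linarith
  have "1 \<le> n * n" using n by simp
  then have w4: "4 < (2::nat) ^ w" using n by linarith
  then have w1: "(1::nat) mod 2 ^ w = 1" "(0::nat) mod 2 ^ w = 0" "(4::nat) mod 2 ^ w = 4"
    using w4 by (auto intro!: mod_less word_size_pos)
  let ?pre = "WAssign ''d'' (WConst 0) ;; WAssign ''st'' (WConst 1) ;;
       WAssign ''pa'' (WMul (WReg ''nU'') (WReg ''nU''))"
  let ?z = "for_com ''t'' ''nU'' (WStore ''K'' (WReg ''t'') (WConst 0))"
  let ?post = "\<lambda>s'. \<exists>d P. hash_state W P d s' \<and> moduli U P d \<and> d \<le> D \<and> W ^ d \<le> Q \<and>
       (\<forall>t<n. warr s' ''K'' t = mkey W P d (xs t)) \<and> 4 * collisions n xs (mkey W P d) \<le> n \<and>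
       warr s' ''cnt'' = (\<lambda>_. 0)"
  let ?I = "\<lambda>k s'. \<exists>P. hash_state W P k s' \<and> moduli U P k \<and> k \<le> D \<and> W ^ k \<le> Q \<and>
       (\<forall>t<n. warr s' ''K'' t = mkey W P k (xs t)) \<and> collisions n xs (mkey W P k) \<le> wreg s' ''pa'' \<and>
       wreg s' ''pa'' * R ^ k \<le> n * n \<and> warr s' ''cnt'' = (\<lambda>_. 0)"
  let ?tb = "U * (9 * n + 12) + 4 + (3 * n + 6)"
  show "runs w (?z ;; While (WLess (WReg ''nU'') (WMul (WConst 4) (WReg ''pa''))) (best_com ;; update_com))
    (final w ?pre s) (3 * n + 2 + (D * (?tb + 1) + 1)) ?post"
  proof (rule runs_Seq)
    show "runs w ?z (final w ?pre s) (3 * n + 2) (\<lambda>s'. \<forall>t<n. warr s' ''K'' t = 0)"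
      by (rule runs_for[where N = n and tb = 1 and I = "\<lambda>k s'. \<forall>t<k. warr s' ''K'' t = 0"])
         (use s nn in \<open>auto intro!: runs_final simp: less_Suc_eq\<close>)
    fix s1 assume 1: "\<forall>t<n. warr s1 ''K'' t = 0" and fr1: "frame ?z (final w ?pre s) s1"
    have v1: "wreg s1 ''nU'' = n" "wreg s1 ''U'' = U" "wreg s1 ''W'' = W" "warr s1 ''Un'' = xs"
      "warr s1 ''cnt'' = (\<lambda>_. 0)" "wreg s1 ''d'' = 0" "wreg s1 ''st'' = 1" "wreg s1 ''pa'' = n * n"
      using s n2 w1 by (simp_all add: frameD[OF fr1])
    have pa4: "4 * wreg s' ''pa'' < 2 ^ w \<and> R ^ k < 4 * n"
      if I: "?I k s'" and b: "bval w (WLess (WReg ''nU'') (WMul (WConst 4) (WReg ''pa''))) s'"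
        and nU: "wreg s' ''nU'' = n" for k s'
    proof -
      have "R > 0" using R(2) by simp
      then have "wreg s' ''pa'' \<le> wreg s' ''pa'' * R ^ k" by simp
      also have paR: "\<dots> \<le> n * n" using I by blast
      finally have "wreg s' ''pa'' \<le> n * n" .
      \<comment> \<open>The guard is computed modulo \<open>2 ^ w\<close>; it means
        \<open>n < 4 * pa\<close> only once overflow has been excluded.\<close>
      then have 4: "4 * wreg s' ''pa'' < 2 ^ w" using n by linarith
      then have "n < 4 * wreg s' ''pa''" using b nU w1 by simp
      then have "n * R ^ k < 4 * wreg s' ''pa'' * R ^ k" using \<open>R > 0\<close> by simp
      also have "\<dots> \<le> 4 * (n * n)" using paR by (simp add: mult.assoc)
      finally have "R ^ k < 4 * n" using n(2) by (simp add: mult.commute mult.left_commute)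
      with 4 show ?thesis by blast
    qed
    show "runs w (While (WLess (WReg ''nU'') (WMul (WConst 4) (WReg ''pa''))) (best_com ;; update_com)) s1 (D * (?tb + 1) + 1) ?post"
    proof (rule runs_While[where I = ?I and n = D and tb = ?tb])
      show "?I 0 s1" using v1 1 Q1 collisions_le[of n xs] by (auto simp: hash_state_def moduli_def)
    next
      fix k s' assume I: "?I k s'" and fr: "frame (best_com ;; update_com) s1 s'"
        and b: "bval w (WLess (WReg ''nU'') (WMul (WConst 4) (WReg ''pa''))) s'"
      have nU: "wreg s' ''nU'' = n" using v1 by (simp add: frameD[OF fr])
      show "k < D" using pa4[OF I b nU] D by blast
      from I obtain P where P: "hash_state W P k s'" "moduli U P k"
          and K: "\<forall>t<n. warr s' ''K'' t = mkey W P k (xs t)" and col: "collisions n xs (mkey W P k) \<le> wreg s' ''pa''"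
          and pa: "wreg s' ''pa'' * R ^ k \<le> n * n" and cnt: "warr s' ''cnt'' = (\<lambda>_. 0)" by blast
      have v: "wreg s' ''U'' = U" "wreg s' ''W'' = W" "warr s' ''Un'' = xs" "wreg s' ''st'' = W ^ k" "wreg s' ''d'' = k"
          "warr s' ''P'' = P"
        using v1 P(1) by (simp_all add: frameD[OF fr] hash_state_def)
      have Rk: "R ^ k < 4 * n" using pa4[OF I b nU] by blast
      have WQ: "W ^ Suc k \<le> Q" using Q(1)[OF Rk] .
      have key: "mkey W P k x + x mod p * W ^ k < W ^ Suc k" if "0 < p" "p \<le> U" for x p
      proof -
        have "mkey W (P(k := p)) (Suc k) x < W ^ Suc k"
          using P(2) that W by (intro mkey_less[where U = U]) (auto simp: moduli_def less_Suc_eq)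
        then show ?thesis using mkey_cong[of k P "P(k := p)"] by (simp add: mkey_Suc)
      qed
      have gw: "warr s' ''K'' t + xs t mod p * W ^ k < 2 ^ w" if "t < n" "0 < p" "p \<le> U" for t p
        using key[OF that(2,3), of "xs t"] K that WQ Q(2) by auto
      have colK: "collisions n (\<lambda>t. warr s' ''K'' t + (xs t mod p) * W ^ k) (\<lambda>x. x) =
          collisions n xs (\<lambda>x. mkey W P k x + x mod p * W ^ k)" for p
        using K by (intro collisions_cong) auto
      have "2 * U < 2 ^ w" using W by simp
      then have Uw: "U < 2 ^ w" by linarith
      show "runs w (best_com ;; update_com) s' ?tb (?I (Suc k))"
      proof (rule runs_Seq[OF runs_best[OF nU v(1,4) refl v(3) cnt gw n(1) W(2) Uw]])
        fix s2
        assume "warr s2 ''cnt'' = (\<lambda>_. 0) \<and> 0 < wreg s2 ''bp'' \<and> wreg s2 ''bp'' \<le> U \<and>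
          (\<forall>p. 0 < p \<and> p \<le> U \<longrightarrow> wreg s2 ''be'' \<le> collisions n (\<lambda>t. warr s' ''K'' t + (xs t mod p) * W ^ k) (\<lambda>x. x)) \<and>
          collisions n (\<lambda>t. warr s' ''K'' t + (xs t mod wreg s2 ''bp'') * W ^ k) (\<lambda>x. x) \<le> wreg s2 ''be''"
          and fr2: "frame best_com s' s2"
        then have cnt2: "warr s2 ''cnt'' = (\<lambda>_. 0)" and bp: "0 < wreg s2 ''bp''" "wreg s2 ''bp'' \<le> U"
          and be: "\<And>p. 0 < p \<Longrightarrow> p \<le> U \<Longrightarrow> wreg s2 ''be'' \<le> collisions n xs (\<lambda>x. mkey W P k x + x mod p * W ^ k)"
          and be': "collisions n xs (\<lambda>x. mkey W P k x + x mod wreg s2 ''bp'' * W ^ k) \<le> wreg s2 ''be''"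
          unfolding colK by auto
        define p where "p = wreg s2 ''bp''"
        have v2: "wreg s2 ''nU'' = n" "wreg s2 ''W'' = W" "wreg s2 ''st'' = W ^ k" "wreg s2 ''d'' = k"
          "warr s2 ''K'' = warr s' ''K''" "warr s2 ''Un'' = xs" "warr s2 ''P'' = P"
          using v nU by (simp_all add: frameD[OF fr2])
        have UW: "U \<le> W" using W by simp
        \<comment> \<open>\<open>p0\<close> exists only in the analysis; the modulus
          \<open>bp\<close> found by exhaustive search does at least as well.\<close>
        obtain p0 where p0: "0 < p0" "p0 \<le> U"
          "collisions n xs (\<lambda>x. mkey W P k x + x mod p0 * W ^ k) * R \<le> collisions n xs (mkey W P k)"
          using exists_good_modulus[OF P(2) UW inj L R] by blast
        have "wreg s2 ''be'' * R \<le> collisions n xs (\<lambda>x. mkey W P k x + x mod p0 * W ^ k) * R"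
          using be[OF p0(1,2)] by (rule mult_le_mono1)
        then have beR: "wreg s2 ''be'' * R \<le> wreg s' ''pa''" using p0(3) col by linarith
        have "wreg s2 ''be'' * R ^ Suc k = wreg s2 ''be'' * R * R ^ k" by simp
        also have "\<dots> \<le> wreg s' ''pa'' * R ^ k" using beR by (rule mult_le_mono1)
        finally have be2: "wreg s2 ''be'' * R ^ Suc k \<le> n * n" using pa by linarith
        have W2: "2 \<le> W" using W by simp
        have WQ': "W ^ Suc k < 2 ^ w" using WQ Q(2) by linarith
        have dk: "Suc k < 2 ^ w" using power_less_word_size(1)[OF W2 WQ'] .
        have stW: "W ^ k * W < 2 ^ w" using WQ' by (simp add: mult.commute)
        have key2: "mkey W (P(k := p)) (Suc k) x = mkey W P k x + x mod p * W ^ k" for x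
          using mkey_cong[of k P "P(k := p)"] by (simp add: mkey_Suc)
        have kD: "k < D" using D[OF Rk] .
        show "runs w update_com s2 (3 * n + 6) (?I (Suc k))"
        proof (rule runs_conseq[OF runs_update[OF v2(1,2,3) p_def[symmetric] v2(4) refl v2(5,6,7) _ nn dk stW]])
          fix t assume "t < n"
          then show "warr s' ''K'' t + xs t mod p * W ^ k < 2 ^ w" using gw bp by (simp add: p_def)
        next
          fix s3
          assume 3: "wreg s3 ''d'' = Suc k \<and> wreg s3 ''st'' = W ^ k * W \<and> wreg s3 ''pa'' = wreg s2 ''be'' \<and>
            warr s3 ''P'' = P(k := p) \<and> (\<forall>t<n. warr s3 ''K'' t = warr s' ''K'' t + xs t mod p * W ^ k)"
            and fr3: "frame update_com s2 s3"
          have v3: "warr s3 ''cnt'' = (\<lambda>_. 0)" "wreg s3 ''W'' = W" using cnt2 v2 by (simp_all add: frameD[OF fr3])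
          show "?I (Suc k) s3"
          proof (intro exI[of _ "P(k := p)"] conjI)
            show "hash_state W (P(k := p)) (Suc k) s3" using 3 v3 by (simp add: hash_state_def mult.commute)
            show "moduli U (P(k := p)) (Suc k)" using P(2) bp by (auto simp: moduli_def less_Suc_eq p_def)
            show "Suc k \<le> D" using kD by simp
            show "W ^ Suc k \<le> Q" by (rule WQ)
            show "\<forall>t<n. warr s3 ''K'' t = mkey W (P(k := p)) (Suc k) (xs t)" using 3 K by (simp add: key2)
            have "mkey W (P(k := p)) (Suc k) = (\<lambda>x. mkey W P k x + x mod p * W ^ k)" by (rule ext) (rule key2)
            then show "collisions n xs (mkey W (P(k := p)) (Suc k)) \<le> wreg s3 ''pa''"
              using be' 3 by (simp add: p_def)
            show "wreg s3 ''pa'' * R ^ Suc k \<le> n * n" using be2 3 by simp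
            show "warr s3 ''cnt'' = (\<lambda>_. 0)" by (rule v3)
          qed
        qed simp
      qed simp_all
    next
      fix k s' assume I: "?I k s'" and fr: "frame (best_com ;; update_com) s1 s'"
        and b: "\<not> bval w (WLess (WReg ''nU'') (WMul (WConst 4) (WReg ''pa''))) s'"
      have nU: "wreg s' ''nU'' = n" using v1 by (simp add: frameD[OF fr])
      from I obtain P where P: "hash_state W P k s'" "moduli U P k" "k \<le> D" "W ^ k \<le> Q"
          and K: "\<forall>t<n. warr s' ''K'' t = mkey W P k (xs t)" and col: "collisions n xs (mkey W P k) \<le> wreg s' ''pa''"
          and pa: "wreg s' ''pa'' * R ^ k \<le> n * n" and cnt: "warr s' ''cnt'' = (\<lambda>_. 0)" by blast
      have "R > 0" using R(2) by simp
      then have "wreg s' ''pa'' \<le> wreg s' ''pa'' * R ^ k" by simp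
      then have "wreg s' ''pa'' \<le> n * n" using pa by linarith
      then have "4 * wreg s' ''pa'' < 2 ^ w" using n by linarith
      then have "4 * wreg s' ''pa'' \<le> n" using b nU w1 by simp
      then have "4 * collisions n xs (mkey W P k) \<le> n" using col by linarith
      then show "?post s'" using P K cnt by blast
    qed simp
  qed simp
qed (simp_all add: select_time_def algebra_simps)

subsection \<open>Recovering the coefficients\<close>

definition arr_list :: "(nat \<Rightarrow> 'a) \<Rightarrow> nat \<Rightarrow> 'a list" where
  "arr_list f n = map f [0..<n]"

lemma length_arr_list [simp]: "length (arr_list f n) = n"
  and set_arr_list: "set (arr_list f n) = f ` {..<n}"
  and nth_arr_list [simp]: "t < n \<Longrightarrow> arr_list f n ! t = f t"
  and arr_list_0 [simp]: "arr_list f 0 = []"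
  by (simp_all add: arr_list_def atLeast0LessThan)

lemma arr_list_snoc: "arr_list (f(n := x)) (Suc n) = arr_list f n @ [x]"
  by (simp add: arr_list_def)

lemma distinct_arr_list: "distinct (arr_list f n) \<longleftrightarrow> inj_on f {..<n}"
  by (simp add: arr_list_def distinct_map atLeast0LessThan)

lemma sum_arr_list: "distinct (arr_list f n) \<Longrightarrow> (\<Sum>t<n. g (f t)) = (\<Sum>x\<in>set (arr_list f n). g x)"
  by (simp add: distinct_arr_list set_arr_list sum.reindex)

text \<open>Unresolved candidates have value \<open>0\<close> in \<open>V\<close>, so all candidates
  can be subtracted alike, and only the unresolved ones remain in the tensor.\<close>

definition sub_com :: com where
  "sub_com = for_com ''t'' ''nT'' (
     WAssign ''x'' (WArr ''T'' (WReg ''t'')) ;;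
     hash_com ;;
     RStore ''FA'' (WReg ''h'') (RSub (RArr ''FA'' (WReg ''h'')) (RArr ''V'' (WReg ''x''))))"

lemma wr_sub [simp]:
  "wr_wreg sub_com = {''t'', ''x'', ''h'', ''hs'', ''hu''}" "wr_warr sub_com = {}"
  "wr_rreg sub_com = {}" "wr_rarr sub_com = {''FA''}"
  by (auto simp: sub_com_def)

lemma runs_sub:
  assumes pa: "params w W U P d" and h: "hash_state W P d s"
    and s: "wreg s ''nT'' = n" "warr s ''T'' = T" "rarr s ''V'' = V" "rarr s ''FA'' = F" and n: "n < 2 ^ w"
  shows "runs w sub_com s (n * (4 * d + 8) + 2)
     (\<lambda>s'. \<forall>i. rarr s' ''FA'' i = F i - (\<Sum>t<n. if mkey W P d (T t) = i then V (T t) else 0))"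
  unfolding sub_com_def
proof (rule runs_for[where N = n and tb = "4 * d + 6" and
    I = "\<lambda>k s'. \<forall>i. rarr s' ''FA'' i = F i - (\<Sum>t<k. if mkey W P d (T t) = i then V (T t) else 0)"])
  note pf = params_facts[OF pa]
  fix k s'
  let ?x = "WAssign ''x'' (WArr ''T'' (WReg ''t''))"
  let ?F = "RStore ''FA'' (WReg ''h'') (RSub (RArr ''FA'' (WReg ''h'')) (RArr ''V'' (WReg ''x'')))"
  let ?c = "?x ;; hash_com ;; ?F"
  let ?I = "\<lambda>k s'. \<forall>i. rarr s' ''FA'' i = F i - (\<Sum>t<k. if mkey W P d (T t) = i then V (T t) else 0)"
  assume I: "?I k s'" and k: "k < n" "wreg s' ''t'' = k" and fr: "frame (for_com ''t'' ''nT'' ?c) s s'"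
  have v: "wreg s' ''d'' = d" "wreg s' ''W'' = W" "warr s' ''P'' = P" "warr s' ''T'' = T" "rarr s' ''V'' = V"
    using s h by (simp_all add: frameD[OF fr] hash_state_def)
  show "runs w ?c s' (4 * d + 6) (?I (Suc k))"
  proof (rule runs_block_Seq[where v = "4 * d + 5"])
    show "runs w (hash_com ;; ?F) (final w ?x s') (4 * d + 5) (?I (Suc k))"
    proof (rule runs_Seq_block)
      show "runs w hash_com (final w ?x s') (4 * d + 4) (\<lambda>s'. wreg s' ''h'' = mkey W P d (T k))"
        using v k by (intro runs_hash[OF _ _ _ _ pf(1,2,3,5,7)]) auto
      fix s1 assume 1: "wreg s1 ''h'' = mkey W P d (T k)" and fr1: "frame hash_com (final w ?x s') s1"
      have v1: "wreg s1 ''x'' = T k" "rarr s1 ''V'' = V" "rarr s1 ''FA'' = rarr s' ''FA''"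
        using v k by (simp_all add: frameD[OF fr1])
      show "?I (Suc k) (final w ?F s1)" using I 1 v1 by auto
    qed simp_all
  qed simp_all
qed (use s n in auto)

text \<open>A bucket with a single unresolved candidate contains the value of that candidate. The
  remaining candidates are compacted at the front of \<open>Un\<close>.\<close>

definition recover_com :: com where
  "recover_com =
     for_com ''t'' ''nU'' (WStore ''cnt'' (WArr ''K'' (WReg ''t'')) (WAdd (WArr ''cnt'' (WArr ''K'' (WReg ''t''))) (WConst 1))) ;;
     WAssign ''nV'' (WConst 0) ;;
     for_com ''t'' ''nU'' (
       WAssign ''x'' (WArr ''Un'' (WReg ''t'')) ;;
       Cond (WEq (WArr ''cnt'' (WArr ''K'' (WReg ''t''))) (WConst 1))
         (RStore ''V'' (WReg ''x'') (RArr ''FA'' (WArr ''K'' (WReg ''t''))))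
         (WStore ''Un'' (WReg ''nV'') (WReg ''x'') ;; WAssign ''nV'' (WAdd (WReg ''nV'') (WConst 1)))) ;;
     for_com ''t'' ''nU'' (WStore ''cnt'' (WArr ''K'' (WReg ''t'')) (WConst 0)) ;;
     WAssign ''nU'' (WReg ''nV'')"

lemma wr_recover [simp]:
  "wr_wreg recover_com = {''t'', ''nV'', ''x'', ''nU''}" "wr_warr recover_com = {''cnt'', ''Un''}"
  "wr_rreg recover_com = {}" "wr_rarr recover_com = {''V''}"
  by (auto simp: recover_com_def)

lemma length_filter_upt_le: "length (filter Q [0..<k]) \<le> k"
  using length_filter_le[of Q "[0..<k]"] by simp

lemma runs_recover:
  assumes s: "wreg s ''nU'' = n" "warr s ''Un'' = xs" "warr s ''cnt'' = (\<lambda>_. 0)" "rarr s ''V'' = V"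
    and K: "\<And>t. t < n \<Longrightarrow> warr s ''K'' t = key t" and n: "0 < n" "Suc n < 2 ^ w"
    and sole: "\<And>t. sole t \<longleftrightarrow> card {t'. t' < n \<and> key t' = key t} = 1"
    and F: "\<And>t. t < n \<Longrightarrow> sole t \<Longrightarrow> rarr s ''FA'' (key t) = cv (xs t)"
  shows "runs w recover_com s (13 * n + 8)
     (\<lambda>s'. arr_list (warr s' ''Un'') (wreg s' ''nU'') = map xs (filter (\<lambda>t. \<not> sole t) [0..<n]) \<and>
       rarr s' ''V'' = (\<lambda>x. if \<exists>t<n. sole t \<and> xs t = x then cv x else V x) \<and> warr s' ''cnt'' = (\<lambda>_. 0))"
  unfolding recover_com_def
proof (rule runs_Seq[where u = "3 * n + 2" and v = "10 * n + 6"])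
  have "1 < (2::nat) ^ w" using n by linarith
  then have "0 < w" by (rule word_size_pos)
  then have w1: "(1::nat) mod 2 ^ w = 1" by simp
  let ?l1 = "for_com ''t'' ''nU'' (WStore ''cnt'' (WArr ''K'' (WReg ''t'')) (WAdd (WArr ''cnt'' (WArr ''K'' (WReg ''t''))) (WConst 1)))"
  let ?if = "Cond (WEq (WArr ''cnt'' (WArr ''K'' (WReg ''t''))) (WConst 1))
         (RStore ''V'' (WReg ''x'') (RArr ''FA'' (WArr ''K'' (WReg ''t''))))
         (WStore ''Un'' (WReg ''nV'') (WReg ''x'') ;; WAssign ''nV'' (WAdd (WReg ''nV'') (WConst 1)))"
  let ?b2 = "WAssign ''x'' (WArr ''Un'' (WReg ''t'')) ;; ?if"
  let ?l2 = "for_com ''t'' ''nU'' ?b2"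
  let ?l3 = "for_com ''t'' ''nU'' (WStore ''cnt'' (WArr ''K'' (WReg ''t'')) (WConst 0))"
  let ?z = "WAssign ''nV'' (WConst 0)" and ?e = "WAssign ''nU'' (WReg ''nV'')"
  let ?c = "\<lambda>k j. card {t. t < k \<and> key t = j}"
  let ?V = "\<lambda>k x. if \<exists>t<k. sole t \<and> xs t = x then cv x else V x"
  let ?f = "\<lambda>k. filter (\<lambda>t. \<not> sole t) [0..<k]"
  let ?post = "\<lambda>s'. arr_list (warr s' ''Un'') (wreg s' ''nU'') = map xs (?f n) \<and>
       rarr s' ''V'' = ?V n \<and> warr s' ''cnt'' = (\<lambda>_. 0)"
  show "runs w ?l1 s (3 * n + 2) (\<lambda>s'. warr s' ''cnt'' = ?c n)"
  proof (rule runs_for[where N = n and tb = 1 and I = "\<lambda>k s'. warr s' ''cnt'' = ?c k"])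
    fix k s' assume I: "warr s' ''cnt'' = ?c k" and k: "k < n" "wreg s' ''t'' = k" and fr: "frame ?l1 s s'"
    have v: "warr s' ''K'' k = key k" using K[OF k(1)] by (simp add: frameD[OF fr])
    have "?c k (key k) + 1 < 2 ^ w" using card_less_le[of k "\<lambda>t. key t = key k"] k n by linarith
    then show "runs w (WStore ''cnt'' (WArr ''K'' (WReg ''t'')) (WAdd (WArr ''cnt'' (WArr ''K'' (WReg ''t''))) (WConst 1))) s' 1
        (\<lambda>s'. warr s' ''cnt'' = ?c (Suc k))"
      using I k v w1 by (intro runs_final) (auto simp: fun_eq_iff card_less_Suc_eq)
  qed (use s n in auto)
  fix s1 assume 1: "warr s1 ''cnt'' = ?c n" and fr1: "frame ?l1 s s1"
  have v1: "wreg s1 ''nU'' = n" "warr s1 ''Un'' = xs" "warr s1 ''K'' = warr s ''K''" "rarr s1 ''V'' = V"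
      "rarr s1 ''FA'' = rarr s ''FA''"
    using s by (simp_all add: frameD[OF fr1])
  show "runs w (?z ;; ?l2 ;; ?l3 ;; ?e) s1 (10 * n + 6) ?post"
  proof (rule runs_block_Seq[where v = "(7 * n + 2) + (3 * n + 3)"])
    show "runs w (?l2 ;; ?l3 ;; ?e) (final w ?z s1) ((7 * n + 2) + (3 * n + 3)) ?post"
    proof (rule runs_Seq)
      let ?I = "\<lambda>k s'. wreg s' ''nV'' = length (?f k) \<and> arr_list (warr s' ''Un'') (length (?f k)) = map xs (?f k) \<and>
          (\<forall>t\<ge>k. warr s' ''Un'' t = xs t) \<and> rarr s' ''V'' = ?V k"
      show "runs w ?l2 (final w ?z s1) (7 * n + 2) (?I n)"
      proof (rule runs_for[where N = n and tb = 5 and I = ?I])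
        fix k s' assume I: "?I k s'" and k: "k < n" "wreg s' ''t'' = k" and fr: "frame ?l2 (final w ?z s1) s'"
        have v: "warr s' ''K'' k = key k" "warr s' ''cnt'' = ?c n" "rarr s' ''FA'' = rarr s ''FA''"
          using v1 1 K[OF k(1)] by (simp_all add: frameD[OF fr])
        have len: "length (?f k) \<le> k" by (rule length_filter_upt_le)
        show "runs w ?b2 s' 5 (?I (Suc k))"
        proof (cases "sole k")
          case True
          then have "final w ?b2 s' = s'\<lparr>wreg := (wreg s')(''x'' := xs k), rarr := (rarr s')(''V'' := (rarr s' ''V'')(xs k := cv (xs k)))\<rparr>"
            using I k v w1 sole[of k] F[OF k(1)] by simp
          then show ?thesis using I True by (intro runs_final) (auto simp: fun_eq_iff less_Suc_eq)
        next
          case False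
          \<comment> \<open>The write position is at most \<open>k\<close>, and cell
            \<open>k\<close> has just been read, so the compaction destroys nothing that is still to
            be visited.\<close>
          have "Suc (length (?f k)) < 2 ^ w" using len k n by linarith
          then have "final w ?b2 s' = s'\<lparr>wreg := (wreg s')(''x'' := xs k, ''nV'' := Suc (length (?f k))),
              warr := (warr s')(''Un'' := (warr s' ''Un'')(length (?f k) := xs k))\<rparr>"
            using I k v w1 sole[of k] False by simp
          then show ?thesis using I False len
            by (intro runs_final) (auto simp: fun_eq_iff less_Suc_eq arr_list_snoc)
        qed
      qed (use v1 n in auto)
      fix s2 assume 2: "?I n s2" and fr2: "frame ?l2 (final w ?z s1) s2"
      have v2: "wreg s2 ''nU'' = n" "warr s2 ''K'' = warr s ''K''" "warr s2 ''cnt'' = ?c n"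
        using v1 1 by (simp_all add: frameD[OF fr2])
      show "runs w (?l3 ;; ?e) s2 (3 * n + 3) ?post"
      proof (rule runs_Seq_block)
        show "runs w ?l3 s2 (3 * n + 2) (\<lambda>s'. warr s' ''cnt'' = (\<lambda>_. 0))"
        proof (rule runs_for[where N = n and tb = 1 and
            I = "\<lambda>k s'. warr s' ''cnt'' = (\<lambda>j. if \<exists>t<k. key t = j then 0 else ?c n j)"])
          fix k s' assume I: "warr s' ''cnt'' = (\<lambda>j. if \<exists>t<k. key t = j then 0 else ?c n j)"
            and k: "k < n" "wreg s' ''t'' = k" and fr: "frame ?l3 s2 s'"
          have v: "warr s' ''K'' k = key k" using v2 K[OF k(1)] by (simp add: frameD[OF fr])
          show "runs w (WStore ''cnt'' (WArr ''K'' (WReg ''t'')) (WConst 0)) s' 1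
              (\<lambda>s'. warr s' ''cnt'' = (\<lambda>j. if \<exists>t<Suc k. key t = j then 0 else ?c n j))"
            using I v k by (intro runs_final) (auto simp: fun_eq_iff less_Suc_eq)
        next
          fix s' assume "warr s' ''cnt'' = (\<lambda>j. if \<exists>t<n. key t = j then 0 else ?c n j)"
          moreover have "(\<lambda>j. if \<exists>t<n. key t = j then 0 else ?c n j) = (\<lambda>_. 0)" by (auto simp: fun_eq_iff)
          ultimately show "warr s' ''cnt'' = (\<lambda>_. 0)" by simp
        qed (use v2 n in auto)
        fix s3 assume 3: "warr s3 ''cnt'' = (\<lambda>_. 0)" and fr3: "frame ?l3 s2 s3"
        show "?post (final w ?e s3)" using 2 3 by (simp add: frameD[OF fr3])
      qed simp_all
    qed simp
  qed simp_all
qed simp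

text \<open>The tensor size \<open>W ^ d\<close> in \<open>conv_time\<close> is replaced by a bound
  \<open>Q\<close>, since the rank \<open>d\<close> is known only after the search for
  moduli.\<close>

definition conv_bound :: "nat \<Rightarrow> nat \<Rightarrow> nat \<Rightarrow> nat \<Rightarrow> nat" where
  "conv_bound n W d Q = n * (4 * d + 8) +
     d * (3 * (Q * (3 * W + 13)) + W * (7 * W + 5) + 24) + 9 * Q + 16"

lemma conv_time_le_bound:
  assumes "d \<le> D" "W ^ d \<le> Q"
  shows "conv_time n W d \<le> conv_bound n W D Q"
  unfolding conv_time_def conv_bound_def
  using assms by (intro add_mono mult_le_mono le_refl) auto

definition round_com :: com where
  "round_com = select_com ;; conv_com ;; sub_com ;; recover_com"

lemma wr_round [simp]:
  "wr_wreg round_com = {''d'', ''st'', ''pa'', ''be'', ''bp'', ''q'', ''p'', ''c'', ''t'', ''k'',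
     ''i'', ''x'', ''h'', ''hs'', ''hu'', ''sa'', ''u'', ''e'', ''sb'', ''eb'', ''b'', ''r'', ''nV'', ''nU''}"
  "wr_warr round_com = {''cnt'', ''P'', ''K'', ''Un''}" "wr_rreg round_com = {''acc''}"
  "wr_rarr round_com = {''MN'', ''TM'', ''FA'', ''FB'', ''V''}"
  by (auto simp: round_com_def)

definition round_time :: "nat \<Rightarrow> nat \<Rightarrow> nat \<Rightarrow> nat \<Rightarrow> nat \<Rightarrow> nat \<Rightarrow> nat" where
  "round_time n M W U D Q = select_time M U D + conv_bound n W D Q + (M * (4 * D + 8) + 2) + (13 * M + 8)"

text \<open>\<open>M\<close> bounds the number of candidates, \<open>2 ^ L\<close> the candidates themselves, \<open>Q\<close> the size of the hash
  tensor and \<open>D\<close> its rank; \<open>R\<close> is the factor by which a good modulus reduces the collisions.\<close>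

definition limits :: "nat \<Rightarrow> nat \<Rightarrow> nat \<Rightarrow> nat \<Rightarrow> nat \<Rightarrow> nat \<Rightarrow> nat \<Rightarrow> nat \<Rightarrow> bool" where
  "limits w W U M L R Q D \<longleftrightarrow> W = 2 * U \<and> 0 < U \<and> W * W < 2 ^ w \<and> 4 * (M * M) < 2 ^ w \<and> Suc M < 2 ^ w \<and>
     R * L \<le> card {p::nat. prime p \<and> p \<le> U} \<and> 0 < R * L \<and>
     (\<forall>k. R ^ k < 4 * M \<longrightarrow> W ^ Suc k \<le> Q \<and> k < D) \<and> Q < 2 ^ w"

definition conv_env ::
  "nat \<Rightarrow> nat \<Rightarrow> nat \<Rightarrow> (nat \<Rightarrow> nat) \<Rightarrow> (nat \<Rightarrow> real) \<Rightarrow> nat \<Rightarrow> (nat \<Rightarrow> nat) \<Rightarrow> (nat \<Rightarrow> real) \<Rightarrow> state \<Rightarrow> bool" where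
  "conv_env W U na ai av nb bi bv s \<longleftrightarrow> wreg s ''U'' = U \<and> wreg s ''W'' = W \<and> input_state na ai av nb bi bv s \<and>
     is_vandermonde W (rarr s ''MV'') \<and> is_lagrange W (rarr s ''Z'')"

definition unresolved :: "(nat \<Rightarrow> real) \<Rightarrow> nat set \<Rightarrow> nat list \<Rightarrow> state \<Rightarrow> bool" where
  "unresolved cv T us s \<longleftrightarrow> arr_list (warr s ''Un'') (wreg s ''nU'') = us \<and> distinct us \<and> set us \<subseteq> T \<and>
     (\<forall>x\<in>T. rarr s ''V'' x = (if x \<in> set us then 0 else cv x)) \<and> warr s ''cnt'' = (\<lambda>_. 0)"

text \<open>Few collisions mean that at least half of the unresolved candidates are alone in their
  buckets, and after the subtraction such a bucket holds nothing but the value sought.\<close>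

lemma runs_round:
  fixes ai bi :: "nat \<Rightarrow> nat"
  assumes lim: "limits w W U M L R Q D" and env: "conv_env W U na ai av nb bi bv s" and q: "wreg s ''pw'' = q"
    and nab: "na < 2 ^ w" "nb < 2 ^ w"
    and T: "arr_list (warr s ''T'') (wreg s ''nT'') = ts" "distinct ts" "length ts \<le> M" "\<And>x. x \<in> set ts \<Longrightarrow> x < 2 ^ L"
    and cov: "pair_pos ai bi q ` ({..<na} \<times> {..<nb}) \<subseteq> set ts"
    and cv: "cv = bucket_sum ({..<na} \<times> {..<nb}) (pair_val av bv) (pair_pos ai bi q)"
    and un: "unresolved cv (set ts) us s" "us \<noteq> []"
  shows "runs w round_com s (round_time (na + nb) M W U D Q)
    (\<lambda>s'. \<exists>us'. unresolved cv (set ts) us' s' \<and> 2 * length us' \<le> length us)"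
  unfolding round_com_def
proof (rule runs_Seq)
  define n where "n = length us"
  define xs where "xs = warr s ''Un''"
  let ?K = "{..<na} \<times> {..<nb}"
  have u: "wreg s ''nU'' = n" "arr_list xs n = us" "distinct us" "set us \<subseteq> set ts" "warr s ''cnt'' = (\<lambda>_. 0)"
    "\<And>x. x \<in> set ts \<Longrightarrow> rarr s ''V'' x = (if x \<in> set us then 0 else cv x)"
    using un by (auto simp: unresolved_def n_def xs_def)
  have xs: "inj_on xs {..<n}" "xs ` {..<n} = set us" using u by (metis distinct_arr_list, metis set_arr_list)
  have nM: "n \<le> M" using card_mono[OF finite_set u(4)] u(3) T by (simp add: distinct_card n_def)
  have n0: "0 < n" using un by (simp add: n_def)
  have nn: "4 * (n * n) \<le> 4 * (M * M)" using nM by (intro mult_le_mono) auto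
  have lim': "W = 2 * U" "0 < U" "W * W < 2 ^ w" "4 * (M * M) < 2 ^ w" "Suc M < 2 ^ w" "Q < 2 ^ w"
     "R * L \<le> card {p::nat. prime p \<and> p \<le> U}" "0 < R * L"
     "\<And>k. R ^ k < 4 * M \<Longrightarrow> W ^ Suc k \<le> Q" "\<And>k. R ^ k < 4 * M \<Longrightarrow> k < D"
    using lim by (auto simp: limits_def)
  have e: "wreg s ''U'' = U" "wreg s ''W'' = W" using env by (auto simp: conv_env_def)
  have xL: "xs t < 2 ^ L" if "t < n" for t using that xs(2) u(4) T(4) by blast
  have Ww: "W < 2 ^ w" using le_less_trans[OF le_square lim'(3)] .
  have step: "R ^ k < 4 * M" if "R ^ k < 4 * n" for k using that nM by linarith
  have n4: "4 * (n * n) < 2 ^ w" using nn lim'(4) by linarith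
  show "runs w select_com s (select_time M U D) (\<lambda>s'. \<exists>d P. hash_state W P d s' \<and> moduli U P d \<and> d \<le> D \<and> W ^ d \<le> Q \<and>
       (\<forall>t<n. warr s' ''K'' t = mkey W P d (xs t)) \<and> 4 * collisions n xs (mkey W P d) \<le> n \<and>
       warr s' ''cnt'' = (\<lambda>_. 0))"
  proof (rule runs_conseq[OF runs_select[OF u(1) e xs_def[symmetric] u(5) xs(1) xL lim'(7,8,1,2) Ww n4 n0 _ lim'(6)]])
    show "W ^ Suc k \<le> Q" "k < D" if "R ^ k < 4 * n" for k using step[OF that] lim'(9,10) by blast+
    show "select_time n U D \<le> select_time M U D"
      unfolding select_time_def using nM by (intro add_mono mult_le_mono le_refl) auto
  qed
  fix s1
  assume "\<exists>d P. hash_state W P d s1 \<and> moduli U P d \<and> d \<le> D \<and> W ^ d \<le> Q \<and>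
       (\<forall>t<n. warr s1 ''K'' t = mkey W P d (xs t)) \<and> 4 * collisions n xs (mkey W P d) \<le> n \<and>
       warr s1 ''cnt'' = (\<lambda>_. 0)" and fr1: "frame select_com s s1"
  then obtain d P where h1: "hash_state W P d s1" and P: "moduli U P d" and d: "d \<le> D" "W ^ d \<le> Q"
    and K: "\<forall>t<n. warr s1 ''K'' t = mkey W P d (xs t)" and col: "4 * collisions n xs (mkey W P d) \<le> n"
    and cnt1: "warr s1 ''cnt'' = (\<lambda>_. 0)" by blast
  have pa: "params w W U P d" using lim' P d by (auto simp: params_def)
  note pf = params_facts[OF pa]
  have env1: "conv_env W U na ai av nb bi bv s1" using env by (simp add: conv_env_def input_state_def frameD[OF fr1])
  have q1: "wreg s1 ''pw'' = q" using q by (simp add: frameD[OF fr1])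
  have nTlen: "wreg s ''nT'' = length ts" using T(1) by auto
  show "runs w (conv_com ;; sub_com ;; recover_com) s1
     (conv_bound (na + nb) W D Q + ((M * (4 * D + 8) + 2) + (13 * M + 8)))
    (\<lambda>s'. \<exists>us'. unresolved cv (set ts) us' s' \<and> 2 * length us' \<le> length us)"
  proof (rule runs_Seq)
    show "runs w conv_com s1 (conv_bound (na + nb) W D Q) (\<lambda>s'. \<forall>i<W ^ d. rarr s' ''FA'' i =
        bucket_sum ?K (pair_val av bv) (\<lambda>k. mkey W P d (pair_pos ai bi q k)) i)"
      using env1 by (intro runs_conseq[OF runs_conv[OF pa h1 _ nab q1] conv_time_le_bound[OF d]]) (auto simp: conv_env_def)
    fix s2 assume 2: "\<forall>i<W ^ d. rarr s2 ''FA'' i =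
        bucket_sum ?K (pair_val av bv) (\<lambda>k. mkey W P d (pair_pos ai bi q k)) i" and fr2: "frame conv_com s1 s2"
    \<comment> \<open>The candidates cover all positions, so the hashed pairs can be regrouped by
      candidate.\<close>
    have FA2: "rarr s2 ''FA'' i = (\<Sum>z\<in>set ts. if mkey W P d z = i then cv z else 0)" if "i < W ^ d" for i
      using 2 that unfolding cv by (subst bucket_sum_comp[OF _ _ cov, symmetric]) auto
    have h2: "hash_state W P d s2" using h1 by (simp add: hash_state_def frameD[OF fr2])
    have v2: "wreg s2 ''nT'' = length ts" "warr s2 ''T'' = warr s ''T''" "rarr s2 ''V'' = rarr s ''V''"
      using nTlen by (simp_all add: frameD[OF fr1] frameD[OF fr2])
    have lenw: "length ts < 2 ^ w" using T(3) lim'(5) by linarith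
    show "runs w (sub_com ;; recover_com) s2 ((M * (4 * D + 8) + 2) + (13 * M + 8))
       (\<lambda>s'. \<exists>us'. unresolved cv (set ts) us' s' \<and> 2 * length us' \<le> length us)"
    proof (rule runs_Seq)
      have "length ts * (4 * d + 8) \<le> M * (4 * D + 8)" using T(3) d by (intro mult_le_mono) auto
      then show "runs w sub_com s2 (M * (4 * D + 8) + 2) (\<lambda>s'. \<forall>i. rarr s' ''FA'' i = rarr s2 ''FA'' i -
          (\<Sum>t<length ts. if mkey W P d (warr s ''T'' t) = i then rarr s ''V'' (warr s ''T'' t) else 0))"
        by (intro runs_conseq[OF runs_sub[OF pa h2 v2 refl lenw]]) auto
      fix s3 assume 3: "\<forall>i. rarr s3 ''FA'' i = rarr s2 ''FA'' i -
          (\<Sum>t<length ts. if mkey W P d (warr s ''T'' t) = i then rarr s ''V'' (warr s ''T'' t) else 0)"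
        and fr3: "frame sub_com s2 s3"
      have tsd: "arr_list (warr s ''T'') (length ts) = ts" using T(1) nTlen by simp
      have FA3: "rarr s3 ''FA'' i = (\<Sum>z\<in>set us. if mkey W P d z = i then cv z else 0)" if "i < W ^ d" for i
      proof -
        have "(\<Sum>t<length ts. if mkey W P d (warr s ''T'' t) = i then rarr s ''V'' (warr s ''T'' t) else 0) =
          (\<Sum>z\<in>set ts. if mkey W P d z = i then rarr s ''V'' z else 0)"
          using sum_arr_list[of "warr s ''T''" "length ts" "\<lambda>z. if mkey W P d z = i then rarr s ''V'' z else 0"] tsd T(2)
          by simp
        then have "rarr s3 ''FA'' i = (\<Sum>z\<in>set ts. if mkey W P d z = i then cv z - rarr s ''V'' z else 0)"
          using 3 FA2[OF that] by (auto simp: sum_subtractf[symmetric] intro!: sum.cong)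
        \<comment> \<open>Resolved candidates cancel, as \<open>V\<close> already holds their
          values; for unresolved ones \<open>V\<close> is zero.\<close>
        also have "\<dots> = (\<Sum>z\<in>set ts. if z \<in> set us then (if mkey W P d z = i then cv z else 0) else 0)"
          using u(6) by (intro sum.cong) auto
        also have "\<dots> = (\<Sum>z\<in>set us. if mkey W P d z = i then cv z else 0)"
          using u(4) by (simp add: sum.inter_restrict[symmetric] Int_absorb1)
        finally show ?thesis .
      qed
      define key where "key t = mkey W P d (xs t)" for t
      define sole where "sole t \<longleftrightarrow> card {t'. t' < n \<and> key t' = key t} = 1" for t
      have soleD: "t' = t" if sole: "sole t" and "t < n" "t' < n" "key t' = key t" for t t'
      proof -
        obtain a where "{t'. t' < n \<and> key t' = key t} = {a}" using sole unfolding sole_def by (auto simp: card_1_singleton_iff)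
        then show ?thesis using that by (metis (mono_tags, lifting) mem_Collect_eq singletonD)
      qed
      have F3: "rarr s3 ''FA'' (key t) = cv (xs t)" if t: "t < n" "sole t" for t
      proof -
        have "key t < W ^ d" unfolding key_def by (rule mkey_less[OF pf(1,2)])
        then have "rarr s3 ''FA'' (key t) = (\<Sum>z\<in>set us. if mkey W P d z = key t then cv z else 0)" by (rule FA3)
        also have "\<dots> = (\<Sum>z\<in>set us. if z = xs t then cv z else 0)"
        proof (rule sum.cong)
          fix z assume "z \<in> set us"
          then obtain t' where t': "t' < n" "z = xs t'" using xs(2) by auto
          then have "mkey W P d z = key t \<longleftrightarrow> z = xs t" using soleD[OF t(2,1) t'(1)] by (auto simp: key_def)
          then show "(if mkey W P d z = key t then cv z else 0) = (if z = xs t then cv z else 0)" by simp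
        qed simp
        also have "\<dots> = cv (xs t)" using t xs(2) by auto
        finally show ?thesis .
      qed
      have v3: "wreg s3 ''nU'' = n" "warr s3 ''Un'' = xs" "warr s3 ''cnt'' = (\<lambda>_. 0)" "rarr s3 ''V'' = rarr s ''V''"
        using u cnt1 by (simp_all add: frameD[OF fr1] frameD[OF fr2] frameD[OF fr3] xs_def)
      have K3: "warr s3 ''K'' t = key t" if "t < n" for t
        using K that by (simp add: frameD[OF fr2] frameD[OF fr3] key_def)
      have nw: "Suc n < 2 ^ w" using nM lim'(5) by linarith
      show "runs w recover_com s3 (13 * M + 8) (\<lambda>s'. \<exists>us'. unresolved cv (set ts) us' s' \<and> 2 * length us' \<le> length us)"
      proof (rule runs_conseq[OF runs_recover[OF v3 K3 n0 nw sole_def F3]])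
        show "13 * n + 8 \<le> 13 * M + 8" using nM by simp
        fix s4 :: state
        assume 4: "arr_list (warr s4 ''Un'') (wreg s4 ''nU'') = map xs (filter (\<lambda>t. \<not> sole t) [0..<n]) \<and>
          rarr s4 ''V'' = (\<lambda>x. if \<exists>t<n. sole t \<and> xs t = x then cv x else rarr s ''V'' x) \<and> warr s4 ''cnt'' = (\<lambda>_. 0)"
        define us' where "us' = map xs (filter (\<lambda>t. \<not> sole t) [0..<n])"
        have set': "set us' = {xs t | t. t < n \<and> \<not> sole t}" by (auto simp: us'_def)
        have "distinct us'" using xs(1) unfolding us'_def
          by (auto simp: distinct_map inj_on_def)
        moreover have "set us' \<subseteq> set ts" using set' xs(2) u(4) by auto
        moreover have "rarr s4 ''V'' x = (if x \<in> set us' then 0 else cv x)" if x: "x \<in> set ts" for x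
        proof (cases "x \<in> set us")
          case True
          then obtain t where t: "t < n" "x = xs t" using xs(2) by auto
          have "(\<exists>t'<n. sole t' \<and> xs t' = x) \<longleftrightarrow> sole t" using xs(1) t by (auto dest: inj_onD)
          moreover have "x \<in> set us' \<longleftrightarrow> \<not> sole t" using xs(1) t unfolding set' by (auto dest: inj_onD)
          ultimately show ?thesis using 4 u(6)[OF x] True by auto
        next
          case False
          then have "x \<notin> set us'" "\<not> (\<exists>t<n. sole t \<and> xs t = x)" using xs(2) unfolding set' by auto
          then show ?thesis using 4 u(6)[OF x] False by auto
        qed
        ultimately have un': "unresolved cv (set ts) us' s4" using 4 by (simp add: unresolved_def us'_def)
        have "length us' = card {t. t < n \<and> \<not> sole t}"
          unfolding us'_def by (simp add: length_filter_conv_card cong: conj_cong)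
        also have "\<dots> \<le> card {t. t < n \<and> (\<exists>t'<n. t' \<noteq> t \<and> mkey W P d (xs t') = mkey W P d (xs t))}"
        proof (intro card_mono subsetI)
          fix t assume t: "t \<in> {t. t < n \<and> \<not> sole t}"
          have "\<exists>t'<n. t' \<noteq> t \<and> key t' = key t"
          proof (rule ccontr)
            assume "\<not> ?thesis"
            then have "{t'. t' < n \<and> key t' = key t} = {t}" using t by auto
            then show False using t by (simp add: sole_def)
          qed
          then show "t \<in> {t. t < n \<and> (\<exists>t'<n. t' \<noteq> t \<and> mkey W P d (xs t') = mkey W P d (xs t))}"
            using t by (auto simp: key_def)
        qed simp
        also have "\<dots> \<le> 2 * collisions n xs (mkey W P d)" by (rule card_not_isolated)
        finally have "2 * length us' \<le> length us" using col n_def by linarith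
        then show "\<exists>us'. unresolved cv (set ts) us' s4 \<and> 2 * length us' \<le> length us" using un' by blast
      qed
    qed simp
  qed simp
qed (simp add: round_time_def)

subsection \<open>Scaling levels\<close>

definition rounds_com :: com where
  "rounds_com = While (WLess (WConst 0) (WReg ''nU'')) round_com"

lemma wr_rounds [simp]:
  "wr_wreg rounds_com = wr_wreg round_com" "wr_warr rounds_com = wr_warr round_com"
  "wr_rreg rounds_com = wr_rreg round_com" "wr_rarr rounds_com = wr_rarr round_com"
  by (auto simp: rounds_com_def)

text \<open>Halving keeps \<open>length us * 2 ^ k \<le> M\<close>, so anything left after
  \<open>k\<close> rounds forces \<open>2 ^ k \<le> M < 2 ^ r\<close>.\<close>

lemma runs_rounds:
  fixes ai bi :: "nat \<Rightarrow> nat"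
  assumes lim: "limits w W U M L R Q D" and env: "conv_env W U na ai av nb bi bv s" and q: "wreg s ''pw'' = q"
    and nab: "na < 2 ^ w" "nb < 2 ^ w"
    and T: "arr_list (warr s ''T'') (wreg s ''nT'') = ts" "distinct ts" "length ts \<le> M" "\<And>x. x \<in> set ts \<Longrightarrow> x < 2 ^ L"
    and cov: "pair_pos ai bi q ` ({..<na} \<times> {..<nb}) \<subseteq> set ts"
    and cv: "cv = bucket_sum ({..<na} \<times> {..<nb}) (pair_val av bv) (pair_pos ai bi q)"
    and un: "unresolved cv (set ts) us s" and r: "M < 2 ^ r"
  shows "runs w rounds_com s (r * (round_time (na + nb) M W U D Q + 1) + 1)
    (\<lambda>s'. (\<forall>x\<in>set ts. rarr s' ''V'' x = cv x) \<and> warr s' ''cnt'' = (\<lambda>_. 0))"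
  unfolding rounds_com_def
proof (rule runs_While[where n = r and I = "\<lambda>k s'. \<exists>us. unresolved cv (set ts) us s' \<and> length us * 2 ^ k \<le> M"])
  have "length us \<le> M"
    using un T card_mono[of "set ts" "set us"] by (simp add: unresolved_def distinct_card)
  then show "\<exists>us. unresolved cv (set ts) us s \<and> length us * 2 ^ 0 \<le> M" using un by auto
  fix k s'
  assume I: "\<exists>us. unresolved cv (set ts) us s' \<and> length us * 2 ^ k \<le> M" and fr: "frame round_com s s'"
  then obtain us where us: "unresolved cv (set ts) us s'" "length us * 2 ^ k \<le> M" by blast
  have nU: "wreg s' ''nU'' = length us" using us(1) by (auto simp: unresolved_def)
  {
    assume b: "bval w (WLess (WConst 0) (WReg ''nU'')) s'"
    then have pos: "0 < length us" using nU by simp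
    then have "1 * 2 ^ k \<le> length us * 2 ^ k" by (intro mult_le_mono1) linarith
    then have "(2::nat) ^ k < 2 ^ r" using us r by linarith
    then show "k < r" by (rule power_less_imp_less_exp[rotated]) simp
    show "runs w round_com s' (round_time (na + nb) M W U D Q)
      (\<lambda>s'. \<exists>us. unresolved cv (set ts) us s' \<and> length us * 2 ^ Suc k \<le> M)"
    proof (rule runs_conseq[OF runs_round[OF lim _ _ nab _ T(2,3,4) cov cv us(1)]])
      show "conv_env W U na ai av nb bi bv s'" using env by (simp add: conv_env_def input_state_def frameD[OF fr])
      show "wreg s' ''pw'' = q" "arr_list (warr s' ''T'') (wreg s' ''nT'') = ts" using q T by (simp_all add: frameD[OF fr])
      show "us \<noteq> []" using pos by auto
      fix s2 assume "\<exists>us'. unresolved cv (set ts) us' s2 \<and> 2 * length us' \<le> length us"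
      then obtain us' where us': "unresolved cv (set ts) us' s2" "2 * length us' \<le> length us" by blast
      have "length us' * 2 ^ Suc k = 2 * length us' * 2 ^ k" by simp
      also have "\<dots> \<le> length us * 2 ^ k" using us'(2) by (rule mult_le_mono1)
      also have "\<dots> \<le> M" by (rule us(2))
      finally show "\<exists>us. unresolved cv (set ts) us s2 \<and> length us * 2 ^ Suc k \<le> M" using us'(1) by blast
    qed simp_all
  next
    assume "\<not> bval w (WLess (WConst 0) (WReg ''nU'')) s'"
    then have "us = []" using nU by simp
    then show "(\<forall>x\<in>set ts. rarr s' ''V'' x = cv x) \<and> warr s' ''cnt'' = (\<lambda>_. 0)"
      using us(1) by (simp add: unresolved_def)
  }
qed simp

text \<open>Cells of \<open>mark\<close> are stamped with the scale \<open>pw\<close>, which differs between levels, so the array is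
  never cleared.\<close>

definition emit_com :: com where
  "emit_com = Cond (WEq (WArr ''mark'' (WReg ''y'')) (WReg ''pw'')) Skip (
     WStore ''mark'' (WReg ''y'') (WReg ''pw'') ;;
     WStore ''T'' (WReg ''nT'') (WReg ''y'') ;;
     WStore ''Un'' (WReg ''nT'') (WReg ''y'') ;;
     RStore ''V'' (WReg ''y'') (ROfWord (WConst 0)) ;;
     WAssign ''nT'' (WAdd (WReg ''nT'') (WConst 1)))"

lemma wr_emit [simp]:
  "wr_wreg emit_com = {''nT''}" "wr_warr emit_com = {''mark'', ''T'', ''Un''}"
  "wr_rreg emit_com = {}" "wr_rarr emit_com = {''V''}"
  by (auto simp: emit_com_def)

definition emitted :: "nat \<Rightarrow> (nat \<Rightarrow> nat) \<Rightarrow> nat list \<Rightarrow> state \<Rightarrow> bool" where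
  "emitted q mk L s \<longleftrightarrow> arr_list (warr s ''T'') (wreg s ''nT'') = L \<and> arr_list (warr s ''Un'') (wreg s ''nT'') = L \<and>
     distinct L \<and> (\<forall>y\<in>set L. rarr s ''V'' y = 0) \<and> warr s ''mark'' = (\<lambda>y. if y \<in> set L then q else mk y)"

lemma final_emit:
  assumes em: "emitted q mk L s" and s: "wreg s ''pw'' = q" and y: "wreg s ''y'' = y"
    and mk: "\<And>y. mk y \<noteq> q" and len: "Suc (length L) < 2 ^ w"
  shows "emitted q mk (if y \<in> set L then L else L @ [y]) (final w emit_com s)"
proof -
  have nT: "wreg s ''nT'' = length L" using em by (auto simp: emitted_def)
  have m: "warr s ''mark'' y = q \<longleftrightarrow> y \<in> set L" using em mk by (simp add: emitted_def)
  have "1 < (2::nat) ^ w" using len by linarith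
  then have "0 < w" by (rule word_size_pos)
  then have w1: "(1::nat) mod 2 ^ w = 1" by simp
  show ?thesis
    using em s y nT m len w1 unfolding emitted_def emit_com_def by (auto simp: arr_list_snoc)
qed

text \<open>The offsets \<open>0\<close>, \<open>1\<close>, \<open>2\<close> are those of
  \<open>pair_pos_halve\<close>. Neighbouring parents share children, as in
  \<open>2 * x + 2 = 2 * (x + 1)\<close>, and \<open>emit_com\<close> filters out the repetitions.
  The limit \<open>3\<close> sits in a register because \<open>for_com\<close> expects one.\<close>

definition expand_com :: com where
  "expand_com = (WAssign ''nT'' (WConst 0) ;; WAssign ''three'' (WConst 3)) ;;
     for_com ''t'' ''nS'' (for_com ''e'' ''three'' (
       WAssign ''y'' (WAdd (WMul (WConst 2) (WArr ''S'' (WReg ''t''))) (WReg ''e'')) ;; emit_com))"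

lemma wr_expand [simp]:
  "wr_wreg expand_com = {''nT'', ''three'', ''t'', ''e'', ''y''}" "wr_warr expand_com = {''mark'', ''T'', ''Un''}"
  "wr_rreg expand_com = {}" "wr_rarr expand_com = {''V''}"
  by (auto simp: expand_com_def)

lemma runs_expand:
  assumes s: "wreg s ''pw'' = q" "wreg s ''nS'' = n" "warr s ''S'' = S" "warr s ''mark'' = mk"
    and mk: "\<And>y. mk y \<noteq> q" and n: "3 * n + 3 < 2 ^ w" and S: "\<And>t. t < n \<Longrightarrow> 2 * S t + 2 < 2 ^ w"
  shows "runs w expand_com s (34 * n + 4) (\<lambda>s'. \<exists>L. emitted q mk L s' \<and> length L \<le> 3 * n \<and>
     set L = {2 * x + e | x e. x \<in> S ` {..<n} \<and> e \<le> 2})"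
  unfolding expand_com_def
proof (rule runs_block_Seq)
  have "3 < (2::nat) ^ w" using n by linarith
  then have w3: "(3::nat) mod 2 ^ w = 3" "1 < (2::nat) ^ w" by simp_all
  then have "2 < (2::nat) ^ w" using \<open>3 < 2 ^ w\<close> by linarith
  then have w2: "(2::nat) mod 2 ^ w = 2" by (rule mod_less)
  let ?pre = "WAssign ''nT'' (WConst 0) ;; WAssign ''three'' (WConst 3)"
  let ?y = "WAssign ''y'' (WAdd (WMul (WConst 2) (WArr ''S'' (WReg ''t''))) (WReg ''e''))"
  let ?in = "for_com ''e'' ''three'' (?y ;; emit_com)"
  let ?X = "\<lambda>k. {2 * S t + e | t e. t < k \<and> e < (3::nat)}"
  let ?I = "\<lambda>k s'. \<exists>L. emitted q mk L s' \<and> length L \<le> 3 * k \<and> set L = ?X k"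
  have nn: "n < 2 ^ w" using n by linarith
  show "runs w (for_com ''t'' ''nS'' ?in) (final w ?pre s) (34 * n + 2) (\<lambda>s'. \<exists>L. emitted q mk L s' \<and> length L \<le> 3 * n \<and>
     set L = {2 * x + e | x e. x \<in> S ` {..<n} \<and> e \<le> 2})"
  proof (rule runs_for[where N = n and tb = 32 and I = ?I])
    fix k s' assume I: "?I k s'" and k: "k < n" "wreg s' ''t'' = k" and fr: "frame (for_com ''t'' ''nS'' ?in) (final w ?pre s) s'"
    have v: "wreg s' ''three'' = 3" "wreg s' ''pw'' = q" "warr s' ''S'' = S"
      using s w3 by (simp_all add: frameD[OF fr])
    let ?J = "\<lambda>j s'. \<exists>L. emitted q mk L s' \<and> length L \<le> 3 * k + j \<and> set L = ?X k \<union> {2 * S k + e | e. e < j}"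
    show "runs w ?in s' 32 (?I (Suc k))"
    proof (rule runs_for[where N = 3 and tb = 8 and I = ?J])
      fix j s1 assume J: "?J j s1" and j: "j < 3" "wreg s1 ''e'' = j" and fr1: "frame ?in s' s1"
      have v1: "wreg s1 ''t'' = k" "wreg s1 ''pw'' = q" "warr s1 ''S'' = S"
        using v k by (simp_all add: frameD[OF fr1])
      from J obtain L where L: "emitted q mk L s1" "length L \<le> 3 * k + j" "set L = ?X k \<union> {2 * S k + e | e. e < j}" by blast
      have b: "2 * S k + j < 2 ^ w" "2 * S k < 2 ^ w" using S[OF k(1)] j by linarith+
      have len: "Suc (length L) < 2 ^ w" using L(2) k j n by linarith
      let ?L = "if 2 * S k + j \<in> set L then L else L @ [2 * S k + j]"
      have em: "emitted q mk ?L (final w emit_com (final w ?y s1))"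
        using L(1) v1 j b w2 by (intro final_emit mk len) (auto simp: emitted_def)
      have "length ?L \<le> 3 * k + Suc j" using L(2) by auto
      moreover have "set ?L = ?X k \<union> {2 * S k + e | e. e < Suc j}"
      proof -
        have "set ?L = insert (2 * S k + j) (set L)" by auto
        moreover have "{2 * S k + e | e. e < Suc j} = insert (2 * S k + j) {2 * S k + e | e. e < j}"
          by (auto simp: less_Suc_eq)
        ultimately show ?thesis using L(3) by auto
      qed
      ultimately have "?J (Suc j) (final w (?y ;; emit_com) s1)" using em
        by (intro exI[of _ ?L]) simp
      then show "runs w (?y ;; emit_com) s1 8 (?J (Suc j))"
        by (intro runs_final) (simp_all add: emit_com_def)
    next
      fix s1 assume "?J 3 s1"
      then obtain L where L: "emitted q mk L s1" "length L \<le> 3 * k + 3" "set L = ?X k \<union> {2 * S k + e | e. e < 3}" by blast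
      have "?X k \<union> {2 * S k + e | e. e < 3} = ?X (Suc k)" by (auto simp: less_Suc_eq)
      then show "?I (Suc k) s1" using L by (intro exI[of _ L]) simp
    next
      show "?J 0 s'" using I by simp
      show "\<And>k' s' v. ?J k' s' \<Longrightarrow> ?J k' (s'\<lparr>wreg := (wreg s')(''e'' := v)\<rparr>)" by (simp add: emitted_def)
    qed (use v \<open>3 < 2 ^ w\<close> in auto)
  next
    fix s' assume "?I n s'"
    then obtain L where L: "emitted q mk L s'" "length L \<le> 3 * n" "set L = ?X n" by blast
    have "?X n = {2 * x + e | x e. x \<in> S ` {..<n} \<and> e \<le> 2}"
      by (auto simp: less_Suc_eq_le numeral_3_eq_3 numeral_2_eq_2)
    then show "\<exists>L. emitted q mk L s' \<and> length L \<le> 3 * n \<and> set L = {2 * x + e | x e. x \<in> S ` {..<n} \<and> e \<le> 2}"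
      using L by (intro exI[of _ L]) (simp only: simp_thms)
  next
    show "\<And>k s' v. ?I k s' \<Longrightarrow> ?I k (s'\<lparr>wreg := (wreg s')(''t'' := v)\<rparr>)" by (simp add: emitted_def)
    show "?I 0 (final w ?pre s)" using s by (intro exI[of _ "[]"]) (simp add: emitted_def)
  qed (use s nn in auto)
qed simp_all

text \<open>A candidate belongs to the support exactly when its recovered value is non-zero. The
  test is a comparison of reals, the only way in which reals can steer the words.\<close>

definition filter_com :: com where
  "filter_com = WAssign ''nS'' (WConst 0) ;;
     for_com ''t'' ''nT'' (
       WAssign ''x'' (WArr ''T'' (WReg ''t'')) ;;
       Cond (REq (RArr ''V'' (WReg ''x'')) (ROfWord (WConst 0))) Skip
         (WStore ''S'' (WReg ''nS'') (WReg ''x'') ;; WAssign ''nS'' (WAdd (WReg ''nS'') (WConst 1))))"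

lemma wr_filter [simp]:
  "wr_wreg filter_com = {''nS'', ''t'', ''x''}" "wr_warr filter_com = {''S''}"
  "wr_rreg filter_com = {}" "wr_rarr filter_com = {}"
  by (auto simp: filter_com_def)

lemma runs_filter:
  assumes s: "wreg s ''nT'' = n" "warr s ''T'' = T" "rarr s ''V'' = V" and n: "Suc n < 2 ^ w"
  shows "runs w filter_com s (7 * n + 3)
    (\<lambda>s'. arr_list (warr s' ''S'') (wreg s' ''nS'') = filter (\<lambda>x. V x \<noteq> 0) (arr_list T n))"
  unfolding filter_com_def
proof (rule runs_block_Seq)
  have "1 < (2::nat) ^ w" using n by linarith
  then have "0 < w" by (rule word_size_pos)
  then have w1: "(1::nat) mod 2 ^ w = 1" by simp
  let ?z = "WAssign ''nS'' (WConst 0)"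
  let ?b = "WAssign ''x'' (WArr ''T'' (WReg ''t'')) ;;
       Cond (REq (RArr ''V'' (WReg ''x'')) (ROfWord (WConst 0))) Skip
         (WStore ''S'' (WReg ''nS'') (WReg ''x'') ;; WAssign ''nS'' (WAdd (WReg ''nS'') (WConst 1)))"
  let ?f = "\<lambda>k. filter (\<lambda>x. V x \<noteq> 0) (arr_list T k)"
  let ?I = "\<lambda>k s'. wreg s' ''nS'' = length (?f k) \<and> arr_list (warr s' ''S'') (length (?f k)) = ?f k"
  show "runs w (for_com ''t'' ''nT'' ?b) (final w ?z s) (7 * n + 2)
    (\<lambda>s'. arr_list (warr s' ''S'') (wreg s' ''nS'') = ?f n)"
  proof (rule runs_for[where N = n and tb = 5 and I = ?I])
    fix k s' assume I: "?I k s'" and k: "k < n" "wreg s' ''t'' = k" and fr: "frame (for_com ''t'' ''nT'' ?b) (final w ?z s) s'"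
    have v: "warr s' ''T'' = T" "rarr s' ''V'' = V" using s by (simp_all add: frameD[OF fr])
    have "length (?f k) \<le> k" using length_filter_le[of _ "arr_list T k"] by simp
    then have len: "Suc (length (?f k)) < 2 ^ w" using k n by linarith
    have Suc: "?f (Suc k) = (if V (T k) = 0 then ?f k else ?f k @ [T k])" by (simp add: arr_list_def)
    show "runs w ?b s' 5 (?I (Suc k))"
      using I k v w1 len Suc by (intro runs_final) (auto simp: arr_list_snoc)
  qed (use s n in auto)
qed simp_all

definition level_com :: com where
  "level_com = WAssign ''pw'' (WDiv (WReg ''pw'') (WConst 2)) ;; expand_com ;;
     WAssign ''nU'' (WReg ''nT'') ;; rounds_com ;; filter_com"

lemma wr_level [simp]:
  "wr_wreg level_com = {''pw'', ''three'', ''y'', ''nT'', ''nS''} \<union> wr_wreg round_com"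
  "wr_warr level_com = {''mark'', ''T'', ''S''} \<union> wr_warr round_com"
  "wr_rreg level_com = wr_rreg round_com" "wr_rarr level_com = wr_rarr round_com"
  by (auto simp: level_com_def)

text \<open>All stamps in \<open>mark\<close> are zero or at least \<open>q\<close>, so the next
  scale, half as large, is a fresh stamp.\<close>

definition level_state ::
  "nat \<Rightarrow> nat \<Rightarrow> nat \<Rightarrow> (nat \<Rightarrow> nat) \<Rightarrow> (nat \<Rightarrow> real) \<Rightarrow> nat \<Rightarrow> (nat \<Rightarrow> nat) \<Rightarrow> (nat \<Rightarrow> real) \<Rightarrow> nat \<Rightarrow> state \<Rightarrow> bool" where
  "level_state W U na ai av nb bi bv q s \<longleftrightarrow> conv_env W U na ai av nb bi bv s \<and> wreg s ''pw'' = q \<and>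
     distinct (arr_list (warr s ''S'') (wreg s ''nS'')) \<and>
     set (arr_list (warr s ''S'') (wreg s ''nS'')) = pair_pos ai bi q ` ({..<na} \<times> {..<nb}) \<and>
     (\<forall>y. warr s ''mark'' y = 0 \<or> q \<le> warr s ''mark'' y) \<and> warr s ''cnt'' = (\<lambda>_. 0)"

definition level_time :: "nat \<Rightarrow> nat \<Rightarrow> nat \<Rightarrow> nat \<Rightarrow> nat \<Rightarrow> nat \<Rightarrow> nat \<Rightarrow> nat" where
  "level_time n M W U D Q r = 41 * M + r * (round_time n M W U D Q + 1) + 10"

text \<open>The children of the coarser support cover the support at scale \<open>q\<close>, the
  rounds determine their values, and dropping the zeros restores the exact support. Hence the
  candidate lists do not grow from level to level.\<close>

lemma runs_level:
  fixes ai bi :: "nat \<Rightarrow> nat"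
  assumes lim: "limits w W U M L R Q D" and r: "M < 2 ^ r"
    and nab: "na < 2 ^ w" "nb < 2 ^ w"
    and pos: "\<And>i. i < na \<Longrightarrow> av i > 0" "\<And>j. j < nb \<Longrightarrow> bv j > 0"
    and L: "\<And>k. k \<in> {..<na} \<times> {..<nb} \<Longrightarrow> pair_pos ai bi 1 k + 2 < 2 ^ L" "2 ^ L \<le> (2::nat) ^ w"
    and M: "\<And>q. 0 < q \<Longrightarrow> 3 * card (pair_pos ai bi q ` ({..<na} \<times> {..<nb})) \<le> M" and Mw: "M + 3 < 2 ^ w"
    and q: "0 < q" "2 * q < 2 ^ w" and st: "level_state W U na ai av nb bi bv (2 * q) s"
  shows "runs w level_com s (level_time (na + nb) M W U D Q r)
    (\<lambda>s'. level_state W U na ai av nb bi bv q s' \<and>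
       (\<forall>x\<in>pair_pos ai bi q ` ({..<na} \<times> {..<nb}).
          rarr s' ''V'' x = bucket_sum ({..<na} \<times> {..<nb}) (pair_val av bv) (pair_pos ai bi q) x))"
  unfolding level_com_def
proof (rule runs_block_Seq[where v = "(34 * M + 4) + (1 + ((r * (round_time (na + nb) M W U D Q + 1) + 1) + (7 * M + 3)))"])
  let ?K = "{..<na} \<times> {..<nb}"
  let ?pw = "WAssign ''pw'' (WDiv (WReg ''pw'') (WConst 2))"
  let ?s = "final w ?pw s"
  let ?nU = "WAssign ''nU'' (WReg ''nT'')"
  let ?rt = "r * (round_time (na + nb) M W U D Q + 1) + 1"
  let ?cv = "bucket_sum ?K (pair_val av bv) (pair_pos ai bi q)"
  let ?post = "\<lambda>s'. level_state W U na ai av nb bi bv q s' \<and> (\<forall>x\<in>pair_pos ai bi q ` ?K. rarr s' ''V'' x = ?cv x)"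
  define mk where "mk = warr s ''mark''"
  define ns where "ns = wreg s ''nS''"
  define S where "S = warr s ''S''"
  have "2 < (2::nat) ^ w" using Mw by linarith
  then have w2: "(2::nat) mod 2 ^ w = 2" by (rule mod_less)
  have env: "conv_env W U na ai av nb bi bv s" and pw: "wreg s ''pw'' = 2 * q"
    and dS: "distinct (arr_list S ns)" and setS: "S ` {..<ns} = pair_pos ai bi (2 * q) ` ?K"
    and marks: "\<And>y. mk y = 0 \<or> 2 * q \<le> mk y" and cnt: "warr s ''cnt'' = (\<lambda>_. 0)"
    using st unfolding level_state_def mk_def ns_def S_def set_arr_list by auto
  have v: "wreg ?s ''pw'' = q" "wreg ?s ''nS'' = ns" "warr ?s ''S'' = S" "warr ?s ''mark'' = mk"
    using pw w2 by (simp_all add: mk_def ns_def S_def)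
  have "ns = card (S ` {..<ns})" using dS by (simp add: distinct_arr_list card_image)
  then have ns: "3 * ns \<le> M" using M[of "2 * q"] q unfolding setS by simp
  \<comment> \<open>As \<open>2 * (a div (2 * q)) \<le> a\<close>, candidates exceed the positions
    at scale \<open>1\<close> by no more than the offset two.\<close>
  have y2: "2 * x + 2 < 2 ^ L" if "x \<in> S ` {..<ns}" for x
  proof -
    obtain k where k: "k \<in> ?K" "x = pair_pos ai bi (2 * q) k" using \<open>x \<in> S ` {..<ns}\<close> setS by auto
    have "2 * (a div (2 * q)) \<le> a" for a :: nat
      by (metis div_mult2_eq div_times_less_eq_dividend le_trans mult.commute mult_le_mono2 div_le_dividend)
    from this[of "ai (fst k)"] this[of "bi (snd k)"] have "2 * x \<le> pair_pos ai bi 1 k"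
      unfolding k pair_pos_def by simp
    then show ?thesis using L(1)[OF k(1)] by linarith
  qed
  have y2w: "2 * S t + 2 < 2 ^ w" if "t < ns" for t
  proof -
    have "S t \<in> S ` {..<ns}" using that by simp
    from y2[OF this] L(2) show ?thesis by linarith
  qed
  \<comment> \<open>The stamps present so far are zero or at least \<open>2 * q\<close>.\<close>
  have mkq: "mk y \<noteq> q" for y using marks[of y] q by auto
  have ns3: "3 * ns + 3 < 2 ^ w" using ns Mw by linarith
  show "runs w (expand_com ;; ?nU ;; rounds_com ;; filter_com) ?s ((34 * M + 4) + (1 + (?rt + (7 * M + 3)))) ?post"
  proof (rule runs_Seq)
    have le: "34 * ns + 4 \<le> 34 * M + 4" using ns by simp
    show "runs w expand_com ?s (34 * M + 4) (\<lambda>s'. \<exists>L. emitted q mk L s' \<and> length L \<le> 3 * ns \<and>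
        set L = {2 * x + e | x e. x \<in> S ` {..<ns} \<and> e \<le> 2})"
      by (rule runs_conseq[OF runs_expand[OF v mkq ns3 y2w] le])
    fix s1 assume "\<exists>L. emitted q mk L s1 \<and> length L \<le> 3 * ns \<and> set L = {2 * x + e | x e. x \<in> S ` {..<ns} \<and> e \<le> 2}"
      and fr1: "frame expand_com ?s s1"
    then obtain ts where ts: "emitted q mk ts s1" "length ts \<le> 3 * ns"
      "set ts = {2 * x + e | x e. x \<in> S ` {..<ns} \<and> e \<le> 2}" by blast
    let ?s1 = "final w ?nU s1"
    have em: "arr_list (warr s1 ''T'') (wreg s1 ''nT'') = ts" "arr_list (warr s1 ''Un'') (wreg s1 ''nT'') = ts"
       "distinct ts" "\<forall>y\<in>set ts. rarr s1 ''V'' y = 0" "warr s1 ''mark'' = (\<lambda>y. if y \<in> set ts then q else mk y)"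
      using ts(1) unfolding emitted_def by blast+
    have env1: "conv_env W U na ai av nb bi bv ?s1" using env by (simp add: conv_env_def input_state_def frameD[OF fr1])
    have pw1: "wreg ?s1 ''pw'' = q" using pw w2 by (simp add: frameD[OF fr1])
    have tsM: "length ts \<le> M" using ts(2) ns by linarith
    have tsL: "x < 2 ^ L" if "x \<in> set ts" for x using that y2 unfolding ts(3) by fastforce
    have cov: "pair_pos ai bi q ` ?K \<subseteq> set ts"
    proof
      fix y assume "y \<in> pair_pos ai bi q ` ?K"
      then obtain k where k: "k \<in> ?K" "y = pair_pos ai bi q k" by auto
      obtain e where e: "e \<le> 2" "y = 2 * pair_pos ai bi (2 * q) k + e" using pair_pos_halve[of ai bi q k] k(2) by auto
      have "pair_pos ai bi (2 * q) k \<in> S ` {..<ns}" unfolding setS using k(1) by (rule imageI)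
      then show "y \<in> set ts" using e unfolding ts(3) by blast
    qed
    have un: "unresolved ?cv (set ts) ts ?s1"
      using em cnt by (simp add: unresolved_def frameD[OF fr1])
    have T1: "arr_list (warr ?s1 ''T'') (wreg ?s1 ''nT'') = ts" using em by simp
    show "runs w (?nU ;; rounds_com ;; filter_com) s1 (1 + (?rt + (7 * M + 3))) ?post"
    proof (rule runs_block_Seq[where v = "?rt + (7 * M + 3)"])
      show "runs w (rounds_com ;; filter_com) ?s1 (?rt + (7 * M + 3)) ?post"
      proof (rule runs_Seq[OF runs_rounds[OF lim env1 pw1 nab T1 em(3) tsM tsL cov refl un r]])
        fix s2 assume 2: "(\<forall>x\<in>set ts. rarr s2 ''V'' x = ?cv x) \<and> warr s2 ''cnt'' = (\<lambda>_. 0)"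
          and fr2: "frame rounds_com ?s1 s2"
        have nT: "wreg s2 ''nT'' = length ts" using em(1) by (auto simp: frameD[OF fr2])
        have lenw: "Suc (length ts) < 2 ^ w" using tsM Mw by linarith
        have "7 * length ts + 3 \<le> 7 * M + 3" using tsM by simp
        then show "runs w filter_com s2 (7 * M + 3) ?post"
        proof (rule runs_conseq[OF runs_filter[OF nT refl refl lenw]])
          fix s3 assume "arr_list (warr s3 ''S'') (wreg s3 ''nS'') =
             filter (\<lambda>x. rarr s2 ''V'' x \<noteq> 0) (arr_list (warr s2 ''T'') (length ts))" and fr3: "frame filter_com s2 s3"
          moreover have "arr_list (warr s2 ''T'') (length ts) = ts" using em(1) by (auto simp: frameD[OF fr2])
          ultimately have S3: "arr_list (warr s3 ''S'') (wreg s3 ''nS'') = filter (\<lambda>x. rarr s2 ''V'' x \<noteq> 0) ts" by simp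
          have val: "pair_val av bv k > 0" if "k \<in> ?K" for k using that pos by (auto simp: pair_val_def)
          have supp: "?cv x \<noteq> 0 \<longleftrightarrow> x \<in> pair_pos ai bi q ` ?K" for x
            using bucket_sum_pos[of ?K "pair_val av bv" x "pair_pos ai bi q"] val by force
          have "rarr s2 ''V'' x \<noteq> 0 \<longleftrightarrow> x \<in> pair_pos ai bi q ` ?K" if "x \<in> set ts" for x
            using 2 supp[of x] that by simp
          then have "set (filter (\<lambda>x. rarr s2 ''V'' x \<noteq> 0) ts) = set ts \<inter> pair_pos ai bi q ` ?K"
            by (auto simp only: set_filter mem_Collect_eq Int_iff)
          then have "set (filter (\<lambda>x. rarr s2 ''V'' x \<noteq> 0) ts) = pair_pos ai bi q ` ?K"
            using cov by (simp only: Int_absorb1)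
          moreover have "\<forall>y. warr s3 ''mark'' y = 0 \<or> q \<le> warr s3 ''mark'' y"
          proof
            fix y show "warr s3 ''mark'' y = 0 \<or> q \<le> warr s3 ''mark'' y"
              using em(5) marks[of y] by (auto simp: frameD[OF fr2] frameD[OF fr3])
          qed
          moreover have "conv_env W U na ai av nb bi bv s3"
            using env1 by (simp add: conv_env_def input_state_def frameD[OF fr2] frameD[OF fr3])
          ultimately have "level_state W U na ai av nb bi bv q s3"
            unfolding level_state_def S3 using 2 em(3) pw1 by (simp add: frameD[OF fr2] frameD[OF fr3])
          moreover have "\<forall>x\<in>pair_pos ai bi q ` ?K. rarr s3 ''V'' x = ?cv x"
            using 2 cov by (auto simp: frameD[OF fr3])
          ultimately show "?post s3" by blast
        qed
      qed simp_all
    qed simp_all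
  qed simp
qed (simp_all add: level_time_def)

definition levels_com :: com where
  "levels_com = While (WLess (WConst 1) (WReg ''pw'')) level_com"

lemma wr_levels [simp]:
  "wr_wreg levels_com = wr_wreg level_com" "wr_warr levels_com = wr_warr level_com"
  "wr_rreg levels_com = wr_rreg level_com" "wr_rarr levels_com = wr_rarr level_com"
  by (auto simp: levels_com_def)

lemma runs_levels:
  fixes ai bi :: "nat \<Rightarrow> nat"
  assumes lim: "limits w W U M L R Q D" and r: "M < 2 ^ r"
    and nab: "na < 2 ^ w" "nb < 2 ^ w"
    and pos: "\<And>i. i < na \<Longrightarrow> av i > 0" "\<And>j. j < nb \<Longrightarrow> bv j > 0"
    and L: "\<And>k. k \<in> {..<na} \<times> {..<nb} \<Longrightarrow> pair_pos ai bi 1 k + 2 < 2 ^ L" "2 ^ L \<le> (2::nat) ^ w"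
    and M: "\<And>q. 0 < q \<Longrightarrow> 3 * card (pair_pos ai bi q ` ({..<na} \<times> {..<nb})) \<le> M" and Mw: "M + 3 < 2 ^ w"
    and el: "0 < el" "2 ^ el < (2::nat) ^ w" and st: "level_state W U na ai av nb bi bv (2 ^ el) s"
  shows "runs w levels_com s (el * (level_time (na + nb) M W U D Q r + 1) + 1)
    (\<lambda>s'. level_state W U na ai av nb bi bv 1 s' \<and>
       (\<forall>x\<in>pair_pos ai bi 1 ` ({..<na} \<times> {..<nb}).
          rarr s' ''V'' x = bucket_sum ({..<na} \<times> {..<nb}) (pair_val av bv) (pair_pos ai bi 1) x))"
  unfolding levels_com_def
\<comment> \<open>\<open>V\<close> holds values of the current scale only after at least one level,
  hence the condition \<open>0 < k\<close>; it is met at the end because \<open>el\<close> is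
  positive.\<close>
proof (rule runs_While[where n = el and I = "\<lambda>k s'. k \<le> el \<and> level_state W U na ai av nb bi bv (2 ^ (el - k)) s' \<and>
    (0 < k \<longrightarrow> (\<forall>x\<in>pair_pos ai bi (2 ^ (el - k)) ` ({..<na} \<times> {..<nb}).
          rarr s' ''V'' x = bucket_sum ({..<na} \<times> {..<nb}) (pair_val av bv) (pair_pos ai bi (2 ^ (el - k))) x))"])
  fix k s'
  let ?P = "\<lambda>k s'. \<forall>x\<in>pair_pos ai bi (2 ^ (el - k)) ` ({..<na} \<times> {..<nb}).
          rarr s' ''V'' x = bucket_sum ({..<na} \<times> {..<nb}) (pair_val av bv) (pair_pos ai bi (2 ^ (el - k))) x"
  assume I: "k \<le> el \<and> level_state W U na ai av nb bi bv (2 ^ (el - k)) s' \<and> (0 < k \<longrightarrow> ?P k s')"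
  have "1 < (2::nat) ^ w" using Mw by linarith
  then have w1: "(1::nat) mod 2 ^ w = 1" by (rule mod_less)
  have pw: "wreg s' ''pw'' = 2 ^ (el - k)" using I by (simp add: level_state_def)
  {
    assume b: "bval w (WLess (WConst 1) (WReg ''pw'')) s'"
    then have "1 < (2::nat) ^ (el - k)" using pw w1 by simp
    then have "0 < el - k" by (rule word_size_pos)
    then show "k < el" by simp
    then have e: "2 ^ (el - k) = 2 * (2::nat) ^ (el - Suc k)" by (simp add: Suc_diff_Suc flip: power_Suc)
    have "2 ^ (el - k) \<le> (2::nat) ^ el" by simp
    then have q: "0 < (2::nat) ^ (el - Suc k)" "2 * 2 ^ (el - Suc k) < (2::nat) ^ w"
      using el(2) unfolding e by (simp, linarith)
    have st': "level_state W U na ai av nb bi bv (2 * 2 ^ (el - Suc k)) s'" using I unfolding e by blast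
    show "runs w level_com s' (level_time (na + nb) M W U D Q r)
      (\<lambda>s'. Suc k \<le> el \<and> level_state W U na ai av nb bi bv (2 ^ (el - Suc k)) s' \<and> (0 < Suc k \<longrightarrow> ?P (Suc k) s'))"
      by (rule runs_conseq[OF runs_level[OF lim r nab pos L M Mw q st']]) (use \<open>k < el\<close> in auto)
  next
    assume "\<not> bval w (WLess (WConst 1) (WReg ''pw'')) s'"
    then have "\<not> 1 < (2::nat) ^ (el - k)" using pw w1 by simp
    then have "el - k = 0" by (metis gr0I one_less_numeral_iff one_less_power semiring_norm(76))
    then show "level_state W U na ai av nb bi bv 1 s' \<and>
       (\<forall>x\<in>pair_pos ai bi 1 ` ({..<na} \<times> {..<nb}).
          rarr s' ''V'' x = bucket_sum ({..<na} \<times> {..<nb}) (pair_val av bv) (pair_pos ai bi 1) x)"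
      using I el by simp
  }
qed (use st in auto)

subsection \<open>The complete program\<close>

text \<open>Only positive values are inserted, hence \<open>D\<close> vanishes exactly at the indices not yet listed in \<open>C\<close>.\<close>

definition insert_com :: com where
  "insert_com =
     Cond (REq (RArr ''D'' (WReg ''y'')) (ROfWord (WConst 0)))
       (WStore ''C'' (WReg ''lenC'') (WReg ''y'') ;; WAssign ''lenC'' (WAdd (WReg ''lenC'') (WConst 1))) Skip ;;
     RStore ''D'' (WReg ''y'') (RAdd (RArr ''D'' (WReg ''y'')) (RReg ''v''))"

lemma wr_insert [simp]:
  "wr_wreg insert_com = {''lenC''}" "wr_warr insert_com = {''C''}"
  "wr_rreg insert_com = {}" "wr_rarr insert_com = {''D''}"
  by (auto simp: insert_com_def)

definition collected :: "nat \<Rightarrow> (nat \<Rightarrow> real) \<Rightarrow> state \<Rightarrow> bool" where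
  "collected m f s \<longleftrightarrow> rarr s ''D'' = f \<and> distinct (arr_list (warr s ''C'') (wreg s ''lenC'')) \<and>
     set (arr_list (warr s ''C'') (wreg s ''lenC'')) = {y. f y \<noteq> 0} \<and> (\<forall>y. f y \<noteq> 0 \<longrightarrow> y < m) \<and> (\<forall>y. 0 \<le> f y)"

lemma collected_lenC:
  assumes "collected m f s"
  shows "wreg s ''lenC'' = card {y. f y \<noteq> 0}"
  using assms distinct_card[of "arr_list (warr s ''C'') (wreg s ''lenC'')"] by (simp add: collected_def)

lemma final_insert:
  assumes c: "collected m f s" and y: "wreg s ''y'' = y" "y < m" and v: "rreg s ''v'' = v" "0 < v" and m: "m < 2 ^ w"
  shows "collected m (f(y := f y + v)) (final w insert_com s)"
proof (cases "f y = 0")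
  case True
  \<comment> \<open>\<open>y\<close> is not listed yet, so fewer than \<open>m\<close> indices are,
    and \<open>lenC\<close> can be incremented without overflow.\<close>
  have "wreg s ''lenC'' = card {y. f y \<noteq> 0}" using collected_lenC[OF c] .
  also have "\<dots> \<le> card ({..<m} - {y})" using c True by (intro card_mono) (auto simp: collected_def)
  also have "\<dots> < m" using y by simp
  finally have len: "Suc (wreg s ''lenC'') < 2 ^ w" using m by linarith
  then have "1 < (2::nat) ^ w" by linarith
  then have w1: "(1::nat) mod 2 ^ w = 1" by (rule mod_less)
  have "{z. (f(y := f y + v)) z \<noteq> 0} = insert y {z. f z \<noteq> 0}" using True v by auto
  then show ?thesis using c y v True len w1
    unfolding collected_def insert_com_def by (auto simp: arr_list_snoc)
next
  case False
  have "{z. (f(y := f y + v)) z \<noteq> 0} = {z. f z \<noteq> 0}" using False v c by (auto simp: collected_def add_nonneg_eq_0_iff)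
  then show ?thesis using c y v False unfolding collected_def insert_com_def by auto
qed

lemma bucket_sum_insert:
  assumes "finite K" "k \<notin> K"
  shows "bucket_sum (insert k K) v x = (bucket_sum K v x)(x k := bucket_sum K v x (x k) + v k)"
  using assms by (auto simp: bucket_sum_def fun_eq_iff)

section \<open>The quadratic algorithm and the collection of the result\<close>

definition brute_com :: com where
  "brute_com = for_com ''i'' ''lenA'' (for_com ''j'' ''lenB'' (
     WAssign ''y'' (WMod (WAdd (WArr ''A'' (WReg ''i'')) (WArr ''B'' (WReg ''j''))) (WReg ''m'')) ;;
     RAssign ''v'' (RMul (RArr ''A'' (WReg ''i'')) (RArr ''B'' (WReg ''j''))) ;;
     insert_com))"

lemma wr_brute [simp]:
  "wr_wreg brute_com = {''i'', ''j'', ''y'', ''lenC''}" "wr_warr brute_com = {''C''}"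
  "wr_rreg brute_com = {''v''}" "wr_rarr brute_com = {''D''}"
  by (auto simp: brute_com_def)

abbreviation wrap_pos :: "nat \<Rightarrow> (nat \<Rightarrow> nat) \<Rightarrow> (nat \<Rightarrow> nat) \<Rightarrow> nat \<times> nat \<Rightarrow> nat" where
  "wrap_pos m ai bi k \<equiv> pair_pos ai bi 1 k mod m"

lemma runs_brute:
  assumes inp: "input_state na ai av nb bi bv s" and m: "wreg s ''m'' = m" "0 < m" "2 * m < 2 ^ w"
    and n: "na < 2 ^ w" "nb < 2 ^ w"
    and lt: "\<And>i. i < na \<Longrightarrow> ai i < m" "\<And>j. j < nb \<Longrightarrow> bi j < m"
    and pos: "\<And>i. i < na \<Longrightarrow> av i > 0" "\<And>j. j < nb \<Longrightarrow> bv j > 0"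
    and c: "collected m (\<lambda>_. 0) s"
  shows "runs w brute_com s (na * (9 * nb + 4) + 2)
    (collected m (bucket_sum ({..<na} \<times> {..<nb}) (pair_val av bv) (wrap_pos m ai bi)))"
  unfolding brute_com_def
proof -
  let ?b = "WAssign ''y'' (WMod (WAdd (WArr ''A'' (WReg ''i'')) (WArr ''B'' (WReg ''j''))) (WReg ''m'')) ;;
     RAssign ''v'' (RMul (RArr ''A'' (WReg ''i'')) (RArr ''B'' (WReg ''j''))) ;; insert_com"
  let ?in = "for_com ''j'' ''lenB'' ?b"
  let ?f = "\<lambda>K. bucket_sum K (pair_val av bv) (wrap_pos m ai bi)"
  show "runs w (for_com ''i'' ''lenA'' ?in) s (na * (9 * nb + 4) + 2) (collected m (?f ({..<na} \<times> {..<nb})))"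
  proof (rule runs_for[where N = na and tb = "9 * nb + 2" and I = "\<lambda>i. collected m (?f ({..<i} \<times> {..<nb}))"])
    fix i s' assume I: "collected m (?f ({..<i} \<times> {..<nb})) s'" and i: "i < na" "wreg s' ''i'' = i"
      and fr: "frame (for_com ''i'' ''lenA'' ?in) s s'"
    let ?K = "\<lambda>j. {..<i} \<times> {..<nb} \<union> {i} \<times> {..<j}"
    have inp': "input_state na ai av nb bi bv s'" "wreg s' ''m'' = m"
      using inp m by (simp_all add: input_state_def frameD[OF fr])
    show "runs w ?in s' (9 * nb + 2) (collected m (?f ({..<Suc i} \<times> {..<nb})))"
    proof (rule runs_for[where N = nb and tb = 7 and I = "\<lambda>j. collected m (?f (?K j))"])
      fix j s1 assume J: "collected m (?f (?K j)) s1" and j: "j < nb" "wreg s1 ''j'' = j" and fr1: "frame ?in s' s1"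
      have v1: "warr s1 ''A'' = ai" "warr s1 ''B'' = bi" "rarr s1 ''A'' = av" "rarr s1 ''B'' = bv" "wreg s1 ''m'' = m"
          "wreg s1 ''i'' = i"
        using inp' i by (simp_all add: input_state_def frameD[OF fr1])
      have b: "ai i + bi j < 2 ^ w" using lt(1)[OF i(1)] lt(2)[OF j(1)] m by linarith
      let ?pre = "WAssign ''y'' (WMod (WAdd (WArr ''A'' (WReg ''i'')) (WArr ''B'' (WReg ''j''))) (WReg ''m'')) ;;
         RAssign ''v'' (RMul (RArr ''A'' (WReg ''i'')) (RArr ''B'' (WReg ''j'')))"
      have y: "wreg (final w ?pre s1) ''y'' = wrap_pos m ai bi (i, j)" "rreg (final w ?pre s1) ''v'' = pair_val av bv (i, j)"
        using v1 b j by (simp_all add: pair_pos_def pair_val_def)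
      have "collected m (?f (?K j)) (final w ?pre s1)" using J by (simp add: collected_def)
      moreover have "0 < pair_val av bv (i, j)" using pos(1)[OF i(1)] pos(2)[OF j(1)] by (simp add: pair_val_def)
      ultimately have "collected m ((?f (?K j))(wrap_pos m ai bi (i, j) := ?f (?K j) (wrap_pos m ai bi (i, j)) + pair_val av bv (i, j)))
         (final w insert_com (final w ?pre s1))"
        using y m by (intro final_insert) auto
      moreover have "?K (Suc j) = insert (i, j) (?K j)" by (auto simp: less_Suc_eq)
      then have "?f (?K (Suc j)) = (?f (?K j))(wrap_pos m ai bi (i, j) := ?f (?K j) (wrap_pos m ai bi (i, j)) + pair_val av bv (i, j))"
        by (simp add: bucket_sum_insert)
      ultimately have "collected m (?f (?K (Suc j))) (final w ?b s1)" by simp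
      then show "runs w ?b s1 7 (collected m (?f (?K (Suc j))))"
        by (intro runs_final) (simp_all add: insert_com_def)
    next
      have "?K nb = {..<Suc i} \<times> {..<nb}" by (auto simp: less_Suc_eq)
      then show "\<And>s1. collected m (?f (?K nb)) s1 \<Longrightarrow> collected m (?f ({..<Suc i} \<times> {..<nb})) s1" by simp
      show "collected m (?f (?K 0)) s'" using I by simp
      show "\<And>k s' v. collected m (?f (?K k)) s' \<Longrightarrow> collected m (?f (?K k)) (s'\<lparr>wreg := (wreg s')(''j'' := v)\<rparr>)"
        by (simp add: collected_def)
    qed (use inp' n in \<open>auto simp: input_state_def\<close>)
  next
    show "collected m (?f ({..<0} \<times> {..<nb})) s" using c by (simp add: bucket_sum_def[abs_def])
    show "\<And>k s' v. collected m (?f ({..<k} \<times> {..<nb})) s' \<Longrightarrow>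
        collected m (?f ({..<k} \<times> {..<nb})) (s'\<lparr>wreg := (wreg s')(''i'' := v)\<rparr>)"
      by (simp add: collected_def)
  qed (use inp n in \<open>auto simp: input_state_def algebra_simps\<close>)
qed

definition collect_com :: com where
  "collect_com = for_com ''t'' ''nS'' (
     WAssign ''y'' (WMod (WArr ''S'' (WReg ''t'')) (WReg ''m'')) ;;
     RAssign ''v'' (RArr ''V'' (WArr ''S'' (WReg ''t''))) ;;
     insert_com)"

lemma wr_collect [simp]:
  "wr_wreg collect_com = {''t'', ''y'', ''lenC''}" "wr_warr collect_com = {''C''}"
  "wr_rreg collect_com = {''v''}" "wr_rarr collect_com = {''D''}"
  by (auto simp: collect_com_def)

lemma runs_collect:
  assumes s: "wreg s ''nS'' = n" "warr s ''S'' = S" "rarr s ''V'' = V" "wreg s ''m'' = m"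
    and m: "0 < m" "m < 2 ^ w" and n: "n < 2 ^ w" and V: "\<And>t. t < n \<Longrightarrow> V (S t) > 0"
    and c: "collected m (\<lambda>_. 0) s"
  shows "runs w collect_com s (9 * n + 2) (collected m (bucket_sum {..<n} (\<lambda>t. V (S t)) (\<lambda>t. S t mod m)))"
  unfolding collect_com_def
proof -
  let ?pre = "WAssign ''y'' (WMod (WArr ''S'' (WReg ''t'')) (WReg ''m'')) ;;
     RAssign ''v'' (RArr ''V'' (WArr ''S'' (WReg ''t'')))"
  let ?b = "WAssign ''y'' (WMod (WArr ''S'' (WReg ''t'')) (WReg ''m'')) ;;
     RAssign ''v'' (RArr ''V'' (WArr ''S'' (WReg ''t''))) ;; insert_com"
  let ?f = "\<lambda>k. bucket_sum {..<k} (\<lambda>t. V (S t)) (\<lambda>t. S t mod m)"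
  show "runs w (for_com ''t'' ''nS'' ?b) s (9 * n + 2) (collected m (?f n))"
  proof (rule runs_for[where N = n and tb = 7 and I = "\<lambda>k. collected m (?f k)"])
    fix k s' assume I: "collected m (?f k) s'" and k: "k < n" "wreg s' ''t'' = k" and fr: "frame (for_com ''t'' ''nS'' ?b) s s'"
    have v: "warr s' ''S'' = S" "rarr s' ''V'' = V" "wreg s' ''m'' = m" using s by (simp_all add: frameD[OF fr])
    have "collected m (?f k) (final w ?pre s')" using I by (simp add: collected_def)
    then have "collected m ((?f k)(S k mod m := ?f k (S k mod m) + V (S k))) (final w insert_com (final w ?pre s'))"
      using v k m V by (intro final_insert) auto
    moreover have "?f (Suc k) = (?f k)(S k mod m := ?f k (S k mod m) + V (S k))"
      by (simp add: lessThan_Suc bucket_sum_insert)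
    ultimately have "collected m (?f (Suc k)) (final w ?b s')" by simp
    then show "runs w ?b s' 7 (collected m (?f (Suc k)))"
      by (intro runs_final) (simp_all add: insert_com_def)
  next
    show "collected m (?f 0) s" using c by (simp add: bucket_sum_def[abs_def])
    show "\<And>k s' v. collected m (?f k) s' \<Longrightarrow> collected m (?f k) (s'\<lparr>wreg := (wreg s')(''t'' := v)\<rparr>)"
      by (simp add: collected_def)
  qed (use s n in auto)
qed

definition copy_com :: com where
  "copy_com = for_com ''i'' ''lenC'' (RStore ''C'' (WReg ''i'') (RArr ''D'' (WArr ''C'' (WReg ''i''))))"

lemma wr_copy [simp]:
  "wr_wreg copy_com = {''i''}" "wr_warr copy_com = {}" "wr_rreg copy_com = {}" "wr_rarr copy_com = {''C''}"
  by (auto simp: copy_com_def)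

lemma runs_copy:
  assumes c: "collected m f s" and m: "m < 2 ^ w"
  shows "runs w copy_com s (3 * card {y. f y \<noteq> 0} + 2)
    (\<lambda>s'. distinct (result s') \<and> set (result s') = {(y, f y) | y. f y \<noteq> 0})"
proof -
  define n where "n = wreg s ''lenC''"
  have n: "n = card {y. f y \<noteq> 0}" using collected_lenC[OF c] by (simp add: n_def)
  also have "\<dots> \<le> card {..<m}" using c by (intro card_mono) (auto simp: collected_def)
  finally have nw: "n < 2 ^ w" using m by simp
  have D: "rarr s ''D'' = f" using c by (simp add: collected_def)
  show ?thesis unfolding copy_com_def n[symmetric]
  proof (rule runs_for[where N = n and tb = 1 and I = "\<lambda>k s'. \<forall>i<k. rarr s' ''C'' i = f (warr s ''C'' i)"])
    fix s' assume 1: "\<forall>i<n. rarr s' ''C'' i = f (warr s ''C'' i)"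
      and fr: "frame (for_com ''i'' ''lenC'' (RStore ''C'' (WReg ''i'') (RArr ''D'' (WArr ''C'' (WReg ''i''))))) s s'"
    have "result s' = map (\<lambda>y. (y, f y)) (arr_list (warr s ''C'') n)"
      using 1 by (simp add: result_def arr_list_def n_def frameD[OF fr])
    then show "distinct (result s') \<and> set (result s') = {(y, f y) | y. f y \<noteq> 0}"
      using c by (auto simp: collected_def n_def distinct_map inj_on_def)
  next
    fix k s'
    assume "\<forall>i<k. rarr s' ''C'' i = f (warr s ''C'' i)" "wreg s' ''i'' = k"
      and fr: "frame (for_com ''i'' ''lenC'' (RStore ''C'' (WReg ''i'') (RArr ''D'' (WArr ''C'' (WReg ''i''))))) s s'"
    moreover have "warr s' ''C'' = warr s ''C''" "rarr s' ''D'' = f" using D by (simp_all add: frameD[OF fr])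
    ultimately show "runs w (RStore ''C'' (WReg ''i'') (RArr ''D'' (WArr ''C'' (WReg ''i'')))) s' 1
        (\<lambda>s'. \<forall>i<Suc k. rarr s' ''C'' i = f (warr s ''C'' i))"
      by (intro runs_final) (auto simp: less_Suc_eq)
  qed (use nw in \<open>auto simp: n_def\<close>)
qed

section \<open>Bit lengths, square roots and powers on the machine\<close>

definition bits :: "nat \<Rightarrow> nat" where
  "bits n = (LEAST k. n < 2 ^ k)"

definition root_up :: "nat \<Rightarrow> nat" where
  "root_up n = (LEAST k. n \<le> k * k)"

text \<open>A step count linear in the argument is crude but affordable, as the arguments will be at
  most the length of the longer input.\<close>

definition bits_com :: "vname \<Rightarrow> vname \<Rightarrow> com" where
  "bits_com x z = (WAssign z (WConst 0) ;; WAssign ''x'' (WConst 1)) ;;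
     While (BNot (WLess (WReg x) (WReg ''x''))) (
       WAssign ''x'' (WMul (WConst 2) (WReg ''x'')) ;; WAssign z (WAdd (WReg z) (WConst 1)))"

lemma wr_bits [simp]:
  "wr_wreg (bits_com x z) = {z, ''x''}" "wr_warr (bits_com x z) = {}"
  "wr_rreg (bits_com x z) = {}" "wr_rarr (bits_com x z) = {}"
  by (auto simp: bits_com_def)

lemma runs_bits:
  assumes s: "wreg s x = n" and names: "x \<noteq> z" "x \<noteq> ''x''" "z \<noteq> ''x''" and n: "2 * n + 2 < 2 ^ w"
  shows "runs w (bits_com x z) s (3 * n + 3) (\<lambda>s'. wreg s' z = bits n)"
  unfolding bits_com_def
proof (rule runs_block_Seq)
  have "2 < (2::nat) ^ w" using n by linarith
  then have w2: "(2::nat) mod 2 ^ w = 2" "(1::nat) mod 2 ^ w = 1" by (intro mod_less, linarith)+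
  let ?pre = "WAssign z (WConst 0) ;; WAssign ''x'' (WConst 1)"
  let ?b = "WAssign ''x'' (WMul (WConst 2) (WReg ''x'')) ;; WAssign z (WAdd (WReg z) (WConst 1))"
  show "runs w (While (BNot (WLess (WReg x) (WReg ''x''))) ?b) (final w ?pre s) (3 * n + 1) (\<lambda>s'. wreg s' z = bits n)"
  proof (rule runs_While[where n = n and tb = 2 and I = "\<lambda>k s'. wreg s' z = k \<and> wreg s' ''x'' = 2 ^ k \<and> (\<forall>j<k. 2 ^ j \<le> n)"])
    fix k s' assume I: "wreg s' z = k \<and> wreg s' ''x'' = 2 ^ k \<and> (\<forall>j<k. 2 ^ j \<le> n)" and fr: "frame ?b (final w ?pre s) s'"
    have v: "wreg s' x = n" using s names by (simp add: frameD[OF fr])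
    {
      assume b: "bval w (BNot (WLess (WReg x) (WReg ''x''))) s'"
      then have le: "2 ^ k \<le> n" using I v by simp
      moreover have "k < 2 ^ k" by (rule less_exp)
      ultimately show kn: "k < n" by linarith
      have "2 * 2 ^ k < (2::nat) ^ w" "k + 1 < 2 ^ w" using le n kn by linarith+
      then show "runs w ?b s' 2 (\<lambda>s'. wreg s' z = Suc k \<and> wreg s' ''x'' = 2 ^ Suc k \<and> (\<forall>j<Suc k. 2 ^ j \<le> n))"
        using I v w2 le names by (intro runs_final) (auto simp: less_Suc_eq)
    next
      assume "\<not> bval w (BNot (WLess (WReg x) (WReg ''x''))) s'"
      then have "n < 2 ^ k" using I v by simp
      then have "bits n = k" unfolding bits_def using I by (intro Least_equality) (auto simp: not_less[symmetric])
      then show "wreg s' z = bits n" using I by simp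
    }
  qed (use names w2 in auto)
qed simp_all

definition root_com :: com where
  "root_com = WAssign ''ss'' (WConst 0) ;;
     While (WLess (WMul (WReg ''ss'') (WReg ''ss'')) (WMul (WReg ''nu'') (WReg ''la'')))
       (WAssign ''ss'' (WAdd (WReg ''ss'') (WConst 1)))"

lemma wr_root [simp]:
  "wr_wreg root_com = {''ss''}" "wr_warr root_com = {}" "wr_rreg root_com = {}" "wr_rarr root_com = {}"
  by (auto simp: root_com_def)

lemma runs_root:
  assumes s: "wreg s ''nu'' = nu" "wreg s ''la'' = la" and n: "(nu * la + 1) * (nu * la + 1) < 2 ^ w"
  shows "runs w root_com s (2 * (nu * la) + 2) (\<lambda>s'. wreg s' ''ss'' = root_up (nu * la))"
  unfolding root_com_def
proof (rule runs_block_Seq)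
  let ?n = "nu * la"
  let ?pre = "WAssign ''ss'' (WConst 0)" and ?b = "WAssign ''ss'' (WAdd (WReg ''ss'') (WConst 1))"
  have nw: "?n + 1 < 2 ^ w" using le_square[of "?n + 1"] n by linarith
  have sq: "k * k < 2 ^ w" if "k \<le> ?n" for k
    using mult_le_mono[of k "?n + 1" k "?n + 1"] that n by linarith
  show "runs w (While (WLess (WMul (WReg ''ss'') (WReg ''ss'')) (WMul (WReg ''nu'') (WReg ''la''))) ?b) (final w ?pre s) (2 * ?n + 1)
    (\<lambda>s'. wreg s' ''ss'' = root_up ?n)"
  proof (rule runs_While[where n = ?n and tb = 1 and I = "\<lambda>k s'. wreg s' ''ss'' = k \<and> k \<le> ?n \<and> (\<forall>j<k. j * j < ?n)"])
    fix k s' assume I: "wreg s' ''ss'' = k \<and> k \<le> ?n \<and> (\<forall>j<k. j * j < ?n)" and fr: "frame ?b (final w ?pre s) s'"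
    have v: "wreg s' ''nu'' = nu" "wreg s' ''la'' = la" using s by (simp_all add: frameD[OF fr])
    have e: "bval w (WLess (WMul (WReg ''ss'') (WReg ''ss'')) (WMul (WReg ''nu'') (WReg ''la''))) s' \<longleftrightarrow> k * k < ?n"
      using I v sq[of k] nw by simp
    {
      assume "bval w (WLess (WMul (WReg ''ss'') (WReg ''ss'')) (WMul (WReg ''nu'') (WReg ''la''))) s'"
      then have k: "k * k < ?n" using e by simp
      then show kn: "k < ?n" using le_square[of k] by linarith
      have "1 < (2::nat) ^ w" using nw kn by linarith
      then have w1: "(1::nat) mod 2 ^ w = 1" by (rule mod_less)
      have "k + 1 < 2 ^ w" using kn nw by linarith
      then show "runs w ?b s' 1 (\<lambda>s'. wreg s' ''ss'' = Suc k \<and> Suc k \<le> ?n \<and> (\<forall>j<Suc k. j * j < ?n))"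
        using I k kn w1 by (intro runs_final) (auto simp: less_Suc_eq)
    next
      assume "\<not> bval w (WLess (WMul (WReg ''ss'') (WReg ''ss'')) (WMul (WReg ''nu'') (WReg ''la''))) s'"
      then have "?n \<le> k * k" using e by simp
      then have "root_up ?n = k" unfolding root_up_def
      proof (intro Least_equality)
        fix y assume "?n \<le> y * y"
        then show "k \<le> y" using I by (metis not_less)
      qed
      then show "wreg s' ''ss'' = root_up ?n" using I by simp
    }
  qed simp_all
qed simp_all

text \<open>\<open>32 ^ ss\<close> is \<open>2 ^ (5 * ss)\<close>. The stored list with the single
  entry \<open>0\<close> is the support at the coarsest scale, where every index has been divided
  down to zero.\<close>

definition pow_com :: com where
  "pow_com = WAssign ''U'' (WConst 1) ;;
     for_com ''i'' ''ss'' (WAssign ''U'' (WMul (WReg ''U'') (WConst 32))) ;;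
     (WAssign ''W'' (WMul (WConst 2) (WReg ''U'')) ;; WStore ''S'' (WConst 0) (WConst 0) ;; WAssign ''nS'' (WConst 1))"

lemma wr_pow [simp]:
  "wr_wreg pow_com = {''U'', ''i'', ''W'', ''nS''}" "wr_warr pow_com = {''S''}"
  "wr_rreg pow_com = {}" "wr_rarr pow_com = {}"
  by (auto simp: pow_com_def)

lemma runs_pow:
  assumes s: "wreg s ''ss'' = k" and n: "2 * 32 ^ k < (2::nat) ^ w" "32 < (2::nat) ^ w"
  shows "runs w pow_com s (3 * k + 6)
    (\<lambda>s'. wreg s' ''U'' = 32 ^ k \<and> wreg s' ''W'' = 2 * 32 ^ k \<and> wreg s' ''nS'' = 1 \<and> warr s' ''S'' 0 = 0)"
  unfolding pow_com_def
proof (rule runs_block_Seq)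
  have w1: "(1::nat) mod 2 ^ w = 1" "(2::nat) mod 2 ^ w = 2" "(32::nat) mod 2 ^ w = 32"
    using n by (intro mod_less, linarith)+
  let ?pre = "WAssign ''U'' (WConst 1)" and ?b = "WAssign ''U'' (WMul (WReg ''U'') (WConst 32))"
  let ?e = "WAssign ''W'' (WMul (WConst 2) (WReg ''U'')) ;; WStore ''S'' (WConst 0) (WConst 0) ;; WAssign ''nS'' (WConst 1)"
  have "k < 32 ^ k" by (rule power_gt_expt) simp
  then have kw: "k < 2 ^ w" using n by linarith
  have le: "(32::nat) ^ j \<le> 32 ^ k" if "j \<le> k" for j using that by (intro power_increasing) auto
  show "runs w (for_com ''i'' ''ss'' ?b ;; ?e) (final w ?pre s) (3 * k + 5)
    (\<lambda>s'. wreg s' ''U'' = 32 ^ k \<and> wreg s' ''W'' = 2 * 32 ^ k \<and> wreg s' ''nS'' = 1 \<and> warr s' ''S'' 0 = 0)"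
  proof (rule runs_Seq_block)
    show "runs w (for_com ''i'' ''ss'' ?b) (final w ?pre s) (3 * k + 2) (\<lambda>s'. wreg s' ''U'' = 32 ^ k)"
    proof (rule runs_for[where N = k and tb = 1 and I = "\<lambda>j s'. wreg s' ''U'' = 32 ^ j"])
      fix j and s' :: state assume I: "wreg s' ''U'' = 32 ^ j" and j: "j < k"
      have "32 ^ j * 32 < (2::nat) ^ w" using le[of "Suc j"] j n by simp
      then show "runs w ?b s' 1 (\<lambda>s'. wreg s' ''U'' = 32 ^ Suc j)"
        using I w1 by (intro runs_final) (simp_all add: mult.commute)
    qed (use s kw w1 in auto)
  qed (use n w1 in simp_all)
qed simp_all

definition heavy_com :: com where
  "heavy_com = bits_com ''el'' ''la'' ;; bits_com ''N'' ''nu'' ;; root_com ;; pow_com ;;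
     vandermonde_com ;; lagrange_com ;; levels_com ;; collect_com"

definition heavy_time :: "nat \<Rightarrow> nat \<Rightarrow> nat \<Rightarrow> nat \<Rightarrow> nat \<Rightarrow> nat \<Rightarrow> nat \<Rightarrow> nat \<Rightarrow> nat \<Rightarrow> nat" where
  "heavy_time n N el s W M D Q r =
     (3 * el + 3) + ((3 * N + 3) + ((2 * (bits N * bits el) + 2) + ((3 * s + 6) +
     ((W * (4 * W + 6) + 2) + ((W * (W * (5 * W + 6) + 6) + 2) +
     ((el * (level_time n M W (32 ^ s) D Q r + 1) + 1) + (9 * M + 2)))))))"

text \<open>At scale \<open>2 ^ el\<close>, which exceeds \<open>m\<close>, every position is
  \<open>0\<close>, so the initial support is known without computation. At scale \<open>1\<close>
  the convolution is still unwrapped; adding up positions congruent modulo \<open>m\<close> finishes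
  it.\<close>

lemma runs_heavy:
  fixes ai bi :: "nat \<Rightarrow> nat"
  assumes ss: "ss = root_up (bits N * bits el)" and W: "W = 2 * 32 ^ ss"
    and lim: "limits w W (32 ^ ss) M L R Q D" and r: "M < 2 ^ r"
    and inp: "input_state na ai av nb bi bv s"
    and s: "wreg s ''m'' = m" "wreg s ''N'' = N" "wreg s ''el'' = el" "wreg s ''pw'' = 2 ^ el"
    and zero: "\<And>j. rarr s ''Z'' j = 0" "warr s ''mark'' = (\<lambda>_. 0)" "warr s ''cnt'' = (\<lambda>_. 0)"
    and c: "collected m (\<lambda>_. 0) s"
    and nab: "0 < na" "0 < nb" "na < 2 ^ w" "nb < 2 ^ w"
    and pos: "\<And>i. i < na \<Longrightarrow> av i > 0" "\<And>j. j < nb \<Longrightarrow> bv j > 0"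
    and lt: "\<And>i. i < na \<Longrightarrow> ai i < m" "\<And>j. j < nb \<Longrightarrow> bi j < m"
    and el: "0 < el" "m < 2 ^ el" "2 ^ Suc el < (2::nat) ^ w" "L = Suc el"
    and M: "\<And>q. 0 < q \<Longrightarrow> 3 * card (pair_pos ai bi q ` ({..<na} \<times> {..<nb})) \<le> M" and Mw: "M + 3 < 2 ^ w"
    and b: "2 * N + 2 < 2 ^ w" "2 * el + 2 < 2 ^ w" "(bits N * bits el + 1) * (bits N * bits el + 1) < 2 ^ w"
      "32 < (2::nat) ^ w"
  shows "runs w heavy_com s (heavy_time (na + nb) N el ss W M D Q r)
    (collected m (bucket_sum ({..<na} \<times> {..<nb}) (pair_val av bv) (wrap_pos m ai bi)))"
  unfolding heavy_com_def
proof -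
  let ?K = "{..<na} \<times> {..<nb}"
  let ?U = "32 ^ ss :: nat"
  let ?Q = "collected m (bucket_sum ?K (pair_val av bv) (wrap_pos m ai bi))"
  let ?t8 = "9 * M + 2"
  let ?t7 = "(el * (level_time (na + nb) M W ?U D Q r + 1) + 1) + ?t8"
  let ?t6 = "(W * (W * (5 * W + 6) + 6) + 2) + ?t7"
  let ?t5 = "(W * (4 * W + 6) + 2) + ?t6"
  let ?t4 = "(3 * ss + 6) + ?t5"
  let ?t3 = "(2 * (bits N * bits el) + 2) + ?t4"
  let ?t2 = "(3 * N + 3) + ?t3"
  have WW: "W * W < 2 ^ w" "0 < w"
  proof -
    show "W * W < 2 ^ w" using lim unfolding limits_def by blast
    show "0 < w" using b(4) by (cases w) auto
  qed
  have W2: "2 * 32 ^ ss < (2::nat) ^ w" using le_less_trans[OF le_square WW(1)] unfolding W .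
  have m0: "0 < m" using lt(1)[OF nab(1)] by simp
  have e3: "2 * 2 ^ el < (2::nat) ^ w" using el(3) by simp
  then have el2w: "2 ^ el < (2::nat) ^ w" by linarith
  then have mw: "m < 2 ^ w" using el(2) by linarith
  have val: "pair_val av bv k > 0" if "k \<in> ?K" for k using that pos by (auto simp: pair_val_def)
  have p1: "pair_pos ai bi 1 k + 2 \<le> 2 * m" if "k \<in> ?K" for k
    using lt(1)[of "fst k"] lt(2)[of "snd k"] that by (auto simp: pair_pos_def)
  have e2: "(2::nat) ^ L = 2 * 2 ^ el" using el by simp
  have L1: "pair_pos ai bi 1 k + 2 < 2 ^ L" if "k \<in> ?K" for k
    using p1[OF that] el(2) unfolding e2 by linarith
  have L2: "2 ^ L \<le> (2::nat) ^ w" unfolding e2 using e3 by (rule less_imp_le)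
  have elw: "2 ^ el < (2::nat) ^ w" by (rule el2w)
  have step7: "runs w (levels_com ;; collect_com) s' ?t7 ?Q"
    if st: "level_state W ?U na ai av nb bi bv (2 ^ el) s'" and c': "collected m (\<lambda>_. 0) s'" and m': "wreg s' ''m'' = m" for s'
  proof (rule runs_Seq[OF runs_levels[OF lim r nab(3,4) pos L1 L2 M Mw el(1) elw st]])
    fix s1
    assume "level_state W ?U na ai av nb bi bv 1 s1 \<and>
       (\<forall>x\<in>pair_pos ai bi 1 ` ?K. rarr s1 ''V'' x = bucket_sum ?K (pair_val av bv) (pair_pos ai bi 1) x)"
      and fr: "frame levels_com s' s1"
    then have st1: "level_state W ?U na ai av nb bi bv 1 s1"
      and V: "\<And>x. x \<in> pair_pos ai bi 1 ` ?K \<Longrightarrow> rarr s1 ''V'' x = bucket_sum ?K (pair_val av bv) (pair_pos ai bi 1) x"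
      by blast+
    define n where "n = wreg s1 ''nS''"
    define S where "S = warr s1 ''S''"
    have dS: "inj_on S {..<n}" and setS: "S ` {..<n} = pair_pos ai bi 1 ` ?K"
      using st1 unfolding level_state_def distinct_arr_list set_arr_list n_def S_def by auto
    have "n = card (S ` {..<n})" using dS by (simp add: card_image)
    then have nM: "n \<le> M" using M[of 1] unfolding setS by simp
    have c1: "collected m (\<lambda>_. 0) s1" using c' by (simp add: collected_def frameD[OF fr])
    have m1: "wreg s1 ''m'' = m" using m' by (simp add: frameD[OF fr])
    have Vp: "rarr s1 ''V'' (S t) > 0" if "t < n" for t
    proof -
      have "S t \<in> pair_pos ai bi 1 ` ?K" using that setS by blast
      then show ?thesis using V bucket_sum_pos(1)[of ?K "pair_val av bv" "S t" "pair_pos ai bi 1"] val by simp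
    qed
    have nw: "n < 2 ^ w" using nM Mw by linarith
    have "9 * n + 2 \<le> ?t8" using nM by simp
    \<comment> \<open>Wrapping is a push-forward along the residue map, so it may start from the
      recovered values instead of the pairs of entries.\<close>
    moreover have "bucket_sum {..<n} (\<lambda>t. rarr s1 ''V'' (S t)) (\<lambda>t. S t mod m) =
        bucket_sum ?K (pair_val av bv) (wrap_pos m ai bi)"
    proof
      fix y
      have "bucket_sum ?K (pair_val av bv) (wrap_pos m ai bi) y =
        (\<Sum>z\<in>S ` {..<n}. if z mod m = y then bucket_sum ?K (pair_val av bv) (pair_pos ai bi 1) z else 0)"
        using setS by (intro bucket_sum_comp) auto
      also have "\<dots> = (\<Sum>z\<in>S ` {..<n}. if z mod m = y then rarr s1 ''V'' z else 0)"
        using V unfolding setS by (intro sum.cong) auto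
      also have "\<dots> = bucket_sum {..<n} (\<lambda>t. rarr s1 ''V'' (S t)) (\<lambda>t. S t mod m) y"
        unfolding bucket_sum_def using dS by (simp add: sum.reindex)
      finally show "bucket_sum {..<n} (\<lambda>t. rarr s1 ''V'' (S t)) (\<lambda>t. S t mod m) y =
         bucket_sum ?K (pair_val av bv) (wrap_pos m ai bi) y" by simp
    qed
    ultimately show "runs w collect_com s1 ?t8 ?Q"
      using runs_collect[OF n_def[symmetric] S_def[symmetric] refl m1 m0 mw nw Vp c1]
      by (auto intro: runs_conseq)
  qed simp_all
  let ?good = "\<lambda>s'. input_state na ai av nb bi bv s' \<and> wreg s' ''m'' = m \<and> wreg s' ''N'' = N \<and> wreg s' ''el'' = el \<and>
     wreg s' ''pw'' = 2 ^ el \<and> (\<forall>j. rarr s' ''Z'' j = 0) \<and> warr s' ''mark'' = (\<lambda>_. 0) \<and> warr s' ''cnt'' = (\<lambda>_. 0) \<and>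
     collected m (\<lambda>_. 0) s'"
  have good: "?good s" using inp s zero c by blast
  let ?good4 = "\<lambda>s'. wreg s' ''U'' = 32 ^ ss \<and> wreg s' ''W'' = W \<and> wreg s' ''nS'' = 1 \<and> warr s' ''S'' 0 = 0"
  have step6: "runs w (lagrange_com ;; levels_com ;; collect_com) s' ?t6 ?Q"
    if g: "?good s'" "?good4 s'" and MV: "is_vandermonde W (rarr s' ''MV'')" for s'
  proof (rule runs_Seq)
    show "runs w lagrange_com s' (W * (W * (5 * W + 6) + 6) + 2) (\<lambda>s'. is_lagrange W (rarr s' ''Z''))"
      using g WW by (intro runs_lagrange) auto
    fix s1 assume Z: "is_lagrange W (rarr s1 ''Z'')" and fr: "frame lagrange_com s' s1"
    have "conv_env W ?U na ai av nb bi bv s1"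
      using g MV Z by (simp add: conv_env_def input_state_def frameD[OF fr])
    moreover have "arr_list (warr s1 ''S'') (wreg s1 ''nS'') = [0]"
      using g by (simp add: arr_list_def frameD[OF fr])
    moreover have "pair_pos ai bi (2 ^ el) ` ?K = {0}"
    proof -
      have "pair_pos ai bi (2 ^ el) k = 0" if "k \<in> ?K" for k
        using lt(1)[of "fst k"] lt(2)[of "snd k"] that el(2) by (auto simp: pair_pos_def)
      moreover have "(0, 0) \<in> ?K" using nab by simp
      ultimately show ?thesis by (auto simp: image_iff intro!: bexI[of _ "(0, 0)"])
    qed
    ultimately have "level_state W ?U na ai av nb bi bv (2 ^ el) s1"
      using g by (simp add: level_state_def frameD[OF fr])
    then show "runs w (levels_com ;; collect_com) s1 ?t7 ?Q"
      by (rule step7) (use g in \<open>simp_all add: collected_def frameD[OF fr]\<close>)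
  qed simp_all
  have step5: "runs w (vandermonde_com ;; lagrange_com ;; levels_com ;; collect_com) s' ?t5 ?Q"
    if g: "?good s'" "?good4 s'" for s'
  proof (rule runs_Seq)
    show "runs w vandermonde_com s' (W * (4 * W + 6) + 2) (\<lambda>s'. is_vandermonde W (rarr s' ''MV''))"
      using g WW by (intro runs_vandermonde) auto
    fix s1 assume "is_vandermonde W (rarr s1 ''MV'')" and fr: "frame vandermonde_com s' s1"
    then show "runs w (lagrange_com ;; levels_com ;; collect_com) s1 ?t6 ?Q"
      by (intro step6) (use g in \<open>simp_all add: input_state_def collected_def frameD[OF fr]\<close>)
  qed simp_all
  have step4: "runs w (pow_com ;; vandermonde_com ;; lagrange_com ;; levels_com ;; collect_com) s' ?t4 ?Q"
    if g: "?good s'" "wreg s' ''ss'' = ss" for s'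
  proof (rule runs_Seq[OF runs_pow[OF g(2) W2 b(4)]])
    fix s1 assume 1: "wreg s1 ''U'' = 32 ^ ss \<and> wreg s1 ''W'' = 2 * 32 ^ ss \<and> wreg s1 ''nS'' = 1 \<and> warr s1 ''S'' 0 = 0"
      and fr: "frame pow_com s' s1"
    have "?good s1" using g by (simp add: input_state_def collected_def frameD[OF fr])
    then show "runs w (vandermonde_com ;; lagrange_com ;; levels_com ;; collect_com) s1 ?t5 ?Q"
      by (rule step5) (use 1 W in simp)
  qed simp_all
  have step3: "runs w (root_com ;; pow_com ;; vandermonde_com ;; lagrange_com ;; levels_com ;; collect_com) s' ?t3 ?Q"
    if g: "?good s'" "wreg s' ''nu'' = bits N" "wreg s' ''la'' = bits el" for s'
  proof (rule runs_Seq[OF runs_root[OF g(2,3) b(3)]])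
    fix s1 assume 1: "wreg s1 ''ss'' = root_up (bits N * bits el)" and fr: "frame root_com s' s1"
    have "?good s1" using g by (simp add: input_state_def collected_def frameD[OF fr])
    then show "runs w (pow_com ;; vandermonde_com ;; lagrange_com ;; levels_com ;; collect_com) s1 ?t4 ?Q"
      by (rule step4) (use 1 ss in simp)
  qed simp_all
  have step2: "runs w (bits_com ''N'' ''nu'' ;; root_com ;; pow_com ;; vandermonde_com ;; lagrange_com ;; levels_com ;; collect_com) s' ?t2 ?Q"
    if g: "?good s'" "wreg s' ''la'' = bits el" for s'
  proof (rule runs_Seq)
    show "runs w (bits_com ''N'' ''nu'') s' (3 * N + 3) (\<lambda>s'. wreg s' ''nu'' = bits N)"
      using g b by (intro runs_bits) auto
    fix s1 assume 1: "wreg s1 ''nu'' = bits N" and fr: "frame (bits_com ''N'' ''nu'') s' s1"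
    have "?good s1" using g by (simp add: input_state_def collected_def frameD[OF fr])
    then show "runs w (root_com ;; pow_com ;; vandermonde_com ;; lagrange_com ;; levels_com ;; collect_com) s1 ?t3 ?Q"
      by (rule step3) (use 1 g in \<open>simp_all add: frameD[OF fr]\<close>)
  qed simp_all
  show "runs w (bits_com ''el'' ''la'' ;; bits_com ''N'' ''nu'' ;; root_com ;; pow_com ;; vandermonde_com ;; lagrange_com ;;
     levels_com ;; collect_com) s (heavy_time (na + nb) N el ss W M D Q r) ?Q"
  proof (rule runs_Seq)
    show "runs w (bits_com ''el'' ''la'') s (3 * el + 3) (\<lambda>s'. wreg s' ''la'' = bits el)"
      using s b by (intro runs_bits) auto
    fix s1 assume 1: "wreg s1 ''la'' = bits el" and fr: "frame (bits_com ''el'' ''la'') s s1"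
    have "?good s1" using good by (simp add: input_state_def collected_def frameD[OF fr])
    then show "runs w (bits_com ''N'' ''nu'' ;; root_com ;; pow_com ;; vandermonde_com ;; lagrange_com ;; levels_com ;; collect_com) s1 ?t2 ?Q"
      using 1 by (rule step2)
  qed (simp add: heavy_time_def)
qed

text \<open>Finding the bit length of \<open>m\<close> takes about \<open>log m\<close> steps, too
  many when the output is tiny. The scan therefore gives up once \<open>el\<close> exceeds
  \<open>N\<close>; then \<open>N\<close> is at most \<open>log m\<close>, and the quadratic
  algorithm is fast enough.\<close>

definition log_com :: com where
  "log_com = (Cond (WLess (WReg ''lenA'') (WReg ''lenB'')) (WAssign ''N'' (WReg ''lenB'')) (WAssign ''N'' (WReg ''lenA'')) ;;
       WAssign ''el'' (WConst 0) ;; WAssign ''pw'' (WConst 1)) ;;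
     While (BAnd (BNot (WLess (WReg ''m'') (WReg ''pw''))) (BNot (WLess (WReg ''N'') (WReg ''el'')))) (
       WAssign ''pw'' (WMul (WConst 2) (WReg ''pw'')) ;; WAssign ''el'' (WAdd (WReg ''el'') (WConst 1)))"

lemma wr_log [simp]:
  "wr_wreg log_com = {''N'', ''el'', ''pw''}" "wr_warr log_com = {}" "wr_rreg log_com = {}" "wr_rarr log_com = {}"
  by (auto simp: log_com_def)

lemma runs_log:
  assumes s: "wreg s ''lenA'' = na" "wreg s ''lenB'' = nb" "wreg s ''m'' = m"
    and m: "0 < m" "2 * m < 2 ^ w" and N: "N = max na nb" "N + 2 < 2 ^ w"
  shows "runs w log_com s (3 * N + 9)
    (\<lambda>s'. wreg s' ''N'' = N \<and> wreg s' ''pw'' = 2 ^ wreg s' ''el'' \<and> wreg s' ''el'' \<le> Suc N \<and>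
       (m < wreg s' ''pw'' \<or> N < wreg s' ''el'') \<and> 0 < wreg s' ''el'' \<and> 2 ^ (wreg s' ''el'' - 1) \<le> m)"
  unfolding log_com_def
proof (rule runs_block_Seq)
  have "2 < (2::nat) ^ w" using N by linarith
  then have w1: "(2::nat) mod 2 ^ w = 2" "(1::nat) mod 2 ^ w = 1" by (intro mod_less, linarith)+
  let ?pre = "Cond (WLess (WReg ''lenA'') (WReg ''lenB'')) (WAssign ''N'' (WReg ''lenB'')) (WAssign ''N'' (WReg ''lenA'')) ;;
       WAssign ''el'' (WConst 0) ;; WAssign ''pw'' (WConst 1)"
  let ?b = "WAssign ''pw'' (WMul (WConst 2) (WReg ''pw'')) ;; WAssign ''el'' (WAdd (WReg ''el'') (WConst 1))"
  let ?c = "BAnd (BNot (WLess (WReg ''m'') (WReg ''pw''))) (BNot (WLess (WReg ''N'') (WReg ''el'')))"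
  let ?Q = "\<lambda>s'. wreg s' ''N'' = N \<and> wreg s' ''pw'' = 2 ^ wreg s' ''el'' \<and> wreg s' ''el'' \<le> Suc N \<and>
       (m < wreg s' ''pw'' \<or> N < wreg s' ''el'') \<and> 0 < wreg s' ''el'' \<and> 2 ^ (wreg s' ''el'' - 1) \<le> m"
  show "runs w (While ?c ?b) (final w ?pre s) (3 * N + 4) ?Q"
  proof (rule runs_While[where n = "N + 1" and tb = 2 and
      I = "\<lambda>k s'. wreg s' ''el'' = k \<and> wreg s' ''pw'' = 2 ^ k \<and> k \<le> Suc N \<and> (0 < k \<longrightarrow> 2 ^ (k - 1) \<le> m)"])
    fix k s'
    assume I: "wreg s' ''el'' = k \<and> wreg s' ''pw'' = 2 ^ k \<and> k \<le> Suc N \<and> (0 < k \<longrightarrow> 2 ^ (k - 1) \<le> m)"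
      and fr: "frame ?b (final w ?pre s) s'"
    have v: "wreg s' ''m'' = m" "wreg s' ''N'' = N" using s N(1) by (auto simp: frameD[OF fr])
    {
      assume "bval w ?c s'"
      then have le: "2 ^ k \<le> m" "k \<le> N" using I v by auto
      then show "k < N + 1" by simp
      have "2 * 2 ^ k < (2::nat) ^ w" "k + 1 < 2 ^ w" using le m N by linarith+
      then show "runs w ?b s' 2 (\<lambda>s'. wreg s' ''el'' = Suc k \<and> wreg s' ''pw'' = 2 ^ Suc k \<and> Suc k \<le> Suc N \<and>
          (0 < Suc k \<longrightarrow> 2 ^ (Suc k - 1) \<le> m))"
        using I le w1 by (intro runs_final) auto
    next
      assume nb: "\<not> bval w ?c s'"
      then have o: "m < 2 ^ k \<or> N < k" using I v by auto
      have "0 < k" using o m by (cases k) auto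
      then show "?Q s'" using I v o by auto
    }
  qed (use w1 in auto)
qed simp_all

text \<open>The inner guards say that the scan reached the bit length of \<open>m\<close>, that the
  inputs are long enough to have paid for it, and that \<open>log (log m)\<close> is at least one.
  If an input list is empty, the initial \<open>lenC = 0\<close> already describes the zero
  output.\<close>

definition main_com :: com where
  "main_com = Cond (BAnd (WLess (WConst 0) (WReg ''lenA'')) (WLess (WConst 0) (WReg ''lenB'')))
     (log_com ;;
      Cond (BAnd (BAnd (WLess (WReg ''m'') (WReg ''pw'')) (BNot (WLess (WReg ''N'') (WReg ''el'')))) (BNot (WLess (WReg ''m'') (WConst 4))))
        heavy_com brute_com ;;
      copy_com) Skip"

subsection \<open>Bounds on the parameters\<close>

lemma bits_gt: "n < 2 ^ bits n"
  unfolding bits_def by (rule LeastI[of _ n]) (rule less_exp)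

lemma bits_le: "n < 2 ^ k \<Longrightarrow> bits n \<le> k"
  unfolding bits_def by (rule Least_le)

lemma power_le_of_less_bits: "k < bits n \<Longrightarrow> 2 ^ k \<le> n"
  unfolding bits_def using not_less_Least[of k "\<lambda>k. n < 2 ^ k"] by simp

lemma bits_mono: "a \<le> b \<Longrightarrow> bits a \<le> bits b"
  using bits_le[of a "bits b"] bits_gt[of b] by linarith

lemma root_up_ge: "n \<le> root_up n * root_up n"
  unfolding root_up_def by (rule LeastI[of _ n]) (rule le_square)

lemma root_up_le: "n \<le> k * k \<Longrightarrow> root_up n \<le> k"
  unfolding root_up_def by (rule Least_le)

lemma square_less_of_less_root_up: "k < root_up n \<Longrightarrow> k * k < n"
  unfolding root_up_def using not_less_Least[of k "\<lambda>k. n \<le> k * k"] by simp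

lemma power_32: "(32::nat) ^ s = (2 ^ s) ^ 5"
proof -
  have "((2::nat) ^ 5) ^ s = (2 ^ s) ^ 5" by (simp only: power_mult[symmetric] mult.commute)
  then show ?thesis by simp
qed

section \<open>Parameters for inputs at least as long as the bit length of the dimension\<close>

context
  fixes m el N n s la nu :: nat
  assumes m: "4 \<le> m" and el: "m < 2 ^ el" "2 ^ (el - 1) \<le> m" "el \<le> N"
    and N: "N \<le> n" "n \<le> N * N" "n \<le> m"
  defines "la \<equiv> bits el" and "nu \<equiv> bits N"
  defines "s \<equiv> root_up (nu * la)"
begin

text \<open>\<open>el \<le> N\<close> yields \<open>la \<le> nu\<close>, and \<open>s\<close> is the
  square root of their product, rounded up, hence lies between them. The inequality
  \<open>la \<le> s\<close> keeps the exponent \<open>5 * s - 4 * la\<close> of the reduction factor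
  at least \<open>s\<close>.\<close>

lemma scale_facts:
  shows "2 \<le> la" "la \<le> nu" "nu \<le> el" "el < 2 ^ la" "nu * la \<le> s * s" "la \<le> s" "s \<le> nu"
    "N < 2 ^ nu" "2 ^ s \<le> 2 * N" "3 \<le> el"
proof -
  show el3: "3 \<le> el"
  proof (rule ccontr)
    assume "\<not> 3 \<le> el"
    then have "(2::nat) ^ el \<le> 2 ^ 2" by (intro power_increasing) auto
    then show False using el m by simp
  qed
  show ella: "el < 2 ^ la" unfolding la_def by (rule bits_gt)
  show la2: "2 \<le> la"
  proof (rule ccontr)
    assume "\<not> 2 \<le> la"
    then have "(2::nat) ^ la \<le> 2 ^ 1" by (intro power_increasing) auto
    then show False using ella el3 by simp
  qed
  show lanu: "la \<le> nu" unfolding la_def nu_def using el by (intro bits_mono)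
  show "nu \<le> el" unfolding nu_def using N el by (intro bits_le) linarith
  show sq: "nu * la \<le> s * s" unfolding s_def by (rule root_up_ge)
  show "la \<le> s"
  proof (rule ccontr)
    assume "\<not> la \<le> s"
    then have "s * s < la * la" by (intro mult_strict_mono) auto
    also have "\<dots> \<le> nu * la" using lanu by (rule mult_le_mono1)
    finally show False using sq by simp
  qed
  show snu: "s \<le> nu" unfolding s_def using lanu by (intro root_up_le) simp
  show "N < 2 ^ nu" unfolding nu_def by (rule bits_gt)
  have "2 ^ (nu - 1) \<le> N" using la2 lanu by (intro power_le_of_less_bits) (auto simp: nu_def[symmetric])
  moreover have "(2::nat) ^ nu = 2 * 2 ^ (nu - 1)" using la2 lanu by (simp flip: power_Suc)
  moreover have "(2::nat) ^ s \<le> 2 ^ nu" using snu by (rule power_increasing) simp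
  ultimately show "2 ^ s \<le> 2 * N" by linarith
qed

text \<open>About \<open>2 ^ (5 * s) / (5 * s)\<close> primes are available. Of the four factors
  \<open>2 ^ la\<close> that separate the reduction factor from \<open>2 ^ (5 * s)\<close>, one pays
  for \<open>Suc el\<close>, one for \<open>s \<le> el\<close>, and the other two, at least
  \<open>16\<close> together, for the constants.\<close>

lemma enough_primes:
  "2 ^ (5 * s - 4 * la) * Suc el \<le> card {p::nat. prime p \<and> p \<le> 32 ^ s}"
proof -
  note f = scale_facts
  let ?R = "2 ^ (5 * s - 4 * la) :: nat" and ?c = "card {p::nat. prime p \<and> p \<le> 32 ^ s}"
  have e32: "(32::nat) ^ s = 2 ^ (5 * s)" by (simp add: power_mult)
  have R: "?R * 2 ^ (4 * la) = 2 ^ (5 * s)" using f by (simp flip: power_add)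
  have 16: "16 \<le> (2::nat) ^ la * 2 ^ la"
    using mult_le_mono[OF power_increasing[of 2 la "2::nat"] power_increasing[of 2 la "2::nat"]] f by simp
  have "?R * Suc el * (5 * s) * 16 \<le> ?R * Suc el * (5 * s) * (2 ^ la * 2 ^ la)" by (intro mult_le_mono2 16)
  also have "\<dots> \<le> ?R * 2 ^ la * (5 * 2 ^ la) * (2 ^ la * 2 ^ la)"
    using f by (intro mult_le_mono le_refl) auto
  also have "\<dots> = 5 * (?R * 2 ^ (4 * la))"
  proof -
    have "(2::nat) ^ (4 * la) = 2 ^ la * 2 ^ la * (2 ^ la * 2 ^ la)" by (simp flip: power_add)
    then show ?thesis by (simp only: mult_ac)
  qed
  also have "\<dots> = 5 * 2 ^ (5 * s)" unfolding R ..
  finally have "?R * Suc el * (5 * s) * 16 \<le> 5 * 2 ^ (5 * s)" .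
  moreover have "(0::nat) < 2 ^ (5 * s)" by simp
  ultimately have "?R * Suc el * (5 * s) \<le> 2 ^ (5 * s) - 1" by linarith
  also have "\<dots> \<le> 5 * s * ?c" using card_primes_le_power_of_two[of "5 * s"] f unfolding e32 by simp
  finally have "?R * Suc el * (5 * s) \<le> ?c * (5 * s)" by (simp add: mult.commute)
  then show ?thesis using f by simp
qed

text \<open>Since \<open>la \<le> s\<close>, the reduction factor \<open>R\<close> is at least
  \<open>2 ^ s\<close>, so \<open>R ^ k < 48 * n\<close> bounds \<open>s * k\<close> by
  \<open>8 * nu\<close>; multiplying by \<open>la\<close> and using
  \<open>nu * la \<le> s * s\<close> gives \<open>k * la \<le> 8 * s\<close>. As
  \<open>W = R * 2 ^ (4 * la + 1)\<close>, the \<open>k\<close> axes waste only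
  \<open>2 ^ (40 * s)\<close> beyond \<open>R ^ k\<close>, and the axis about to be added
  contributes one more \<open>W\<close>, whence the exponent \<open>45\<close>.\<close>

lemma rank_bound:
  assumes k: "(2 ^ (5 * s - 4 * la)) ^ k < 4 * (12 * n)"
  shows "k < 8 * s + 1" "(2 * 32 ^ s) ^ Suc k \<le> 96 * n * (2 ^ s) ^ 45"
proof -
  note f = scale_facts
  let ?R = "2 ^ (5 * s - 4 * la) :: nat"
  have "(2 ^ s) ^ k \<le> ?R ^ k" using f by (intro power_mono power_increasing) auto
  then have "2 ^ (s * k) < 48 * n" using k by (simp add: power_mult)
  also have "\<dots> \<le> 48 * (2 ^ nu * 2 ^ nu)"
    using N mult_le_mono[of N "2 ^ nu" N "2 ^ nu"] f by simp
  also have "\<dots> \<le> 2 ^ 6 * (2 ^ nu * 2 ^ nu)" by simp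
  also have "\<dots> = 2 ^ (6 + (nu + nu))" by (simp only: power_add)
  finally have "s * k < 6 + (nu + nu)" by (rule power_less_imp_less_exp[rotated]) simp
  also have "\<dots> \<le> 8 * nu" using f by linarith
  finally have "s * k * la \<le> 8 * nu * la" by (intro mult_le_mono1) simp
  also have "\<dots> \<le> 8 * (s * s)" using f by simp
  finally have "s * (k * la) \<le> s * (8 * s)" by (simp add: mult_ac)
  then have kla: "k * la \<le> 8 * s" using f by simp
  have "k \<le> k * la" using f by simp
  then show "k < 8 * s + 1" using kla by linarith
  have "(2 * 32 ^ s) = (2::nat) ^ (5 * s + 1)" by (simp add: power_mult)
  also have "\<dots> = ?R * 2 ^ (4 * la + 1)" using f by (simp flip: power_add)
  finally have W: "(2 * 32 ^ s) = ?R * 2 ^ (4 * la + 1)" .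
  have "(4 * la + 1) * k \<le> 5 * la * k" using f by (intro mult_le_mono1) linarith
  also have "\<dots> = 5 * (k * la)" by simp
  also have "\<dots> \<le> 40 * s" using kla by linarith
  finally have e: "(4 * la + 1) * k \<le> 40 * s" .
  have "(2 * 32 ^ s) ^ k = ?R ^ k * (2 ^ (4 * la + 1)) ^ k" unfolding W by (rule power_mult_distrib)
  also have "(2 ^ (4 * la + 1)) ^ k = (2::nat) ^ ((4 * la + 1) * k)" by (simp only: power_mult)
  also have "?R ^ k * 2 ^ ((4 * la + 1) * k) \<le> 48 * n * 2 ^ (40 * s)"
    using mult_le_mono[OF less_imp_le[OF k] power_increasing[OF e, of "2::nat"]] by simp
  finally have "(2 * 32 ^ s) ^ Suc k \<le> 2 * 32 ^ s * (48 * n * 2 ^ (40 * s))" by simp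
  also have "\<dots> = 96 * n * (2 ^ (5 * s) * 2 ^ (40 * s))" by (simp add: power_mult)
  also have "\<dots> = 96 * n * (2 ^ s) ^ 45" by (simp only: power_add[symmetric] power_mult[symmetric]) (simp add: mult.commute)
  finally show "(2 * 32 ^ s) ^ Suc k \<le> 96 * n * (2 ^ s) ^ 45" .
qed

text \<open>This fixes the number of rounds per level, because each round halves the unresolved
  candidates; \<open>n \<le> N * N\<close> makes \<open>nu\<close> count twice.\<close>

lemma candidates_less: "12 * n < 2 ^ (4 + 2 * nu)"
proof -
  note f = scale_facts
  have "N * N < 2 ^ nu * 2 ^ nu" using f by (intro mult_strict_mono) auto
  then have "12 * n < 2 ^ 4 * (2 ^ nu * 2 ^ nu)" using N by simp
  then show ?thesis by (simp only: power_add mult_2)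
qed

text \<open>Origin of the word-length exponent \<open>100\<close>: with \<open>b = m + 1\<close> one
  has \<open>2 ^ s \<le> b ^ 2\<close>, so the tensor bound is at most
  \<open>b ^ 3 * b * b ^ 90 = b ^ 94\<close>. The other quantities are bounded by smaller powers of
  \<open>b\<close>.\<close>

lemma word_bounds:
  assumes w: "(m + 1) ^ 100 \<le> 2 ^ w"
  shows "limits w (2 * 32 ^ s) (32 ^ s) (12 * n) (Suc el) (2 ^ (5 * s - 4 * la)) (96 * n * (2 ^ s) ^ 45) (8 * s + 1)"
    "12 * n + 3 < 2 ^ w" "2 ^ Suc el < (2::nat) ^ w" "2 * el + 2 < 2 ^ w" "(nu * la + 1) * (nu * la + 1) < 2 ^ w"
proof -
  note f = scale_facts
  define b where "b = m + 1"
  have b: "5 \<le> b" using m by (simp add: b_def)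
  have pw: "b ^ k < 2 ^ w" if "k < 100" for k
  proof -
    have "b ^ k < b ^ 100" using that b by (intro power_strict_increasing) auto
    then show ?thesis using w unfolding b_def by linarith
  qed
  have nb: "n \<le> b" "N \<le> b" using N by (auto simp: b_def)
  have b2: "5 * b \<le> b ^ 2" using b by (simp add: power2_eq_square)
  have b3: "25 * b \<le> b ^ 3" and b4: "125 \<le> b ^ 3"
  proof -
    have "5 * 5 * b \<le> b * b * b" using b by (intro mult_le_mono) auto
    then show "25 * b \<le> b ^ 3" by (simp add: power3_eq_cube)
    have "5 * 5 * 5 \<le> b * b * b" using b by (intro mult_le_mono) auto
    then show "125 \<le> b ^ 3" by (simp add: power3_eq_cube)
  qed
  have E: "2 ^ s \<le> b ^ 2" using f(9) nb b2 by linarith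
  have E10: "(2 ^ s) ^ 10 \<le> (b ^ 2) ^ 10" and E45: "(2 ^ s) ^ 45 \<le> (b ^ 2) ^ 45"
    using E by (intro power_mono; simp)+
  have "96 * n * (2 ^ s) ^ 45 \<le> b ^ 3 * b * (b ^ 2) ^ 45"
    using b4 nb E45 by (intro mult_le_mono) auto
  also have "\<dots> = b ^ 94" by (simp flip: power_mult power_add power_Suc2)
  also have "\<dots> < 2 ^ w" by (rule pw) simp
  finally have Q: "96 * n * (2 ^ s) ^ 45 < 2 ^ w" .
  have "2 * 32 ^ s * (2 * 32 ^ s) = 4 * ((2::nat) ^ s) ^ 10"
    unfolding power_32 by (simp flip: power_add)
  also have "\<dots> \<le> b ^ 3 * (b ^ 2) ^ 10" using b4 E10 by (intro mult_le_mono) auto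
  also have "\<dots> = b ^ 23" by (simp flip: power_mult power_add)
  also have "\<dots> < 2 ^ w" by (rule pw) simp
  finally have WW: "2 * 32 ^ s * (2 * 32 ^ s) < (2::nat) ^ w" .
  have "4 * (12 * n * (12 * n)) = 576 * (n * n)" by simp
  also have "\<dots> \<le> b ^ 3 * b ^ 3 * (b * b)" using b4 nb mult_le_mono[OF b4 b4] by (intro mult_le_mono) auto
  also have "\<dots> = b ^ 8" by (simp flip: power_add power2_eq_square)
  also have "\<dots> < 2 ^ w" by (rule pw) simp
  finally have MM: "4 * (12 * n * (12 * n)) < 2 ^ w" .
  have M3: "12 * n + 3 < b ^ 3" using nb b3 b by linarith
  also have "b ^ 3 < 2 ^ w" by (rule pw) simp
  finally show M: "12 * n + 3 < 2 ^ w" .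
  then have M1: "Suc (12 * n) < 2 ^ w" by linarith
  show "limits w (2 * 32 ^ s) (32 ^ s) (12 * n) (Suc el) (2 ^ (5 * s - 4 * la)) (96 * n * (2 ^ s) ^ 45) (8 * s + 1)"
    unfolding limits_def using WW MM M1 enough_primes rank_bound Q by simp
  have "(2::nat) ^ el = 2 * 2 ^ (el - 1)" using f by (simp flip: power_Suc)
  then have "2 ^ Suc el \<le> 4 * m" using el by simp
  also have "\<dots> < 25 * b" by (simp add: b_def)
  also have "\<dots> \<le> b ^ 3" by (rule b3)
  also have "\<dots> < 2 ^ w" by (rule pw) simp
  finally show "2 ^ Suc el < (2::nat) ^ w" .
  have "2 * el + 2 < 25 * b" using el nb b by linarith
  also have "\<dots> \<le> b ^ 3" by (rule b3)
  also have "\<dots> < 2 ^ w" by (rule pw) simp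
  finally show "2 * el + 2 < 2 ^ w" .
  have "nu \<le> b" "la \<le> b" using f el nb by linarith+
  then have "nu * la \<le> b * b" by (rule mult_le_mono)
  then have "nu * la + 1 \<le> 5 * (b * b)" using b le_square[of b] by linarith
  also have "\<dots> \<le> b * (b * b)" using b by (rule mult_le_mono1)
  finally have "nu * la + 1 \<le> b ^ 3" by (simp add: power3_eq_cube mult.assoc)
  then have "(nu * la + 1) * (nu * la + 1) \<le> b ^ 3 * b ^ 3" by (intro mult_le_mono)
  also have "\<dots> = b ^ 6" by (simp flip: power_add)
  also have "\<dots> < 2 ^ w" by (rule pw) simp
  finally show "(nu * la + 1) * (nu * la + 1) < 2 ^ w" .
qed

text \<open>With \<open>E = 2 ^ s\<close> the exponent \<open>54\<close> is the sum of
  \<open>45\<close> for the tensor size, \<open>5\<close> for the factor \<open>W\<close> of an axis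
  transform, one for the number of axes, two for the rounds and one for the levels. The search for
  moduli and the two tables are of lower order in \<open>E\<close>.\<close>

lemma heavy_time_le:
  assumes n': "n' \<le> 2 * n"
  shows "heavy_time n' N el s (2 * 32 ^ s) (12 * n) (8 * s + 1) (96 * n * (2 ^ s) ^ 45) (4 + 2 * nu)
    \<le> 160000 * (n * (2 ^ s) ^ 54)"
proof -
  note f = scale_facts
  define E where "E = (2::nat) ^ s"
  have E1: "1 \<le> E" by (simp add: E_def)
  have n1: "1 \<le> n" using N f el by linarith
  have sE: "s < E" unfolding E_def by (rule less_exp)
  have U: "32 ^ s = E ^ 5" unfolding E_def by (rule power_32)
  have pw: "n * E ^ a \<le> n * E ^ b" if "a \<le> b" for a b using that E1 by (intro mult_le_mono2 power_increasing) auto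
  have pw1: "E ^ a \<le> n * E ^ b" if "a \<le> b" for a b
    using pw[OF that] mult_le_mono1[OF n1, of "E ^ a"] by linarith
  have pwn: "n \<le> n * E ^ b" for b using pw[of 0 b] by simp
  have one: "1 \<le> n * E ^ b" for b using pwn[of b] n1 by linarith
  define D where "D = 8 * s + 1"
  have D: "D \<le> 9 * E" using sE by (simp add: D_def)
  define Q where "Q = 96 * n * E ^ 45"
  define W where "W = 2 * E ^ 5"
  have E5: "1 \<le> E ^ 5" using E1 by simp
  have select: "select_time (12 * n) (E ^ 5) D \<le> 1545 * (n * E ^ 6)"
  proof -
    have "E ^ 5 * (9 * (12 * n) + 12) + 3 * (12 * n) + 11 \<le> E ^ 5 * (120 * n) + 47 * n"
      using n1 mult_le_mono2[of "9 * (12 * n) + 12" "120 * n" "E ^ 5"] by linarith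
    also have "\<dots> \<le> 167 * (n * E ^ 5)" using pwn[of 5] by (simp add: mult_ac)
    finally have "D * (E ^ 5 * (9 * (12 * n) + 12) + 3 * (12 * n) + 11) \<le> 9 * E * (167 * (n * E ^ 5))"
      using D by (intro mult_le_mono)
    also have "\<dots> = 1503 * (n * (E * E ^ 5))" by (simp add: mult_ac)
    also have "E * E ^ 5 = E ^ 6" by (simp flip: power_Suc)
    finally show ?thesis unfolding select_time_def using pwn[of 6] n1 by linarith
  qed
  have D44: "4 * D + 8 \<le> 44 * E" using D E1 by linarith
  have conv: "conv_bound n' W D Q \<le> 50774 * (n * E ^ 51)"
  proof -
    have 1: "n' * (4 * D + 8) \<le> 88 * (n * E ^ 1)"
      using mult_le_mono[OF n' D44] by (simp add: mult_ac)
    have "3 * W + 13 \<le> 19 * E ^ 5" using E5 by (simp add: W_def)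
    then have "Q * (3 * W + 13) \<le> 96 * n * E ^ 45 * (19 * E ^ 5)" unfolding Q_def by (rule mult_le_mono2)
    also have "\<dots> = 1824 * (n * (E ^ 45 * E ^ 5))" by (simp add: mult_ac)
    also have "E ^ 45 * E ^ 5 = E ^ 50" by (simp flip: power_add)
    finally have 2: "3 * (Q * (3 * W + 13)) \<le> 5472 * (n * E ^ 50)" by linarith
    have "7 * W + 5 \<le> 19 * E ^ 5" using E5 by (simp add: W_def)
    then have "W * (7 * W + 5) \<le> 2 * E ^ 5 * (19 * E ^ 5)" unfolding W_def by (rule mult_le_mono2)
    also have "\<dots> = 38 * (E ^ 5 * E ^ 5)" by simp
    also have "E ^ 5 * E ^ 5 = E ^ 10" by (simp flip: power_add)
    finally have 3: "W * (7 * W + 5) \<le> 38 * (n * E ^ 50)" using pw1[of 10 50] by linarith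
    have "3 * (Q * (3 * W + 13)) + W * (7 * W + 5) + 24 \<le> 5534 * (n * E ^ 50)"
      using 2 3 one[of 50] by linarith
    then have "D * (3 * (Q * (3 * W + 13)) + W * (7 * W + 5) + 24) \<le> 9 * E * (5534 * (n * E ^ 50))"
      using D by (intro mult_le_mono)
    also have "\<dots> = 49806 * (n * (E * E ^ 50))" by (simp add: mult_ac)
    also have "E * E ^ 50 = E ^ 51" by (simp flip: power_Suc)
    finally have 4: "D * (3 * (Q * (3 * W + 13)) + W * (7 * W + 5) + 24) \<le> 49806 * (n * E ^ 51)" .
    have 5: "9 * Q \<le> 864 * (n * E ^ 51)" using pw[of 45 51] by (simp add: Q_def)
    show ?thesis unfolding conv_bound_def using 1 4 5 pw[of 1 51] one[of 51] by linarith
  qed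
  have round: "round_time n' (12 * n) W (E ^ 5) D Q \<le> 53013 * (n * E ^ 51)"
  proof -
    have "12 * n * (4 * D + 8) \<le> 12 * n * (44 * E)" using D44 by (rule mult_le_mono2)
    also have "\<dots> = 528 * (n * E ^ 1)" by simp
    finally show ?thesis unfolding round_time_def
      using select conv pw[of 6 51] pw[of 1 51] pwn[of 51] one[of 51] by linarith
  qed
  define r where "r = 4 + 2 * nu"
  \<comment> \<open>\<open>nu\<close> may be larger than \<open>s\<close>, so it is bounded through
    \<open>nu * la \<le> s * s\<close>; the summand \<open>4\<close> is covered by
    \<open>2 \<le> s\<close>.\<close>
  have "2 * 2 \<le> s * s" using f by (intro mult_le_mono) auto
  moreover have "nu \<le> nu * la" using f by simp
  ultimately have "r \<le> 3 * (s * s)" using f(5) unfolding r_def by linarith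
  moreover have ssE: "s * s \<le> E ^ 2" using sE by (simp add: power2_eq_square mult_le_mono)
  ultimately have r: "r \<le> 3 * E ^ 2" by linarith
  have level: "level_time n' (12 * n) W (E ^ 5) D Q r \<le> 159544 * (n * E ^ 53)"
  proof -
    have "round_time n' (12 * n) W (E ^ 5) D Q + 1 \<le> 53014 * (n * E ^ 51)" using round one[of 51] by linarith
    then have "r * (round_time n' (12 * n) W (E ^ 5) D Q + 1) \<le> 3 * E ^ 2 * (53014 * (n * E ^ 51))"
      using r by (intro mult_le_mono)
    also have "\<dots> = 159042 * (n * (E ^ 2 * E ^ 51))" by (simp add: mult_ac)
    also have "E ^ 2 * E ^ 51 = E ^ 53" by (simp flip: power_add)
    finally show ?thesis unfolding level_time_def using pwn[of 53] one[of 53] by linarith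
  qed
  \<comment> \<open>The number of levels is about \<open>log m\<close>, yet
    \<open>el < 2 ^ la\<close> and \<open>la \<le> s\<close> let \<open>2 ^ s\<close> absorb
    it.\<close>
  have elE: "el \<le> E"
  proof -
    have "(2::nat) ^ la \<le> 2 ^ s" using f by (intro power_increasing) auto
    then show ?thesis using f(4) unfolding E_def by linarith
  qed
  have levels: "el * (level_time n' (12 * n) W (E ^ 5) D Q r + 1) + 1 \<le> 159546 * (n * E ^ 54)"
  proof -
    have "level_time n' (12 * n) W (E ^ 5) D Q r + 1 \<le> 159545 * (n * E ^ 53)" using level one[of 53] by linarith
    then have "el * (level_time n' (12 * n) W (E ^ 5) D Q r + 1) \<le> E * (159545 * (n * E ^ 53))"
      using elE by (intro mult_le_mono)
    also have "\<dots> = 159545 * (n * (E * E ^ 53))" by (simp add: mult_ac)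
    also have "E * E ^ 53 = E ^ 54" by (simp flip: power_Suc)
    finally show ?thesis using one[of 54] by linarith
  qed
  have vander: "W * (4 * W + 6) + 2 \<le> 30 * (n * E ^ 54)"
  proof -
    have "4 * W + 6 \<le> 14 * E ^ 5" using E5 by (simp add: W_def)
    then have "W * (4 * W + 6) \<le> 2 * E ^ 5 * (14 * E ^ 5)" unfolding W_def by (rule mult_le_mono2)
    also have "\<dots> = 28 * (E ^ 5 * E ^ 5)" by simp
    also have "E ^ 5 * E ^ 5 = E ^ 10" by (simp flip: power_add)
    finally show ?thesis using pw1[of 10 54] one[of 54] by linarith
  qed
  have lagr: "W * (W * (5 * W + 6) + 6) + 2 \<le> 78 * (n * E ^ 54)"
  proof -
    have "5 * W + 6 \<le> 16 * E ^ 5" using E5 by (simp add: W_def)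
    then have "W * (5 * W + 6) \<le> 2 * E ^ 5 * (16 * E ^ 5)" unfolding W_def by (rule mult_le_mono2)
    also have "\<dots> = 32 * (E ^ 5 * E ^ 5)" by simp
    also have "E ^ 5 * E ^ 5 = E ^ 10" by (simp flip: power_add)
    finally have "W * (5 * W + 6) + 6 \<le> 38 * E ^ 10" using one_le_power[OF E1, of 10] by linarith
    then have "W * (W * (5 * W + 6) + 6) \<le> 2 * E ^ 5 * (38 * E ^ 10)" unfolding W_def by (rule mult_le_mono2)
    also have "\<dots> = 76 * (E ^ 5 * E ^ 10)" by simp
    also have "E ^ 5 * E ^ 10 = E ^ 15" by (simp flip: power_add)
    finally show ?thesis using pw1[of 15 54] one[of 54] by linarith
  qed
  have "nu * la \<le> E ^ 2" using f(5) ssE by linarith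
  then have "2 * (nu * la) + 2 \<le> 4 * (n * E ^ 54)" using pw1[of 2 54] one[of 54] by linarith
  moreover have "3 * el + 3 \<le> 6 * (n * E ^ 54)" "3 * s + 6 \<le> 9 * (n * E ^ 54)"
    using elE sE pw1[of 1 54] one[of 54] by simp_all
  moreover have "3 * N + 3 \<le> 6 * (n * E ^ 54)" "9 * (12 * n) + 2 \<le> 110 * (n * E ^ 54)"
    using N(1) pwn[of 54] one[of 54] by linarith+
  ultimately show ?thesis
    using levels vander lagr
    unfolding heavy_time_def nu_def[symmetric] la_def[symmetric] E_def[symmetric] U
      D_def[symmetric] Q_def[symmetric] W_def[symmetric] r_def[symmetric] by linarith
qed

text \<open>Rounding costs only constants: \<open>nu \<le> 2 * log n\<close>,
  \<open>la \<le> 3 * log (log m)\<close>, and \<open>s - 1\<close> is below the square root of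
  \<open>nu * la\<close>. All logarithms involved are at least one because \<open>4 \<le> m\<close>,
  so additive terms turn into factors.\<close>

lemma real_scale_bound:
  "real s \<le> 4 * sqrt (log 2 (real n) * log 2 (log 2 (real m)))" "1 \<le> log 2 (real n) * log 2 (log 2 (real m))"
proof -
  note f = scale_facts
  let ?ln = "log 2 (real n)" and ?lm = "log 2 (real m)" and ?llm = "log 2 (log 2 (real m))"
  have n3: "3 \<le> n" using f el N by linarith
  have "log 2 2 \<le> ?ln" using n3 by (subst log_le_cancel_iff) auto
  then have ln1: "1 \<le> ?ln" by simp
  have "log 2 (2 ^ 2) \<le> ?lm" using m by (subst log_le_cancel_iff) auto
  moreover have "log 2 ((2::real) ^ 2) = 2" using log_pow_cancel[of "2::real" 2] by simp
  ultimately have lm2: "2 \<le> ?lm" by linarith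
  have "log 2 2 \<le> ?llm" using lm2 by (subst log_le_cancel_iff) auto
  then have llm1: "1 \<le> ?llm" by simp
  have "1 * 1 \<le> ?ln * ?llm" using ln1 llm1 by (intro mult_mono) auto
  then show x1: "1 \<le> ?ln * ?llm" by simp
  have bits_log: "real (bits k) \<le> log 2 (real k) + 1" if "0 < k" for k
  proof (cases "bits k")
    case (Suc b)
    then have "2 ^ b \<le> k" by (intro power_le_of_less_bits) simp
    then have "real (2 ^ b) \<le> real k" by (simp only: of_nat_le_iff)
    then have "log 2 (real (2 ^ b)) \<le> log 2 (real k)" using that by (subst log_le_cancel_iff) auto
    then show ?thesis using Suc by (simp add: log_nat_power)
  qed (use that in simp)
  have "real nu \<le> log 2 (real N) + 1" unfolding nu_def using f el by (intro bits_log) linarith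
  also have "log 2 (real N) \<le> ?ln" using f el N by (subst log_le_cancel_iff) auto
  finally have nu: "real nu \<le> 2 * ?ln" using ln1 by linarith
  have "2 ^ (el - 1) \<le> real m" using el(2) by (metis of_nat_le_iff of_nat_numeral of_nat_power)
  then have "log 2 (2 ^ (el - 1)) \<le> ?lm" using m by (subst log_le_cancel_iff) auto
  then have "real (el - 1) \<le> ?lm" by (simp add: log_nat_power)
  then have "real el \<le> 2 * ?lm" using lm2 by linarith
  then have "log 2 (real el) \<le> log 2 (2 * ?lm)" using f lm2 by (subst log_le_cancel_iff) auto
  also have "\<dots> = 1 + ?llm" using lm2 by (subst log_mult) auto
  finally have "log 2 (real el) \<le> 1 + ?llm" .
  moreover have "real la \<le> log 2 (real el) + 1" unfolding la_def using f by (intro bits_log) linarith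
  ultimately have la: "real la \<le> 3 * ?llm" using llm1 by linarith
  have "real (s - 1) ^ 2 \<le> real (nu * la)"
  proof -
    have "(s - 1) * (s - 1) < nu * la"
      using f by (intro square_less_of_less_root_up) (simp add: s_def[symmetric])
    then have "real ((s - 1) * (s - 1)) \<le> real (nu * la)" by (simp only: of_nat_le_iff)
    then show ?thesis by (simp add: power2_eq_square)
  qed
  also have "\<dots> \<le> (2 * ?ln) * (3 * ?llm)" unfolding of_nat_mult using nu la ln1 by (intro mult_mono) auto
  also have "\<dots> \<le> (3 * sqrt (?ln * ?llm))\<^sup>2" using x1 by (simp add: power_mult_distrib)
  finally have "(real (s - 1))\<^sup>2 \<le> (3 * sqrt (?ln * ?llm))\<^sup>2" .
  then have "real (s - 1) \<le> 3 * sqrt (?ln * ?llm)" by (rule power2_le_imp_le) (use x1 in simp)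
  moreover have "1 \<le> sqrt (?ln * ?llm)" using x1 by simp
  ultimately show "real s \<le> 4 * sqrt (?ln * ?llm)" by linarith
qed

end

subsection \<open>Correctness and running time\<close>

text \<open>The maximum with \<open>1\<close> covers the zero output. For \<open>m = 1\<close> and
  \<open>n \<le> 1\<close> the left logarithm vanishes, so the product is zero whatever
  \<open>log 2 0\<close> is.\<close>

definition time_factor :: "nat \<Rightarrow> nat \<Rightarrow> real" where
  "time_factor m n = sqrt (log 2 (max 1 (real n)) * log 2 (log 2 (real m)))"

lemma log_log_nonneg: "2 \<le> m \<Longrightarrow> 0 \<le> log 2 (log 2 (real m))"
proof -
  assume "2 \<le> m"
  then have "log 2 2 \<le> log 2 (real m)" by (subst log_le_cancel_iff) auto
  then show ?thesis by simp
qed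

lemma time_factor_nonneg:
  assumes "0 < m" "n \<le> m"
  shows "0 \<le> time_factor m n"
proof (cases "m = 1")
  case True
  then have "max 1 (real n) = 1" using assms by auto
  then show ?thesis by (simp add: time_factor_def)
next
  case False
  then show ?thesis using log_log_nonneg[of m] assms by (simp add: time_factor_def)
qed

lemma brute_factor:
  assumes N: "0 < N" "N \<le> n" and m: "2 ^ N \<le> m" "4 \<le> m"
  shows "real N \<le> 2 powr time_factor m n"
proof -
  have "real (2 ^ N) \<le> real m" using m(1) by (simp only: of_nat_le_iff)
  then have "log 2 (2 ^ N) \<le> log 2 (real m)" using m(2) by (subst log_le_cancel_iff) auto
  then have Nm: "real N \<le> log 2 (real m)" by (simp add: log_nat_power)
  then have "log 2 (real N) \<le> log 2 (log 2 (real m))" using N by (subst log_le_cancel_iff) auto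
  moreover have "log 2 (real N) \<le> log 2 (max 1 (real n))" using N by (subst log_le_cancel_iff) auto
  moreover have "0 \<le> log 2 (real N)" using N by simp
  ultimately have "log 2 (real N) * log 2 (real N) \<le> log 2 (max 1 (real n)) * log 2 (log 2 (real m))"
    by (intro mult_mono) auto
  then have "log 2 (real N) \<le> time_factor m n"
    unfolding time_factor_def by (intro real_le_rsqrt) (simp add: power2_eq_square)
  then have "2 powr log 2 (real N) \<le> 2 powr time_factor m n" by simp
  then show ?thesis using N by simp
qed

lemma bucket_sum_cong:
  assumes "\<And>k. k \<in> K \<Longrightarrow> v k = v' k" "\<And>k. k \<in> K \<Longrightarrow> x k = x' k"
  shows "bucket_sum K v x = bucket_sum K v' x'"
  unfolding bucket_sum_def using assms by (intro ext sum.cong) auto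

text \<open>One constant serves as factor and inside the exponent; \<open>200000\<close> leaves room
  above the \<open>160000\<close> of the heavy branch for the linear extra work. The bound of
  \<open>nnz (A \<star> B)\<close> by \<open>m\<close> is recorded for the running time in terms of
  \<open>m\<close>.\<close>

lemma runs_main:
  fixes A B :: "real vec"
  assumes m: "0 < m" and w: "(m + 1) ^ 100 \<le> 2 ^ w"
    and A: "A \<in> carrier_vec m" and B: "B \<in> carrier_vec m"
    and nonneg: "\<forall>i<m. A $ i \<ge> 0" "\<forall>i<m. B $ i \<ge> 0"
    and xs: "sparse_rep xs A" and ys: "sparse_rep ys B"
  shows "\<exists>t. runs w main_com (init_state m xs ys) t (\<lambda>s. sparse_rep (result s) (A \<star> B)) \<and>
    nnz (A \<star> B) \<le> m \<and>
    real t \<le> 200000 * max 1 (real (nnz (A \<star> B))) * 2 powr (200000 * time_factor m (nnz (A \<star> B)))"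
proof -
  define na nb where "na = length xs" and "nb = length ys"
  define ai bi where "ai = (\<lambda>i. if i < na then fst (xs ! i) else 0)" and "bi = (\<lambda>i. if i < nb then fst (ys ! i) else 0)"
  define av bv where "av = (\<lambda>i. if i < na then snd (xs ! i) else 0)" and "bv = (\<lambda>i. if i < nb then snd (ys ! i) else 0)"
  let ?K = "{..<na} \<times> {..<nb}"
  let ?s = "init_state m xs ys"
  define F where "F = bucket_sum ?K (pair_val av bv) (wrap_pos m ai bi)"
  define n where "n = nnz (A \<star> B)"
  define N where "N = max na nb"
  have dim: "dim_vec (A \<star> B) = m" using A by (simp add: wrap_conv_def Let_def)
  have Feq: "(A \<star> B) $ r = F r" if "r < m" for r
    unfolding wrap_conv_eq_bucket_sum[OF xs A ys B that] F_def na_def[symmetric] nb_def[symmetric]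
    by (rule fun_cong[OF bucket_sum_cong]) (auto simp: pair_val_def pair_pos_def ai_def bi_def av_def bv_def)
  have lt: "i < na \<Longrightarrow> ai i < m" "j < nb \<Longrightarrow> bi j < m" for i j
    using sparse_rep_nth(1)[OF xs A, of i] sparse_rep_nth(1)[OF ys B, of j] by (auto simp: ai_def bi_def na_def nb_def)
  have posA: "0 < av i" if "i < na" for i
    using sparse_rep_nth[OF xs A, of i] nonneg(1) that by (auto simp: av_def na_def less_le)
  have posB: "0 < bv j" if "j < nb" for j
    using sparse_rep_nth[OF ys B, of j] nonneg(2) that by (auto simp: bv_def nb_def less_le)
  have val: "0 < pair_val av bv k" if "k \<in> ?K" for k using that posA posB by (auto simp: pair_val_def)
  have Fsupp: "F y \<noteq> 0 \<longleftrightarrow> y \<in> wrap_pos m ai bi ` ?K" for y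
    using bucket_sum_pos[of ?K "pair_val av bv" y "wrap_pos m ai bi"] val unfolding F_def by force
  have wm: "y < m" if "y \<in> wrap_pos m ai bi ` ?K" for y using that m by auto
  have Fm: "y < m" if "F y \<noteq> 0" for y using wm Fsupp that by blast
  have Fset: "{y. F y \<noteq> 0} = wrap_pos m ai bi ` ?K" using Fsupp by blast
  have nF: "n = card {y. F y \<noteq> 0}"
  proof -
    have "{i. i < m \<and> (A \<star> B) $ i \<noteq> 0} = {y. F y \<noteq> 0}" using Feq Fm by auto
    then show ?thesis by (simp add: n_def nnz_def dim)
  qed
  have rep: "sparse_rep (result s) (A \<star> B)" if "distinct (result s) \<and> set (result s) = {(y, F y) | y. F y \<noteq> 0}" for s
  proof -
    have "{(y, F y) | y. F y \<noteq> 0} = {(i, (A \<star> B) $ i) | i. i < m \<and> (A \<star> B) $ i \<noteq> 0}"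
      using Feq Fm by force
    then show ?thesis using that by (simp add: sparse_rep_def dim)
  qed
  have nm: "n \<le> m"
  proof -
    have "card {y. F y \<noteq> 0} \<le> card {..<m}" using Fm by (intro card_mono) auto
    then show ?thesis by (simp add: nF)
  qed
  have tf: "0 \<le> time_factor m n" by (rule time_factor_nonneg[OF m nm])
  then have tf1: "1 \<le> 2 powr (200000 * time_factor m n)" by (simp add: ge_one_powr_ge_zero)
  have init: "input_state na ai av nb bi bv ?s" "wreg ?s ''m'' = m" "wreg ?s ''lenA'' = na" "wreg ?s ''lenB'' = nb"
    "rarr ?s ''Z'' = (\<lambda>_. 0)" "warr ?s ''mark'' = (\<lambda>_. 0)" "warr ?s ''cnt'' = (\<lambda>_. 0)" "collected m (\<lambda>_. 0) ?s"
    "wreg ?s ''lenC'' = 0"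
    by (simp_all add: init_state_def input_state_def collected_def na_def nb_def ai_def bi_def av_def bv_def)
  let ?cond = "BAnd (WLess (WConst 0) (WReg ''lenA'')) (WLess (WConst 0) (WReg ''lenB''))"
  have cond: "bval w ?cond ?s \<longleftrightarrow> 0 < na \<and> 0 < nb" using init by simp
  show ?thesis
  proof (cases "0 < na \<and> 0 < nb")
    case False
    then have K: "?K = {}" by auto
    have "F y = 0" for y unfolding F_def bucket_sum_def K by simp
    then have "distinct (result ?s) \<and> set (result ?s) = {(y, F y) | y. F y \<noteq> 0}" using init by (simp add: result_def)
    then have "runs w main_com ?s 2 (\<lambda>s. sparse_rep (result s) (A \<star> B))"
      unfolding main_com_def using False cond rep by (intro runs_Cond[where t = 1] runs_final) auto
    moreover have "real 2 \<le> 200000 * max 1 (real n) * 2 powr (200000 * time_factor m n)"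
    proof -
      have "2 * 1 * 1 \<le> 200000 * max 1 (real n) * 2 powr (200000 * time_factor m n)"
        using tf1 by (intro mult_mono) auto
      then show ?thesis by simp
    qed
    ultimately show ?thesis using nm unfolding n_def by blast
  next
    case True
    then have nab: "0 < na" "0 < nb" by auto
    have sumset: "wrap_pos m ai bi ` ?K = (\<lambda>k. (ai (fst k) + bi (snd k)) mod m) ` ?K"
      by (simp add: pair_pos_def)
    have inj: "inj_on ai {..<na}" "inj_on bi {..<nb}"
      using sparse_rep_inj[OF xs A] sparse_rep_inj[OF ys B]
      by (auto simp: inj_on_def ai_def bi_def na_def nb_def)
    have na_n: "na \<le> n" unfolding nF Fset sumset by (rule length_le_card_sumset[OF inj(1) lt(1) nab(2)])
    have nb_n: "nb \<le> n" unfolding nF Fset sumset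
      by (subst sumset_commute) (rule length_le_card_sumset[OF inj(2) lt(2) nab(1)])
    have N: "N \<le> n" "0 < N" using na_n nb_n nab by (auto simp: N_def)
    have "n \<le> card ?K" unfolding nF Fset by (rule card_image_le) simp
    also have "\<dots> = na * nb" by simp
    also have "\<dots> \<le> N * N" by (intro mult_le_mono) (auto simp: N_def)
    finally have nNN: "n \<le> N * N" .
    have n1: "1 \<le> n" using N by linarith
    have mpow: "(m + 1) ^ k \<le> 2 ^ w" if "k \<le> 100" for k
      using power_increasing[OF that, of "m + 1"] w by simp
    have m2: "m * m + 2 * m + 1 \<le> 2 ^ w" using mpow[of 2] by (simp add: power2_eq_square algebra_simps)
    have "1 \<le> m * m" using m by simp
    then have mw: "2 * m < 2 ^ w" "m < 2 ^ w" "m + 2 < 2 ^ w" using m2 m by linarith+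
    have nw: "na < 2 ^ w" "nb < 2 ^ w" "N + 2 < 2 ^ w" using N na_n nb_n nm mw by linarith+
    have w32: "32 < (2::nat) ^ w"
    proof -
      have "(2::nat) ^ 6 \<le> (m + 1) ^ 6" using m by (intro power_mono) auto
      also have "\<dots> \<le> 2 ^ w" by (rule mpow) simp
      finally show ?thesis by simp
    qed
    then have w4: "(4::nat) mod 2 ^ w = 4" by (intro mod_less) linarith
    let ?hc = "BAnd (BAnd (WLess (WReg ''m'') (WReg ''pw'')) (BNot (WLess (WReg ''N'') (WReg ''el'')))) (BNot (WLess (WReg ''m'') (WConst 4)))"
    define tb where "tb = na * (9 * nb + 4) + 2"
    have brute: "runs w brute_com s' tb (collected m F)"
      if "input_state na ai av nb bi bv s'" "wreg s' ''m'' = m" "collected m (\<lambda>_. 0) s'" for s'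
      unfolding F_def tb_def
      by (rule runs_brute[OF that(1,2) m mw(1) nw(1,2) lt posA posB that(3)])
    have finish: "runs w (Cond ?hc heavy_com brute_com ;; copy_com) s' (th + 1 + (3 * n + 2)) (\<lambda>s. sparse_rep (result s) (A \<star> B))"
      if "bval w ?hc s' \<Longrightarrow> runs w heavy_com s' th (collected m F)"
        "\<not> bval w ?hc s' \<Longrightarrow> runs w brute_com s' th (collected m F)" for s' th
    proof (rule runs_Seq)
      show "runs w (Cond ?hc heavy_com brute_com) s' (th + 1) (collected m F)"
        by (rule runs_Cond[OF that]) simp_all
      fix s1 assume c: "collected m F s1"
      show "runs w copy_com s1 (3 * n + 2) (\<lambda>s. sparse_rep (result s) (A \<star> B))"
        unfolding nF by (rule runs_conseq[OF runs_copy[OF c mw(2)]]) (use rep in auto)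
    qed simp
    have whole: "runs w main_com ?s (th + 3 * N + 3 * n + 13) (\<lambda>s. sparse_rep (result s) (A \<star> B))"
      if h: "\<And>s' el. input_state na ai av nb bi bv s' \<Longrightarrow> wreg s' ''m'' = m \<Longrightarrow> collected m (\<lambda>_. 0) s' \<Longrightarrow>
         wreg s' ''N'' = N \<Longrightarrow> wreg s' ''pw'' = 2 ^ el \<Longrightarrow> wreg s' ''el'' = el \<Longrightarrow>
         rarr s' ''Z'' = (\<lambda>_. 0) \<Longrightarrow> warr s' ''mark'' = (\<lambda>_. 0) \<Longrightarrow> warr s' ''cnt'' = (\<lambda>_. 0) \<Longrightarrow>
         0 < el \<Longrightarrow> 2 ^ (el - 1) \<le> m \<Longrightarrow> m < 2 ^ el \<Longrightarrow> el \<le> N \<Longrightarrow> 4 \<le> m \<Longrightarrow>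
         runs w heavy_com s' th (collected m F)"
       and b: "m < 4 \<or> 2 ^ N \<le> m \<Longrightarrow> tb \<le> th" for th
      unfolding main_com_def
    proof (rule runs_Cond[where t = "3 * N + 9 + (th + 1 + (3 * n + 2))"])
      assume "bval w ?cond ?s"
      show "runs w (log_com ;; Cond ?hc heavy_com brute_com ;; copy_com) ?s (3 * N + 9 + (th + 1 + (3 * n + 2)))
        (\<lambda>s. sparse_rep (result s) (A \<star> B))"
      proof (rule runs_Seq[OF runs_log[OF init(3,4,2) m mw(1) N_def nw(3)]])
        fix s1
        assume 1: "wreg s1 ''N'' = N \<and> wreg s1 ''pw'' = 2 ^ wreg s1 ''el'' \<and> wreg s1 ''el'' \<le> Suc N \<and>
          (m < wreg s1 ''pw'' \<or> N < wreg s1 ''el'') \<and> 0 < wreg s1 ''el'' \<and> 2 ^ (wreg s1 ''el'' - 1) \<le> m"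
          and fr: "frame log_com ?s s1"
        have i1: "input_state na ai av nb bi bv s1" "wreg s1 ''m'' = m" "collected m (\<lambda>_. 0) s1"
          "rarr s1 ''Z'' = (\<lambda>_. 0)" "warr s1 ''mark'' = (\<lambda>_. 0)" "warr s1 ''cnt'' = (\<lambda>_. 0)"
          using init by (simp_all add: input_state_def collected_def frameD[OF fr])
        have hc: "bval w ?hc s1 \<longleftrightarrow> m < wreg s1 ''pw'' \<and> wreg s1 ''el'' \<le> N \<and> 4 \<le> m"
          using i1 1 w4 by auto
        show "runs w (Cond ?hc heavy_com brute_com ;; copy_com) s1 (th + 1 + (3 * n + 2)) (\<lambda>s. sparse_rep (result s) (A \<star> B))"
        proof (rule finish)
          assume "bval w ?hc s1"
          then show "runs w heavy_com s1 th (collected m F)" using 1 i1 hc by (intro h[where el = "wreg s1 ''el''"]) auto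
        next
          assume "\<not> bval w ?hc s1"
          \<comment> \<open>The scan stops at \<open>Suc N\<close> at the latest, so exceeding
            \<open>N\<close> means \<open>el = Suc N\<close>, and its last successful test reads
            \<open>2 ^ N \<le> m\<close>.\<close>
          then have "m < 4 \<or> N < wreg s1 ''el''" using hc 1 by auto
          then have "m < 4 \<or> wreg s1 ''el'' = Suc N" using 1 by auto
          then have "m < 4 \<or> 2 ^ N \<le> m" using 1 by auto
          then show "runs w brute_com s1 th (collected m F)"
            using b by (intro runs_conseq[OF brute[OF i1(1,2,3)]]) auto
        qed
      qed simp
    qed (use True cond in auto)
    have bound: "\<exists>t. runs w main_com ?s t (\<lambda>s. sparse_rep (result s) (A \<star> B)) \<and> nnz (A \<star> B) \<le> m \<and>
       real t \<le> 200000 * max 1 (real (nnz (A \<star> B))) * 2 powr (200000 * time_factor m (nnz (A \<star> B)))"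
      if r: "runs w main_com ?s (th + 3 * N + 3 * n + 13) (\<lambda>s. sparse_rep (result s) (A \<star> B))"
        and t: "real th \<le> 190000 * (real n * 2 powr (200000 * time_factor m n))" for th
    proof -
      have "1 * 1 \<le> real n * 2 powr (200000 * time_factor m n)" using tf1 n1 by (intro mult_mono) auto
      moreover have "real n * 1 \<le> real n * 2 powr (200000 * time_factor m n)" using tf1 by (intro mult_left_mono) auto
      ultimately have "real (th + 3 * N + 3 * n + 13) \<le> 200000 * (real n * 2 powr (200000 * time_factor m n))"
        using t N(1) by simp
      then show ?thesis using r nm n1 unfolding n_def[symmetric]
        by (intro exI[of _ "th + 3 * N + 3 * n + 13"]) (auto simp: max_def)
    qed
    show ?thesis
    proof (cases "m < 4 \<or> 2 ^ N \<le> m")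
      case brute_case: True
      \<comment> \<open>In this case the guard of the heavy branch is unsatisfiable, so the premise
        about \<open>heavy_com\<close> holds vacuously.\<close>
      have nh: "\<not> (m < 2 ^ el \<and> el \<le> N \<and> 4 \<le> m)" for el
      proof
        assume a: "m < 2 ^ el \<and> el \<le> N \<and> 4 \<le> m"
        then have "(2::nat) ^ el \<le> 2 ^ N" by (intro power_increasing) auto
        then show False using a brute_case by linarith
      qed
      have "runs w main_com ?s (tb + 3 * N + 3 * n + 13) (\<lambda>s. sparse_rep (result s) (A \<star> B))"
        by (rule whole) (use nh in blast)+
      moreover have "real tb \<le> 190000 * (real n * 2 powr (200000 * time_factor m n))"
      proof -
        have "na * (9 * nb + 4) \<le> N * (9 * n + 4 * n)"
          using nb_n n1 by (intro mult_le_mono) (auto simp: N_def)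
        then have "tb \<le> N * (13 * n) + 2" by (simp add: tb_def algebra_simps)
        moreover have "1 * 1 \<le> n * N" using N n1 by (intro mult_le_mono) auto
        moreover have "N * (13 * n) = 13 * (n * N)" by simp
        ultimately have "tb \<le> 15 * (n * N)" by linarith
        then have "real tb \<le> 15 * (real n * real N)" by (metis of_nat_le_iff of_nat_mult of_nat_numeral)
        also have "real N \<le> 3 * 2 powr (200000 * time_factor m n)"
        proof (cases "4 \<le> m")
          case True
          then have "real N \<le> 2 powr time_factor m n" using brute_case N by (intro brute_factor) auto
          also have "\<dots> \<le> 2 powr (200000 * time_factor m n)" using tf by (intro powr_mono) auto
          finally show ?thesis using tf1 by linarith
        next
          case False
          then have "N \<le> 3" using N nm by linarith
          then show ?thesis using tf1 by linarith
        qed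
        finally have "real tb \<le> 15 * (real n * (3 * 2 powr (200000 * time_factor m n)))" by (simp add: mult_left_mono)
        also have "\<dots> = 45 * (real n * 2 powr (200000 * time_factor m n))" by simp
        also have "\<dots> \<le> 190000 * (real n * 2 powr (200000 * time_factor m n))" by (intro mult_right_mono) auto
        finally show ?thesis .
      qed
      ultimately show ?thesis by (rule bound)
    next
      case False
      then have m4: "4 \<le> m" and mN: "m < 2 ^ N" by auto
      \<comment> \<open>The two inequalities pin down the bit length, so the value found by the scan
        can be replaced by \<open>bits m\<close>.\<close>
      have el_unique: "el = bits m" if "0 < el" "2 ^ (el - 1) \<le> m" "m < 2 ^ el" for el
      proof (rule antisym)
        show "bits m \<le> el" using that by (intro bits_le)
        show "el \<le> bits m"
        proof (rule ccontr)
          assume "\<not> el \<le> bits m"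
          then have "(2::nat) ^ bits m \<le> 2 ^ (el - 1)" by (intro power_increasing) auto
          then show False using bits_gt[of m] that by linarith
        qed
      qed
      define el where "el = bits m"
      define ss where "ss = root_up (bits N * bits el)"
      have el: "m < 2 ^ el" "2 ^ (el - 1) \<le> m" "el \<le> N"
      proof -
        show "m < 2 ^ el" unfolding el_def by (rule bits_gt)
        have "0 < bits m" using bits_gt[of m] m4 by (cases "bits m") auto
        then show "2 ^ (el - 1) \<le> m" unfolding el_def by (intro power_le_of_less_bits) simp
        show "el \<le> N" unfolding el_def using mN by (rule bits_le)
      qed
      have el0: "0 < el" using el m4 by (cases el) auto
      note wb = word_bounds[OF m4 el N(1) nNN nm w, folded ss_def]
      have tn: "na + nb \<le> 2 * n" using na_n nb_n by linarith
      \<comment> \<open>Origin of the factor \<open>12\<close>: three offsets per position, two for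
        the passage between scales and two for unwrapping.\<close>
      have M: "3 * card (pair_pos ai bi q ` ?K) \<le> 12 * n" if "0 < q" for q
      proof -
        have "card (pair_pos ai bi q ` ?K) \<le> 2 * card (pair_pos ai bi 1 ` ?K)"
          by (rule card_pair_pos_le[OF _ that]) simp
        moreover have "card (pair_pos ai bi 1 ` ?K) \<le> 2 * card ((\<lambda>s. s mod m) ` pair_pos ai bi 1 ` ?K)"
        proof (rule card_le_card_mod)
          fix s assume "s \<in> pair_pos ai bi 1 ` ?K"
          then obtain i j where "i < na" "j < nb" "s = ai i + bi j" by (auto simp: pair_pos_def)
          then show "s < 2 * m" using lt(1)[of i] lt(2)[of j] by linarith
        qed simp
        moreover have "card ((\<lambda>s. s mod m) ` pair_pos ai bi 1 ` ?K) = n" unfolding nF Fset by (simp add: image_image)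
        ultimately show ?thesis by linarith
      qed
      define th where "th = heavy_time (na + nb) N el ss (2 * 32 ^ ss) (12 * n) (8 * ss + 1) (96 * n * (2 ^ ss) ^ 45) (4 + 2 * bits N)"
      have "runs w main_com ?s (th + 3 * N + 3 * n + 13) (\<lambda>s. sparse_rep (result s) (A \<star> B))"
      proof (rule whole)
        fix s' el' assume s': "input_state na ai av nb bi bv s'" "wreg s' ''m'' = m" "collected m (\<lambda>_. 0) s'"
           "wreg s' ''N'' = N" "wreg s' ''pw'' = 2 ^ el'" "wreg s' ''el'' = el'"
           "rarr s' ''Z'' = (\<lambda>_. 0)" "warr s' ''mark'' = (\<lambda>_. 0)" "warr s' ''cnt'' = (\<lambda>_. 0)"
           "0 < el'" "2 ^ (el' - 1) \<le> m" "m < 2 ^ el'"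
        have [simp]: "el' = el" unfolding el_def by (rule el_unique[OF s'(10,11,12)])
        show "runs w heavy_com s' th (collected m F)"
          unfolding th_def F_def
        proof (rule runs_heavy[OF ss_def refl wb(1) candidates_less[OF m4 el N(1) nNN nm] s'(1,2,4) _ _ _ s'(8,9,3)
              nab nw(1,2) posA posB lt el0 el(1) wb(3) refl M wb(2) _ wb(4,5) w32])
          show "wreg s' ''el'' = el" "wreg s' ''pw'' = 2 ^ el" using s' by simp_all
          show "\<And>j. rarr s' ''Z'' j = 0" using s' by simp
          show "2 * N + 2 < 2 ^ w" using N nm m2 \<open>1 \<le> m * m\<close> m4 mult_le_mono1[OF m4, of m] by linarith
        qed
      qed (use False in auto)
      moreover have "real th \<le> 190000 * (real n * 2 powr (200000 * time_factor m n))"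
      proof -
        have "th \<le> 160000 * (n * (2 ^ ss) ^ 54)"
          unfolding th_def by (rule heavy_time_le[OF m4 el N(1) nNN nm tn, folded ss_def])
        then have "real th \<le> real (160000 * (n * (2 ^ ss) ^ 54))" by (simp only: of_nat_le_iff)
        also have "\<dots> = 160000 * (real n * 2 powr (54 * real ss))"
          by (simp add: powr_realpow[symmetric] powr_powr mult.commute)
        also have "\<dots> \<le> 160000 * (real n * 2 powr (200000 * time_factor m n))"
        proof -
          have "real ss \<le> 4 * time_factor m n"
            using real_scale_bound(1)[OF m4 el N(1) nNN nm, folded ss_def] n1
            by (simp add: time_factor_def max_def)
          \<comment> \<open>The exponent really needed is \<open>54 * 4 = 216\<close>; the common
            constant is far larger.\<close>
          then have "54 * real ss \<le> 200000 * time_factor m n" using tf by linarith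
          then show ?thesis by (intro mult_left_mono powr_mono) auto
        qed
        also have "\<dots> \<le> 190000 * (real n * 2 powr (200000 * time_factor m n))" by (intro mult_right_mono) auto
        finally show ?thesis .
      qed
      ultimately show ?thesis by (rule bound)
    qed
  qed
qed

lemma runs_exec:
  assumes "runs w c s t0 Q" "real t0 \<le> T"
  shows "\<exists>t s'. exec w c s t s' \<and> Q s' \<and> real t \<le> T"
proof -
  obtain t s' where "exec w c s t s'" "t \<le> t0" "Q s'" using assms(1) by (auto simp: runs_def)
  moreover then have "real t \<le> T" using assms(2) by linarith
  ultimately show ?thesis by blast
qed

lemma wrap_conv_algorithm_main:
  "wrap_conv_algorithm 100 main_com (\<lambda>m n. 200000 * max 1 (real n) * 2 powr (200000 * time_factor m n))"
  unfolding wrap_conv_algorithm_def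
proof (intro allI impI)
  fix m w :: nat and A B :: "real vec" and xs ys :: "(nat \<times> real) list"
  assume "m > 0" "(m + 1) ^ 100 \<le> 2 ^ w" "A \<in> carrier_vec m" "B \<in> carrier_vec m"
    "\<forall>i<m. A $ i \<ge> 0" "\<forall>i<m. B $ i \<ge> 0" "sparse_rep xs A" "sparse_rep ys B"
  from runs_main[OF this] obtain t0 where "runs w main_com (init_state m xs ys) t0 (\<lambda>s. sparse_rep (result s) (A \<star> B))"
    "real t0 \<le> 200000 * max 1 (real (nnz (A \<star> B))) * 2 powr (200000 * time_factor m (nnz (A \<star> B)))" by blast
  then show "\<exists>t s. exec w main_com (init_state m xs ys) t s \<and> sparse_rep (result s) (A \<star> B) \<and>
    real t \<le> 200000 * max 1 (real (nnz (A \<star> B))) * 2 powr (200000 * time_factor m (nnz (A \<star> B)))"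
    by (rule runs_exec)
qed

text \<open>For \<open>2 \<le> m\<close> this makes \<open>m powr exponent m\<close> equal to
  \<open>2\<close> raised to \<open>200000 * sqrt (log m * log (log m))\<close>. Under the root only
  one factor \<open>log m\<close> occurs, so the quotient tends to zero.\<close>

definition exponent :: "nat \<Rightarrow> real" where
  "exponent m = 200000 * sqrt (log 2 (real m) * log 2 (log 2 (real m))) / log 2 (real m)"

lemma exponent_tendsto: "exponent \<longlonglongrightarrow> 0"
  unfolding exponent_def[abs_def] by real_asymp

text \<open>Replacing \<open>n\<close> by its bound \<open>m\<close> under the root leaves an
  exponent that depends on \<open>m\<close> alone; for \<open>m = 1\<close> both sides are
  one.\<close>

lemma time_factor_le_exponent:
  assumes m: "0 < m" and n: "n \<le> m"
  shows "2 powr (200000 * time_factor m n) \<le> real m powr exponent m"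
proof (cases "m = 1")
  case True
  then have "max 1 (real n) = 1" using n by auto
  then show ?thesis using True by (simp add: time_factor_def)
next
  case False
  then have m2: "2 \<le> m" using m by simp
  have "log 2 (max 1 (real n)) \<le> log 2 (real m)" using n m by (subst log_le_cancel_iff) auto
  then have le: "time_factor m n \<le> sqrt (log 2 (real m) * log 2 (log 2 (real m)))"
    unfolding time_factor_def using log_log_nonneg[OF m2] by (intro real_sqrt_le_mono mult_right_mono)
  have "log 2 2 \<le> log 2 (real m)" using m2 by (subst log_le_cancel_iff) auto
  then have lm: "1 \<le> log 2 (real m)" by simp
  have "real m powr exponent m = (2 powr log 2 (real m)) powr exponent m" using m by simp
  also have "\<dots> = 2 powr (log 2 (real m) * exponent m)" by (rule powr_powr)
  also have "log 2 (real m) * exponent m = 200000 * sqrt (log 2 (real m) * log 2 (log 2 (real m)))"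
    using lm by (simp add: exponent_def)
  finally show ?thesis using le by simp
qed

theorem theorem1:
  "\<exists>(P :: com) (c :: nat). c \<ge> 1 \<and>
     (\<exists>K :: real. K > 0 \<and>
        wrap_conv_algorithm c P (\<lambda>m n.
          K * max 1 (real n) *
            2 powr (K * sqrt (log 2 (max 1 (real n)) * log 2 (log 2 (real m)))))) \<and>
     (\<exists>(K :: real) (g :: nat \<Rightarrow> real). K > 0 \<and> g \<longlonglongrightarrow> 0 \<and>
        wrap_conv_algorithm c P (\<lambda>m n. K * max 1 (real n) * real m powr g m))"
proof (intro exI conjI)
  show "wrap_conv_algorithm 100 main_com (\<lambda>m n. 200000 * max 1 (real n) *
      2 powr (200000 * sqrt (log 2 (max 1 (real n)) * log 2 (log 2 (real m)))))"
    using wrap_conv_algorithm_main unfolding time_factor_def .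
  show "exponent \<longlonglongrightarrow> 0" by (rule exponent_tendsto)
  show "wrap_conv_algorithm 100 main_com (\<lambda>m n. 200000 * max 1 (real n) * real m powr exponent m)"
    unfolding wrap_conv_algorithm_def
  proof (intro allI impI)
    fix m w :: nat and A B :: "real vec" and xs ys :: "(nat \<times> real) list"
    assume a: "m > 0" "(m + 1) ^ 100 \<le> 2 ^ w" "A \<in> carrier_vec m" "B \<in> carrier_vec m"
      "\<forall>i<m. A $ i \<ge> 0" "\<forall>i<m. B $ i \<ge> 0" "sparse_rep xs A" "sparse_rep ys B"
    obtain t0 where t0: "runs w main_com (init_state m xs ys) t0 (\<lambda>s. sparse_rep (result s) (A \<star> B))"
      "nnz (A \<star> B) \<le> m"
      "real t0 \<le> 200000 * max 1 (real (nnz (A \<star> B))) * 2 powr (200000 * time_factor m (nnz (A \<star> B)))"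
      using runs_main[OF a] by blast
    \<comment> \<open>The step count is taken from \<open>runs_main\<close>, which also provides
      \<open>nnz (A \<star> B) \<le> m\<close>, the condition for passing to the exponent in
      \<open>m\<close>.\<close>
    have "real t0 \<le> 200000 * max 1 (real (nnz (A \<star> B))) * real m powr exponent m"
      using t0(3) mult_left_mono[OF time_factor_le_exponent[OF a(1) t0(2)], of "200000 * max 1 (real (nnz (A \<star> B)))"]
      by simp
    then show "\<exists>t s. exec w main_com (init_state m xs ys) t s \<and> sparse_rep (result s) (A \<star> B) \<and>
        real t \<le> 200000 * max 1 (real (nnz (A \<star> B))) * real m powr exponent m"
      by (rule runs_exec[OF t0(1)])
  qed
qed simp_all

end
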